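(* Let $d\geq3$ and let $P\subset\mathbb R^d$ be a full-dimensional polytope. If the set of edge-2-faces of $P$ can be partitioned into pairs of edge-2-faces that compensate each other, then $P$ is equiprojective.
   Context: For a $2$-face $F$ of $P$, $\mathrm{Span}[F]$ denotes the unique $2$-dimensional linear subspace parallel to $F$; two $2$-faces are parallel if they have the same $\mathrm{Span}[\cdot]$; a class of 2-faces is an equivalence class for parallelism. For a $2$-dimensional linear subspace $W$, $\pi_W$ is the orthogonal projection onto $W$. A $2$-face $F$ is degenerating for $W$ if $\pi_W(F)$ is contained in a line (equivalently $W^\perp\cap \mathrm{Span}[F]\neq\{0\}$); a class is degenerating for $W$ if one (equivalently every) representative is. $W$ is admissible if no class of 2-faces of $P$ is degenerating for $W$. $P$ is $k$-equiprojective if $\pi_W(P)$ is a $k$-gon for every admissible plane $W$, and equiprojective if it is $k$-equiprojective for some $k$. Two parallel 2-faces $F\neq F'$ are simultaneously visible if there is a $2$-dimensional subspace $W$ such that the class of $F$ is the only class of 2-faces degenerating for $W$ and both $\pi_W(F)$ and $\pi_W(F')$ lie in the boundary of $\pi_W(P)$; the pair $(F,\varnothing)$ is also called simultaneously visible if there is such a $W$ for which $\pi_W(F)$ lies in the boundary of $\pi_W(P)$ and no other 2-face parallel to $F$ does. An edge-2-faces is a triple $(e,F,F')$ where $F,F'$ are simultaneously visible ($F'$ possibly $\varnothing$) and $e$ is an edge of $F$. Each edge-2-faces carries an orientation of $e$: if $F'\neq\varnothing$, let $A$ be the smallest affine subspace containing $F\cup F'$; then $Q=P\cap A$ is a $3$-polytope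 having $F$ and $F'$ as facets, and (fixing an orientation of the direction space of $A$) the boundary cycle of each of $F$ and $F'$ is oriented counterclockwise as seen from outside $Q$ (i.e. for an edge traversed along $u$, a vector $w\in\mathrm{Span}[G]$ pointing from the edge into the facet $G$, and the outward normal $n_G$ of $G$ in $Q$, $(u,w,n_G)$ is positively oriented); every edge-2-faces $(e,F,F')$ or $(e,F',F)$ gets the orientation of $e$ thus defined. If $F'=\varnothing$, one fixes arbitrarily one of the two cyclic orientations of the boundary of $F$ and orients its edges accordingly. Two distinct edge-2-faces $(e,F,F')$ and $(\tilde e,\tilde F,\tilde F')$ compensate each other if $e$ and $\tilde e$ are parallel with opposite orientations and either ($F=\tilde F'$ and $F'=\tilde F$) or ($F=\tilde F$ and $F'=\tilde F'$, possibly empty). *)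

theory Defs
  imports "HOL-Analysis.Analysis" "HOL-Library.Disjoint_Sets"
begin

definition orth_proj :: "'a::euclidean_space set \<Rightarrow> 'a \<Rightarrow> 'a" where
  "orth_proj W x = (THE y. y \<in> W \<and> x - y \<in> orthogonal_comp W)"

(* The linear subspace parallel to the affine hull of S. *)
definition dir_space :: "'a::euclidean_space set \<Rightarrow> 'a set" where
  "dir_space S = span {x - y | x y. x \<in> S \<and> y \<in> S}"

definition two_faces :: "'a::euclidean_space set \<Rightarrow> 'a set set" where
  "two_faces P = {F. F face_of P \<and> aff_dim F = 2}"

definition parallel_rel :: "'a::euclidean_space set \<Rightarrow> ('a set \<times> 'a set) set" where
  "parallel_rel P =
     {(F, G). F \<in> two_faces P \<and> G \<in> two_faces P \<and> dir_space F = dir_space G}"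

definition face_classes :: "'a::euclidean_space set \<Rightarrow> 'a set set set" where
  "face_classes P = two_faces P // parallel_rel P"

definition linear_plane :: "'a::euclidean_space set \<Rightarrow> bool" where
  "linear_plane W \<longleftrightarrow> subspace W \<and> dim W = 2"

definition degenerating :: "'a::euclidean_space set \<Rightarrow> 'a set \<Rightarrow> bool" where
  "degenerating W F \<longleftrightarrow> collinear (orth_proj W ` F)"

(* Degeneracy of F depends only on dir_space F, so "some" and "every" representative agree. *)
definition class_degenerating :: "'a::euclidean_space set \<Rightarrow> 'a set set \<Rightarrow> bool" where
  "class_degenerating W C \<longleftrightarrow> (\<exists>F\<in>C. degenerating W F)"

definition admissible :: "'a::euclidean_space set \<Rightarrow> 'a set \<Rightarrow> bool" where
  "admissible P W \<longleftrightarrow>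
     linear_plane W \<and> (\<forall>C\<in>face_classes P. \<not> class_degenerating W C)"

definition k_gon :: "nat \<Rightarrow> 'a::euclidean_space set \<Rightarrow> bool" where
  "k_gon k Q \<longleftrightarrow> polytope Q \<and> aff_dim Q = 2 \<and> card {v. v extreme_point_of Q} = k"

definition k_equiprojective :: "nat \<Rightarrow> 'a::euclidean_space set \<Rightarrow> bool" where
  "k_equiprojective k P \<longleftrightarrow> (\<forall>W. admissible P W \<longrightarrow> k_gon k (orth_proj W ` P))"

definition equiprojective :: "'a::euclidean_space set \<Rightarrow> bool" where
  "equiprojective P \<longleftrightarrow> (\<exists>k. k_equiprojective k P)"

definition only_degenerating_class ::
  "'a::euclidean_space set \<Rightarrow> 'a set \<Rightarrow> 'a set \<Rightarrow> bool" where
  "only_degenerating_class P W F \<longleftrightarrow>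
     {C \<in> face_classes P. class_degenerating W C} = {parallel_rel P `` {F}}"

(* The boundary of the projected polytope is taken inside the plane W.  For full-dimensional P
   the projection affinely spans W, so this is the relative frontier. *)
definition projects_to_boundary ::
  "'a::euclidean_space set \<Rightarrow> 'a set \<Rightarrow> 'a set \<Rightarrow> bool" where
  "projects_to_boundary P W F \<longleftrightarrow> orth_proj W ` F \<subseteq> rel_frontier (orth_proj W ` P)"

(* The empty set in the second position encodes the absence of a second 2-face. *)
definition simultaneously_visible ::
  "'a::euclidean_space set \<Rightarrow> 'a set \<Rightarrow> 'a set \<Rightarrow> bool" where
  "simultaneously_visible P F F' \<longleftrightarrow>
     F \<in> two_faces P \<and>
     (if F' = {} then
        (\<exists>W. linear_plane W \<and> only_degenerating_class P W F \<and> projects_to_boundary P W F \<and>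
             (\<forall>G. (F, G) \<in> parallel_rel P \<and> G \<noteq> F \<longrightarrow> \<not> projects_to_boundary P W G))
      else
        F \<noteq> F' \<and> (F, F') \<in> parallel_rel P \<and>
        (\<exists>W. linear_plane W \<and> only_degenerating_class P W F \<and>
             projects_to_boundary P W F \<and> projects_to_boundary P W F'))"

definition edge_two_faces ::
  "'a::euclidean_space set \<Rightarrow> ('a set \<times> 'a set \<times> 'a set) set" where
  "edge_two_faces P = {(e, F, F'). simultaneously_visible P F F' \<and> e edge_of F}"

(* An orientation of a 3-dimensional subspace V is given by an ordered basis of V. *)
definition ordered_basis :: "'a::euclidean_space set \<Rightarrow> 'a ^ 3 \<Rightarrow> bool" where
  "ordered_basis V b \<longleftrightarrow>
     inj (\<lambda>i. b $ i) \<and> independent (range (\<lambda>i. b $ i)) \<and> span (range (\<lambda>i. b $ i)) = V"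

(* The matrix expressing v in terms of the basis b has positive determinant. *)
definition positively_oriented :: "'a::euclidean_space ^ 3 \<Rightarrow> 'a ^ 3 \<Rightarrow> bool" where
  "positively_oriented b v \<longleftrightarrow>
     (\<exists>M :: real ^ 3 ^ 3. det M > 0 \<and> (\<forall>i. v $ i = (\<Sum>j\<in>UNIV. (M $ i $ j) *\<^sub>R (b $ j))))"

definition points_into :: "'a::euclidean_space set \<Rightarrow> 'a set \<Rightarrow> 'a \<Rightarrow> bool" where
  "points_into e G w \<longleftrightarrow> (\<exists>x\<in>e. \<exists>y\<in>G - e. w = y - x)"

(* Normals are taken inside the direction space of Q; for a facet G of Q this determines n
   up to a positive factor. *)
definition outward_normal :: "'a::euclidean_space set \<Rightarrow> 'a set \<Rightarrow> 'a \<Rightarrow> bool" where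
  "outward_normal Q G n \<longleftrightarrow>
     n \<noteq> 0 \<and> n \<in> dir_space Q \<and> n \<in> orthogonal_comp (dir_space G) \<and>
     (\<forall>x\<in>G. \<forall>y\<in>Q. n \<bullet> y \<le> n \<bullet> x)"

(* u is the direction in which the edge e of F is traversed when the boundary of F runs
   counterclockwise as seen from outside the section of P by the affine hull of F and F',
   with respect to the orientation b of the direction space of that affine hull. *)
definition ccw_direction ::
  "'a::euclidean_space set \<Rightarrow> 'a ^ 3 \<Rightarrow> 'a set \<Rightarrow> 'a set \<Rightarrow> 'a set \<Rightarrow> 'a \<Rightarrow> bool" where
  "ccw_direction P b e F F' u \<longleftrightarrow>
     (\<exists>w n. points_into e F w \<and> outward_normal (P \<inter> affine hull (F \<union> F')) F n \<and>
            positively_oriented b (vector [u, w, n]))"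

(* A cyclic orientation of the boundary of a polygon is given as the set of its directed edges
   (tail, head): every edge gets exactly one direction, and every vertex is left and entered
   exactly once. *)
definition cyclic_orientation :: "'a::euclidean_space set \<Rightarrow> ('a \<times> 'a) set \<Rightarrow> bool" where
  "cyclic_orientation F D \<longleftrightarrow>
     (\<forall>(a, b)\<in>D. closed_segment a b edge_of F) \<and>
     (\<forall>a b. closed_segment a b edge_of F \<longrightarrow> ((a, b) \<in> D) \<noteq> ((b, a) \<in> D)) \<and>
     (\<forall>v. v extreme_point_of F \<longrightarrow> (\<exists>!b. (v, b) \<in> D) \<and> (\<exists>!a. (a, v) \<in> D))"

(* ori assigns an orientation to 3-dimensional affine subspaces, cyc assigns a cyclic
   orientation to 2-faces.  Since ori depends only on the affine hull of F and F',
   the triples (e, F, F') and (e, F', F) are oriented by the same choice. *)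
definition orientation_choice ::
  "'a::euclidean_space set \<Rightarrow> ('a set \<Rightarrow> 'a ^ 3) \<Rightarrow> ('a set \<Rightarrow> ('a \<times> 'a) set) \<Rightarrow> bool" where
  "orientation_choice P ori cyc \<longleftrightarrow>
     (\<forall>F F'. simultaneously_visible P F F' \<and> F' \<noteq> {} \<longrightarrow>
        ordered_basis (dir_space (affine hull (F \<union> F'))) (ori (affine hull (F \<union> F')))) \<and>
     (\<forall>F. simultaneously_visible P F {} \<longrightarrow> cyclic_orientation F (cyc F))"

(* (a, b) are tail and head of e under the orientation carried by (e, F, F'). *)
fun oriented_as ::
  "'a::euclidean_space set \<Rightarrow> ('a set \<Rightarrow> 'a ^ 3) \<Rightarrow> ('a set \<Rightarrow> ('a \<times> 'a) set) \<Rightarrow>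
     'a set \<times> 'a set \<times> 'a set \<Rightarrow> 'a \<times> 'a \<Rightarrow> bool" where
  "oriented_as P ori cyc (e, F, F') (a, b) \<longleftrightarrow>
     e = closed_segment a b \<and> a \<noteq> b \<and>
     (if F' = {} then (a, b) \<in> cyc F
      else ccw_direction P (ori (affine hull (F \<union> F'))) e F F' (b - a))"

definition oppositely_oriented ::
  "'a::euclidean_space set \<Rightarrow> ('a set \<Rightarrow> 'a ^ 3) \<Rightarrow> ('a set \<Rightarrow> ('a \<times> 'a) set) \<Rightarrow>
     'a set \<times> 'a set \<times> 'a set \<Rightarrow> 'a set \<times> 'a set \<times> 'a set \<Rightarrow> bool" where
  "oppositely_oriented P ori cyc s t \<longleftrightarrow>
     (\<exists>a b a' b' c. oriented_as P ori cyc s (a, b) \<and> oriented_as P ori cyc t (a', b') \<and>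
        c > 0 \<and> b' - a' = - (c *\<^sub>R (b - a)))"

fun compensate ::
  "'a::euclidean_space set \<Rightarrow> ('a set \<Rightarrow> 'a ^ 3) \<Rightarrow> ('a set \<Rightarrow> ('a \<times> 'a) set) \<Rightarrow>
     'a set \<times> 'a set \<times> 'a set \<Rightarrow> 'a set \<times> 'a set \<times> 'a set \<Rightarrow> bool" where
  "compensate P ori cyc (e, F, F') (g, G, G') \<longleftrightarrow>
     (e, F, F') \<noteq> (g, G, G') \<and>
     oppositely_oriented P ori cyc (e, F, F') (g, G, G') \<and>
     (F = G' \<and> F' = G \<or> F = G \<and> F' = G')"

definition partitioned_into_compensating_pairs ::
  "'a::euclidean_space set \<Rightarrow> ('a set \<Rightarrow> 'a ^ 3) \<Rightarrow> ('a set \<Rightarrow> ('a \<times> 'a) set) \<Rightarrow> bool" where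
  "partitioned_into_compensating_pairs P ori cyc \<longleftrightarrow>
     (\<exists>\<P>. partition_on (edge_two_faces P) \<P> \<and>
           (\<forall>B\<in>\<P>. \<exists>s t. B = {s, t} \<and> compensate P ori cyc s t))"

end

theory Submission
  imports Defs
begin

text \<open>Admissible planes are spanned by pairs \<open>(a, b)\<close>, and the number of vertices of the projection is
  the number of edges of \<open>P\<close> that are maximal faces for some functional in the plane. Two admissible
  planes are joined by moving one basis vector at a time along a line, with the fixed vector generic
  (every admissible plane contains a generic vector). Degeneracy of a class of 2-faces is then an
  affine condition on the parameter, so that for a generic line each class degenerates at most once
  and no two classes do so simultaneously. An edge is visible exactly on a closed parameter interval
  whose endpoints are parameters at which it lies in a visible degenerating 2-face. At such a
  parameter the edges of that 2-face starting or ending their visibility are told apart by the sign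
  of their direction, once the boundary of the face is oriented; hence compensating edges contribute
  opposite jumps and the total jump vanishes.\<close>

subsection \<open>Direction spaces and projections\<close>

text \<open>Orientation enters through one computation. Let \<open>e\<close> with direction
  \<open>u\<close> be an edge of a degenerating face, and let \<open>d\<close> point from
  \<open>e\<close> into that face. The derivative of the normal of \<open>e\<close> along the moving
  direction \<open>a'\<close>, evaluated at \<open>d\<close>, is minus the area form of
  \<open>a'\<close> and \<open>b\<close> at \<open>(u, d)\<close>, divided by
  \<open>b \<bullet> u\<close>. The area form tells on which side of \<open>e\<close> the face lies;
  once the edges are directed so that this side is constant, only the sign of
  \<open>b \<bullet> u\<close> decides between appearing and disappearing. At a degenerate parameter
  at most two faces matter, those maximal for \<open>w\<close> and for \<open>- w\<close>. Their
  counterclockwise orientations have opposite area signs, and their edges are followed under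
  opposite multiples of the normal. The two reversals match, so a compensating pair cancels whether
  its edges lie in one face or in both. A straight line between two given bases may still meet
  several classes at once. This is avoided by a detour through a third vector outside finitely many
  hyperplanes.\<close>

lemma subspace_dir_space: "subspace (dir_space S)"
  by (simp add: dir_space_def)

lemma diff_in_dir_space: "x \<in> S \<Longrightarrow> y \<in> S \<Longrightarrow> x - y \<in> dir_space S"
  unfolding dir_space_def by (rule span_base) blast

lemma dir_space_mono: "S \<subseteq> T \<Longrightarrow> dir_space S \<subseteq> dir_space T"
  unfolding dir_space_def by (rule span_mono) blast

lemma dir_space_least:
  assumes "subspace V" "\<And>x. x \<in> S \<Longrightarrow> x - a \<in> V"
  shows "dir_space S \<subseteq> V"
  unfolding dir_space_def
proof (rule span_minimal)
  show "{x - y |x y. x \<in> S \<and> y \<in> S} \<subseteq> V"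
    using subspace_diff[OF assms(1) assms(2) assms(2)] by force
qed (rule assms)

lemma dir_space_eq_span:
  assumes "a \<in> S"
  shows "dir_space S = span ((\<lambda>x. x - a) ` S)"
proof
  show "dir_space S \<subseteq> span ((\<lambda>x. x - a) ` S)"
    by (rule dir_space_least[where a = a]) (auto intro: span_base)
  show "span ((\<lambda>x. x - a) ` S) \<subseteq> dir_space S"
    using assms by (intro span_minimal subspace_dir_space) (auto intro: diff_in_dir_space)
qed

lemma dim_dir_space:
  assumes "S \<noteq> {}"
  shows "int (dim (dir_space S)) = aff_dim S"
proof -
  obtain a where a: "a \<in> S" using assms by auto
  have "aff_dim S = int (dim ((\<lambda>x. x - a) ` S))"
    by (rule aff_dim_eq_dim_subtract) (simp add: a hull_inc)
  then show ?thesis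
    by (simp add: dir_space_eq_span[OF a])
qed

lemma affine_hull_eq_dir_space:
  assumes "a \<in> S"
  shows "affine hull S = {x. x - a \<in> dir_space S}"
proof -
  have "affine hull S = (\<lambda>x. a + x) ` span ((\<lambda>x. x - a) ` S)"
    using affine_hull_span_gen[of a S] assms by (simp add: hull_inc)
  then show ?thesis
    unfolding dir_space_eq_span[OF assms]
    by (auto simp: image_iff intro!: bexI[of _ "_ - a"])
qed

lemma dir_space_linear_image:
  assumes "linear f"
  shows "dir_space (f ` S) = f ` dir_space S"
proof -
  have "f ` {x - y |x y. x \<in> S \<and> y \<in> S} = {f (x - y) |x y. x \<in> S \<and> y \<in> S}"
    by blast
  also have "\<dots> = {x - y |x y. x \<in> f ` S \<and> y \<in> f ` S}"
    unfolding linear_diff[OF assms] by blast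
  finally have "{x - y |x y. x \<in> f ` S \<and> y \<in> f ` S} = f ` {x - y |x y. x \<in> S \<and> y \<in> S}" ..
  then show ?thesis
    unfolding dir_space_def by (simp add: linear_span_image[OF assms])
qed

lemma inner_dir_space_eq_0:
  assumes "v \<in> dir_space S" "\<And>x y. x \<in> S \<Longrightarrow> y \<in> S \<Longrightarrow> w \<bullet> x = w \<bullet> y"
  shows "w \<bullet> v = 0"
proof -
  have "dir_space S \<subseteq> {v. w \<bullet> v = 0}"
    unfolding dir_space_def
  proof (rule span_minimal[OF _ subspace_hyperplane], safe)
    show "w \<bullet> (x - y) = 0" if "x \<in> S" "y \<in> S" for x y
      using assms(2)[OF that] by (simp add: inner_diff_right)
  qed
  then show ?thesis using assms(1) by blast
qed

lemma dir_space_full_dim: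
  fixes P :: "'a::euclidean_space set"
  assumes "aff_dim P = DIM('a)"
  shows "dir_space P = UNIV"
proof -
  have "P \<noteq> {}" using assms by auto
  then have "dim (dir_space P) = DIM('a)" using dim_dir_space[of P] assms by simp
  then have "span (dir_space P) = UNIV" by (simp only: dim_eq_full)
  then show ?thesis using span_eq_iff[of "dir_space P"] subspace_dir_space[of P] by simp
qed

text \<open>Justifies the definite description in \<open>orth_proj\<close>: two candidates differ by
  a vector of \<open>W\<close> that is orthogonal to \<open>W\<close>.\<close>

lemma orth_proj_decomp:
  assumes "subspace W"
  shows "orth_proj W x \<in> W" "x - orth_proj W x \<in> orthogonal_comp W"
proof -
  obtain y z where yz: "y \<in> span W" "\<And>w. w \<in> span W \<Longrightarrow> orthogonal z w" "x = y + z"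
    using orthogonal_subspace_decomp_exists[of W x] by blast
  have W: "span W = W" by (simp add: assms)
  have "y \<in> W \<and> x - y \<in> orthogonal_comp W"
    using yz W by (auto simp: orthogonal_comp_def orthogonal_commute)
  moreover have "y' = y" if "y' \<in> W \<and> x - y' \<in> orthogonal_comp W" for y'
  proof -
    have "y' - y \<in> W" using that yz W assms by (auto intro: subspace_diff)
    moreover have "w \<bullet> (y' - y) = 0" if "w \<in> W" for w
    proof -
      have "w \<bullet> (x - y) = 0" "w \<bullet> (x - y') = 0"
        using that \<open>y' \<in> W \<and> x - y' \<in> orthogonal_comp W\<close> \<open>y \<in> W \<and> x - y \<in> orthogonal_comp W\<close>
        by (auto simp: orthogonal_comp_def orthogonal_def)
      then show ?thesis by (simp add: inner_diff_right)
    qed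
    ultimately show ?thesis by (metis eq_iff_diff_eq_0 inner_eq_zero_iff)
  qed
  ultimately have "orth_proj W x \<in> W \<and> x - orth_proj W x \<in> orthogonal_comp W"
    unfolding orth_proj_def by (rule theI)
  then show "orth_proj W x \<in> W" "x - orth_proj W x \<in> orthogonal_comp W" by auto
qed

lemma inner_orth_proj:
  assumes "subspace W" "w \<in> W"
  shows "w \<bullet> orth_proj W x = w \<bullet> x"
  using orth_proj_decomp(2)[OF assms(1), of x] assms(2)
  by (auto simp: orthogonal_comp_def orthogonal_def inner_diff_right)

lemma orth_proj_unique:
  assumes "subspace W" "y \<in> W" "\<And>w. w \<in> W \<Longrightarrow> w \<bullet> y = w \<bullet> x"
  shows "orth_proj W x = y"
proof -
  have "orth_proj W x - y \<in> W"
    using assms orth_proj_decomp(1) by (auto intro: subspace_diff)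
  then have "(orth_proj W x - y) \<bullet> (orth_proj W x - y) = 0"
    using assms by (simp add: inner_diff_right inner_orth_proj)
  then show ?thesis by simp
qed

lemma linear_orth_proj:
  assumes "subspace W"
  shows "linear (orth_proj W)"
proof
  show "orth_proj W (x + y) = orth_proj W x + orth_proj W y" for x y
    by (rule orth_proj_unique[OF assms])
      (auto simp: assms orth_proj_decomp subspace_add inner_orth_proj inner_add_right)
  show "orth_proj W (c *\<^sub>R x) = c *\<^sub>R orth_proj W x" for c x
    by (rule orth_proj_unique[OF assms])
      (auto simp: assms orth_proj_decomp subspace_scale inner_orth_proj)
qed

lemma orth_proj_ident:
  assumes "subspace W" "x \<in> W"
  shows "orth_proj W x = x"
  using assms by (intro orth_proj_unique) auto

lemma orth_proj_eq_0_iff: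
  assumes "subspace W"
  shows "orth_proj W x = 0 \<longleftrightarrow> (\<forall>w\<in>W. w \<bullet> x = 0)"
  by (metis assms inner_orth_proj inner_zero_right orth_proj_unique subspace_0)

lemma orth_proj_image_subset: "subspace W \<Longrightarrow> orth_proj W ` S \<subseteq> W"
  using orth_proj_decomp(1) by blast

text \<open>Rank-nullity as a strict inequality. It converts loss of dimension under projection into
  a nonzero direction killed by every functional of the plane.\<close>

lemma dim_linear_image_less_iff:
  fixes f :: "'a::euclidean_space \<Rightarrow> 'b::euclidean_space"
  assumes f: "linear f" and S: "subspace S"
  shows "dim (f ` S) < dim S \<longleftrightarrow> (\<exists>v\<in>S. v \<noteq> 0 \<and> f v = 0)"
proof
  assume *: "dim (f ` S) < dim S"
  show "\<exists>v\<in>S. v \<noteq> 0 \<and> f v = 0"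
  proof (rule ccontr)
    assume "\<not> ?thesis"
    then have "x = y" if "x \<in> S" "y \<in> S" "f x = f y" for x y
      using that subspace_diff[OF S] linear_diff[OF f] by (metis right_minus_eq)
    then have "inj_on f S" by (rule inj_onI)
    then have "inj_on f (span S)" using S by (metis span_eq_iff)
    then show False using * dim_image_eq[OF f] by simp
  qed
next
  assume "\<exists>v\<in>S. v \<noteq> 0 \<and> f v = 0"
  then obtain v where v: "v \<in> S" "v \<noteq> 0" "f v = 0" by blast
  \<comment> \<open>A kernel vector is completed to a basis of \<open>S\<close>; its image is zero,
    so the other basis vectors already span the image.\<close>
  obtain B where B: "{v} \<subseteq> B" "B \<subseteq> S" "independent B" "S \<subseteq> span B"
    using maximal_independent_subset_extend[of "{v}" S] v by auto
  have "f ` S \<subseteq> f ` span B" using B by blast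
  also have "\<dots> = span (f ` B)" by (simp add: linear_span_image[OF f])
  also have "\<dots> = span (f ` (B - {v}))"
  proof -
    have "f ` B = insert 0 (f ` (B - {v}))" using B(1) v(3) by force
    then show ?thesis by (simp add: span_insert_0)
  qed
  finally have "dim (f ` S) \<le> card (f ` (B - {v}))"
    using B by (meson dim_le_card finiteI_independent finite_Diff finite_imageI)
  also have "\<dots> \<le> card (B - {v})"
    using B by (intro card_image_le) (simp add: finiteI_independent)
  also have "\<dots> < card B"
    using B by (intro psubset_card_mono) (auto simp: finiteI_independent)
  also have "\<dots> = dim S" using B by (simp add: basis_card_eq_dim)
  finally show "dim (f ` S) < dim S" .
qed

subsection \<open>Faces of polytopes\<close>

text \<open>Faces are indexed by functionals because the sweep moves a functional. Every nonempty
  face of a polytope arises this way (\<open>face_eq_max_face\<close>), and \<open>w = 0\<close>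
  gives \<open>P\<close> itself.\<close>

definition max_face :: "'a::euclidean_space set \<Rightarrow> 'a \<Rightarrow> 'a set" where
  "max_face P w = {x \<in> P. \<forall>y\<in>P. w \<bullet> y \<le> w \<bullet> x}"

lemma max_face_eq_Int:
  assumes "x \<in> max_face P w"
  shows "max_face P w = P \<inter> {y. w \<bullet> y = w \<bullet> x}"
  using assms by (force simp: max_face_def)

lemma max_face_of:
  assumes "convex P"
  shows "max_face P w face_of P"
proof (cases "max_face P w = {}")
  case False
  then obtain x where x: "x \<in> max_face P w" by blast
  show ?thesis
    unfolding max_face_eq_Int[OF x] using x assms
    by (intro face_of_Int_supporting_hyperplane_le) (auto simp: max_face_def)
qed simp

lemma max_face_scale:
  assumes "c > 0"
  shows "max_face P (c *\<^sub>R w) = max_face P w"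
  using assms by (auto simp: max_face_def)

lemma inner_max_face_eq: "x \<in> max_face P w \<Longrightarrow> y \<in> max_face P w \<Longrightarrow> w \<bullet> x = w \<bullet> y"
  by (auto simp: max_face_def intro: antisym)

lemma inner_max_face_less: "x \<in> max_face P w \<Longrightarrow> y \<in> P \<Longrightarrow> y \<notin> max_face P w \<Longrightarrow> w \<bullet> y < w \<bullet> x"
  using max_face_eq_Int[of x P w] by (fastforce simp: max_face_def)

lemma inner_dir_max_face:
  assumes "v \<in> dir_space (max_face P w)"
  shows "w \<bullet> v = 0"
  using inner_dir_space_eq_0[OF assms inner_max_face_eq] .

lemma face_eq_max_face:
  assumes "polytope P" "F face_of P" "F \<noteq> {}"
  obtains w where "F = max_face P w"
proof -
  have "F exposed_face_of P"
    using assms exposed_face_of_polyhedron polytope_imp_polyhedron by blast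
  then obtain a b where ab: "P \<subseteq> {x. a \<bullet> x \<le> b}" "F = P \<inter> {x. a \<bullet> x = b}"
    by (auto simp: exposed_face_of_def)
  then have "F = max_face P a"
    using assms(3) by (fastforce simp: max_face_def)
  then show ?thesis ..
qed

lemma max_face_eq_whole:
  fixes P :: "'a::euclidean_space set"
  assumes "aff_dim P = DIM('a)" "max_face P w = P"
  shows "w = 0"
proof -
  have "w \<in> dir_space (max_face P w)" using assms by (simp add: dir_space_full_dim)
  then have "w \<bullet> w = 0" by (rule inner_dir_max_face)
  then show ?thesis by simp
qed

lemma face_eqI_aff_dim:
  fixes P :: "'a::euclidean_space set"
  assumes "F face_of P" "G face_of P" "F \<subseteq> G" "aff_dim F = aff_dim G"
  shows "F = G"
  using assms face_of_aff_dim_lt[of G F] face_of_imp_convex face_of_face[OF assms(2), of F] by force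

text \<open>A face is the section of \<open>P\<close> by its affine hull, and the hull is fixed by
  one point and the directions.\<close>

lemma face_of_eq_if_common_point:
  fixes P :: "'a::euclidean_space set"
  assumes "convex P" "F face_of P" "G face_of P" "dir_space F = dir_space G" "x \<in> F" "x \<in> G"
  shows "F = G"
proof -
  have "affine hull F = affine hull G"
    using assms(4) by (simp add: affine_hull_eq_dir_space[OF assms(5)] affine_hull_eq_dir_space[OF assms(6)])
  then show ?thesis
    using face_of_imp_eq_affine_Int[OF assms(1,2)] face_of_imp_eq_affine_Int[OF assms(1,3)] by simp
qed

lemma extreme_point_exists_polytope:
  fixes P :: "'a::euclidean_space set"
  assumes "polytope P" "P \<noteq> {}"
  obtains v where "v extreme_point_of P" "{v} face_of P"
  using extreme_point_exists_convex[of P] assms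
  by (metis face_of_singleton polytope_imp_compact polytope_imp_convex)

text \<open>Induction on \<open>aff_dim P - k\<close>: a proper face lies in some facet, which takes
  the place of \<open>P\<close>.\<close>

lemma exists_face_aff_dim_between:
  fixes P :: "'a::euclidean_space set"
  assumes "polytope P" "e face_of P" "e \<noteq> {}" "aff_dim e \<le> k" "k \<le> aff_dim P"
  shows "\<exists>F. F face_of P \<and> e \<subseteq> F \<and> aff_dim F = k"
  using assms
proof (induction "nat (aff_dim P - k)" arbitrary: P)
  case 0
  then show ?case
    using face_of_refl[OF polytope_imp_convex] face_of_imp_subset[of e P] by (intro exI[of _ P]) auto
next
  case (Suc n)
  then have "e \<noteq> P" by auto
  then obtain G where G: "G facet_of P" "e \<subseteq> G"
    using face_of_polyhedron_subset_facet Suc.prems polytope_imp_polyhedron by metis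
  then have "G face_of P" and dimG: "aff_dim G = aff_dim P - 1" by (auto simp: facet_of_def)
  then have "polytope G" "e face_of G"
    using Suc.prems face_of_polytope_polytope G face_of_face by blast+
  moreover have "n = nat (aff_dim G - k)" "k \<le> aff_dim G"
    using Suc.hyps(2) dimG by linarith+
  ultimately obtain F where "F face_of G" "e \<subseteq> F" "aff_dim F = k"
    using Suc.hyps(1)[of G] Suc.prems by blast
  then show ?case using \<open>G face_of P\<close> face_of_trans by blast
qed

lemma exists_face_aff_dim:
  fixes P :: "'a::euclidean_space set"
  assumes "polytope P" "0 \<le> k" "k \<le> aff_dim P"
  shows "\<exists>F. F face_of P \<and> aff_dim F = k"
proof -
  have "P \<noteq> {}" using assms by auto
  then obtain v where "{v} face_of P" using extreme_point_exists_polytope assms(1) by blast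
  then show ?thesis using exists_face_aff_dim_between[OF assms(1), of "{v}" k] assms by auto
qed

text \<open>A vertex is the intersection of the facets through it. Were all facets parallel, only
  one could pass through the vertex, so the vertex would itself be a facet and \<open>P\<close>
  would have dimension 1.\<close>

lemma exists_nonparallel_facets:
  fixes P :: "'a::euclidean_space set"
  assumes "polytope P" "aff_dim P \<ge> 2"
  shows "\<exists>F G. F facet_of P \<and> G facet_of P \<and> dir_space F \<noteq> dir_space G"
proof (rule ccontr)
  assume "\<not> ?thesis"
  then have par: "dir_space F = dir_space G" if "F facet_of P" "G facet_of P" for F G
    using that by blast
  have "P \<noteq> {}" using assms by auto
  then obtain v where v: "{v} face_of P" using extreme_point_exists_polytope assms(1) by blast
  have "{v} \<noteq> P" using assms by auto
  note vP = face_of_polyhedron[OF polytope_imp_polyhedron[OF assms(1)] v _ this]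
  obtain F where F: "F facet_of P" "{v} \<subseteq> F"
    using face_of_polyhedron_subset_facet[OF polytope_imp_polyhedron[OF assms(1)] v _ \<open>{v} \<noteq> P\<close>] by blast
  have "G = F" if "G facet_of P" "v \<in> G" for G
    using face_of_eq_if_common_point[OF polytope_imp_convex[OF assms(1)]
        facet_of_imp_face_of[OF that(1)] facet_of_imp_face_of[OF F(1)] par[OF that(1) F(1)] that(2)] F
    by simp
  then have "\<Inter>{G. G facet_of P \<and> {v} \<subseteq> G} = F" using F by blast
  with vP have "{v} = F" by (rule trans) simp
  then have "aff_dim P = 1" using F(1) by (auto simp: facet_of_def)
  then show False using assms by simp
qed

lemma edge_of_polytope_segment:
  fixes P :: "'a::euclidean_space set"
  assumes "polytope P" "e edge_of P"
  obtains a b where "e = closed_segment a b" "a \<noteq> b"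
proof -
  have "polytope e" "aff_dim e = 1"
    using assms face_of_polytope_polytope by (auto simp: edge_of_def)
  then obtain a b where "e = closed_segment a b"
    using compact_convex_collinear_segment[of e] collinear_aff_dim[of e]
    by (metis aff_dim_empty_eq order_refl polytope_imp_compact polytope_imp_convex zero_neq_neg_one
        one_neq_neg_one)
  moreover have "a \<noteq> b" using calculation \<open>aff_dim e = 1\<close> by auto
  ultimately show ?thesis ..
qed

lemma segment_edge_ends:
  fixes P :: "'a::euclidean_space set"
  assumes "closed_segment a b edge_of P"
  shows "a \<noteq> b" "a extreme_point_of P" "b extreme_point_of P" "a \<in> P" "b \<in> P"
proof -
  have f: "closed_segment a b face_of P" "aff_dim (closed_segment a b) = 1"
    using assms by (auto simp: edge_of_def)
  then show "a \<noteq> b" by auto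
  have "a extreme_point_of closed_segment a b" "b extreme_point_of closed_segment a b"
    by (auto simp: extreme_point_of_segment)
  then show "a extreme_point_of P" "b extreme_point_of P"
    using extreme_point_of_face[OF f(1)] by auto
  then show "a \<in> P" "b \<in> P" by (auto simp: extreme_point_of_def)
qed

text \<open>Distinct edges meet in a proper face of each, which has dimension 0 once it is
  nonempty.\<close>

lemma edges_Int_extreme_point:
  fixes P :: "'a::euclidean_space set"
  assumes "e1 edge_of P" "e2 edge_of P" "e1 \<noteq> e2" "x \<in> e1" "x \<in> e2"
  shows "x extreme_point_of P"
proof -
  have f: "e1 face_of P" "e2 face_of P" "aff_dim e1 = 1" "aff_dim e2 = 1"
    using assms by (auto simp: edge_of_def)
  have i: "e1 \<inter> e2 face_of P" using f face_of_Int by blast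
  have "e1 \<inter> e2 \<noteq> e1"
    using face_eqI_aff_dim[OF f(1,2)] f(3,4) assms(3) by auto
  then have "aff_dim (e1 \<inter> e2) < 1"
    using face_of_aff_dim_lt[of e1 "e1 \<inter> e2"] f i face_of_face[OF f(1), of "e1 \<inter> e2"]
    by (auto intro: face_of_imp_convex)
  moreover have "aff_dim (e1 \<inter> e2) \<ge> 0"
  proof (rule ccontr)
    assume "\<not> ?thesis"
    then have "e1 \<inter> e2 = {}" using aff_dim_negative_iff[of "e1 \<inter> e2"] by (simp only: not_le)
    then show False using assms(4,5) by blast
  qed
  ultimately have "aff_dim (e1 \<inter> e2) = 0" by simp
  then obtain z where "e1 \<inter> e2 = {z}" using aff_dim_eq_0 by blast
  then have "e1 \<inter> e2 = {x}" using assms(4,5) by auto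
  then show ?thesis using i face_of_singleton by metis
qed

subsection \<open>Polygons\<close>

lemma plane_coordinates:
  fixes u d x :: "'a::euclidean_space"
  assumes "subspace S" "dim S = 2" "u \<in> S" "d \<in> S" "u \<noteq> 0" "\<And>c. d \<noteq> c *\<^sub>R u" "x \<in> S"
  obtains c1 c2 where "x = c1 *\<^sub>R u + c2 *\<^sub>R d"
proof -
  have d: "d \<notin> span {u}" using assms(6) by (auto simp: span_singleton)
  then have "independent {d, u}" using assms(5) by (simp add: independent_insert)
  moreover have "d \<noteq> u" using assms(6)[of 1] by simp
  ultimately have "S \<subseteq> span {d, u}"
    using card_ge_dim_independent[of "{d, u}" S] assms by auto
  then have "x \<in> span {d, u}" using assms by blast
  then obtain k where "x - k *\<^sub>R d \<in> span {u}" by (auto simp: span_breakdown_eq)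
  then obtain c where "x - k *\<^sub>R d = c *\<^sub>R u" by (auto simp: span_singleton)
  then have "x = c *\<^sub>R u + k *\<^sub>R d" by (simp add: algebra_simps)
  then show ?thesis ..
qed

lemma plane_kernel:
  fixes w :: "'a::euclidean_space"
  assumes "subspace S" "dim S \<ge> 2"
  obtains v where "v \<in> S" "v \<noteq> 0" "w \<bullet> v = 0"
proof -
  have "dim ((\<lambda>x. w \<bullet> x) ` S) \<le> 1"
    using dim_subset_UNIV[of "(\<lambda>x. w \<bullet> x) ` S"] by simp
  then have "dim ((\<lambda>x. w \<bullet> x) ` S) < dim S" using assms by simp
  moreover have "linear (\<lambda>x. w \<bullet> x)" by (simp add: bounded_linear.linear bounded_linear_inner_right)
  ultimately show ?thesis
    using dim_linear_image_less_iff[of "\<lambda>x. w \<bullet> x" S] assms(1) that by blast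
qed

lemma polytope_subset_convexI:
  fixes P :: "'a::euclidean_space set"
  assumes "polytope P" "convex C" "\<And>x. x extreme_point_of P \<Longrightarrow> x \<in> C"
  shows "P \<subseteq> C"
  using Krein_Milman_Minkowski[OF polytope_imp_compact[OF assms(1)] polytope_imp_convex[OF assms(1)]]
    hull_minimal[of "{x. x extreme_point_of P}" C convex] assms(2,3) by blast

lemma max_face_memI_extreme:
  fixes P :: "'a::euclidean_space set"
  assumes "polytope P" "v \<in> P" "\<And>x. x extreme_point_of P \<Longrightarrow> w \<bullet> x \<le> w \<bullet> v"
  shows "v \<in> max_face P w"
proof -
  have "P \<subseteq> {x. w \<bullet> x \<le> w \<bullet> v}"
    using assms(3) by (intro polytope_subset_convexI[OF assms(1) convex_halfspace_le]) simp
  then show ?thesis using assms(2) by (auto simp: max_face_def)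
qed

lemma finite_extreme_points:
  fixes P :: "'a::euclidean_space set"
  assumes "polytope P"
  shows "finite {x. x extreme_point_of P}"
  by (rule finite_polyhedron_extreme_points[OF polytope_imp_polyhedron[OF assms]])

lemma edge_other_end:
  assumes "polytope Q" "e edge_of Q" "v extreme_point_of Q" "v \<in> e"
  obtains x where "e = closed_segment v x" "x \<noteq> v" "x extreme_point_of Q"
proof -
  obtain a b where ab: "e = closed_segment a b" "a \<noteq> b"
    using edge_of_polytope_segment assms by blast
  have "v extreme_point_of e"
    using extreme_point_of_face[of e Q v] assms by (auto simp: edge_of_def)
  then have "v = a \<or> v = b" using ab extreme_point_of_segment by blast
  then show ?thesis
    using that ab segment_edge_ends[of a b Q] assms by (metis closed_segment_commute)
qed

lemma face_with_two_points_edge: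
  fixes Q :: "'a::euclidean_space set"
  assumes "polytope Q" "aff_dim Q = 2" "e face_of Q" "e \<noteq> Q" "v \<in> e" "x \<in> e" "x \<noteq> v"
  shows "e edge_of Q"
proof -
  have "aff_dim e < 2"
    using assms face_of_aff_dim_lt[of Q e] by (simp add: polytope_imp_convex)
  moreover have "aff_dim e \<ge> aff_dim {v, x}" using assms by (intro aff_dim_subset) auto
  ultimately show ?thesis using assms by (simp add: edge_of_def)
qed

lemma two_edges_at_vertex:
  fixes Q :: "'a::euclidean_space set"
  assumes Q: "polytope Q" "aff_dim Q = 2" and v: "v extreme_point_of Q"
  shows "card {e. e edge_of Q \<and> v \<in> e} = 2"
proof -
  define S where "S = dir_space Q"
  have ne: "Q \<noteq> {}" using Q by auto
  have vQ: "v \<in> Q" using v by (simp add: extreme_point_of_def)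
  have S: "subspace S" "dim S = 2"
    using dim_dir_space[OF ne] Q by (simp_all add: S_def subspace_dir_space)
  have "{v} face_of Q" using v by (simp add: face_of_singleton)
  then obtain f where f: "max_face Q f = {v}" using face_eq_max_face[OF Q(1)] by (metis insert_not_empty)
  have fneg: "f \<bullet> (x - v) < 0" if "x \<in> Q" "x \<noteq> v" for x
    using inner_max_face_less[of v Q f x] that f by (simp add: inner_diff_right)
  obtain g where g: "g \<in> S" "g \<noteq> 0" "f \<bullet> g = 0" using plane_kernel[OF S(1)] S(2) by (metis order_refl)
  define V where "V = {x. x extreme_point_of Q \<and> x \<noteq> v}"
  have VQ: "V \<subseteq> Q" by (auto simp: V_def extreme_point_of_def)
  have finV: "finite V" using finite_extreme_points[OF Q(1)] by (simp add: V_def)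
  have "V \<noteq> {}"
  proof
    assume "V = {}"
    then have "Q \<subseteq> {v}"
      by (intro polytope_subset_convexI[OF Q(1)]) (auto simp: V_def)
    then show False using Q aff_dim_subset[of Q "{v}"] by simp
  qed
  have pos: "0 < - (f \<bullet> (x - v))" if "x \<in> V" for x using fneg[of x] that VQ by (auto simp: V_def)
  have xS: "x - v \<in> S" if "x \<in> Q" for x using that vQ by (simp add: S_def diff_in_dir_space)
  text \<open>Seen from \<open>v\<close>, the other vertices are ordered by slope; the two extreme slopes give the edges.\<close>
  define r where "r x = g \<bullet> (x - v) / - (f \<bullet> (x - v))" for x
  have gr: "g \<bullet> (x - v) = r x * - (f \<bullet> (x - v))" if "x \<in> V" for x
    using pos[OF that] by (simp add: r_def)
  have edge: "max_face Q (s *\<^sub>R g + k *\<^sub>R f) edge_of Q" "v \<in> max_face Q (s *\<^sub>R g + k *\<^sub>R f)"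
    "x0 \<in> max_face Q (s *\<^sub>R g + k *\<^sub>R f)"
    \<comment> \<open>The sign \<open>s\<close> lets one argument serve the largest slope
      (\<open>s = 1\<close>) and the smallest (\<open>s = -1\<close>).\<close>
    if "s \<noteq> 0" "\<And>x. x \<in> V \<Longrightarrow> s * r x \<le> k" "x0 \<in> V" "s * r x0 = k" for s k x0
  proof -
    let ?w = "s *\<^sub>R g + k *\<^sub>R f"
    have w: "?w \<bullet> (x - v) = (s * r x - k) * - (f \<bullet> (x - v))" if "x \<in> V" for x
      unfolding inner_add_left inner_scaleR_left gr[OF that] by algebra
    have "?w \<bullet> x \<le> ?w \<bullet> v" if "x extreme_point_of Q" for x
    proof (cases "x = v")
      case False
      then have "x \<in> V" using that by (simp add: V_def)
      then have "?w \<bullet> (x - v) \<le> 0"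
        unfolding w[OF \<open>x \<in> V\<close>] using pos[OF \<open>x \<in> V\<close>] \<open>\<And>x. x \<in> V \<Longrightarrow> s * r x \<le> k\<close>[OF \<open>x \<in> V\<close>]
        by (intro mult_nonpos_nonneg) auto
      then show ?thesis by (simp add: inner_diff_right)
    qed simp
    then show vm: "v \<in> max_face Q ?w" using max_face_memI_extreme[OF Q(1) vQ] by blast
    have "?w \<bullet> (x0 - v) = 0" using w[OF \<open>x0 \<in> V\<close>] that(4) by simp
    then show xm: "x0 \<in> max_face Q ?w"
      using max_face_eq_Int[OF vm] \<open>x0 \<in> V\<close> VQ by (auto simp: inner_diff_right)
    \<comment> \<open>Since \<open>g\<close> is orthogonal to \<open>f\<close>, the functional takes
      the nonzero value \<open>s * (g \<bullet> g)\<close> at \<open>g\<close> and is not constant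
      on \<open>Q\<close>.\<close>
    have "max_face Q ?w \<noteq> Q"
    proof
      assume "max_face Q ?w = Q"
      then have "?w \<bullet> g = 0" using inner_dir_max_face[of g Q ?w] g(1) by (simp add: S_def)
      then show False using g \<open>s \<noteq> 0\<close> by (simp add: inner_add_left)
    qed
    then show "max_face Q ?w edge_of Q"
      using face_with_two_points_edge[OF Q max_face_of[OF polytope_imp_convex[OF Q(1)]] _ vm xm]
        \<open>x0 \<in> V\<close>
      by (simp add: V_def)
  qed
  define M where "M = Max (r ` V)"
  define m where "m = Min (r ` V)"
  obtain xM where xM: "xM \<in> V" "r xM = M"
    using Max_in[of "r ` V"] finV \<open>V \<noteq> {}\<close> unfolding M_def by fastforce
  obtain xm where xm: "xm \<in> V" "r xm = m"
    using Min_in[of "r ` V"] finV \<open>V \<noteq> {}\<close> unfolding m_def by fastforce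
  have le: "r x \<le> M" "m \<le> r x" if "x \<in> V" for x using that finV by (auto simp: M_def m_def)
  let ?eM = "max_face Q (1 *\<^sub>R g + M *\<^sub>R f)"
  let ?em = "max_face Q ((-1) *\<^sub>R g + (- m) *\<^sub>R f)"
  have eM: "?eM edge_of Q" "v \<in> ?eM" "xM \<in> ?eM"
    using edge[of 1 M xM] le xM by auto
  have em: "?em edge_of Q" "v \<in> ?em" "xm \<in> ?em"
    using edge[of "-1" "-m" xm] le xm by auto
  have slopeM: "r x = M" if "x \<in> V" "x \<in> ?eM" for x
  proof -
    have "(1 *\<^sub>R g + M *\<^sub>R f) \<bullet> (x - v) = 0"
      using inner_max_face_eq[OF that(2) eM(2)] by (simp add: inner_diff_right)
    then have "(r x - M) * - (f \<bullet> (x - v)) = 0"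
      using gr[OF that(1)] by (simp add: inner_add_left algebra_simps)
    then show ?thesis using pos[OF that(1)] by simp
  qed
  have "m \<noteq> M"
  proof
    assume "m = M"
    then have all: "r x = M" if "x \<in> V" for x using le[OF that] by simp
    have "x \<in> {x. (g + M *\<^sub>R f) \<bullet> x = (g + M *\<^sub>R f) \<bullet> v}" if "x extreme_point_of Q" for x
    proof (cases "x = v")
      case False
      then have "x \<in> V" using that by (simp add: V_def)
      then show ?thesis
        using gr[OF \<open>x \<in> V\<close>] all[OF \<open>x \<in> V\<close>] by (simp add: inner_add_left inner_diff_right algebra_simps)
    qed simp
    then have sub: "Q \<subseteq> {x. (g + M *\<^sub>R f) \<bullet> x = (g + M *\<^sub>R f) \<bullet> v}"
      by (rule polytope_subset_convexI[OF Q(1) convex_hyperplane])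
    have "(g + M *\<^sub>R f) \<bullet> x = (g + M *\<^sub>R f) \<bullet> y" if "x \<in> Q" "y \<in> Q" for x y
      using subsetD[OF sub that(1)] subsetD[OF sub that(2)] by simp
    then have "(g + M *\<^sub>R f) \<bullet> g = 0"
      using g(1) unfolding S_def by (rule inner_dir_space_eq_0[rotated])
    then show False using g by (simp add: inner_add_left)
  qed
  then have "?eM \<noteq> ?em" using slopeM[OF xm(1)] em(3) xm(2) by metis
  moreover have "{e. e edge_of Q \<and> v \<in> e} = {?eM, ?em}"
  proof (intro equalityI subsetI)
    fix e assume "e \<in> {e. e edge_of Q \<and> v \<in> e}"
    then have e: "e edge_of Q" "v \<in> e" by auto
    obtain x where x: "e = closed_segment v x" "x \<noteq> v" "x extreme_point_of Q"
      using edge_other_end[OF Q(1) e(1) v e(2)] .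
    then have xV: "x \<in> V" by (simp add: V_def)
    have eq: "e = e'" if "e' edge_of Q" "v \<in> e'" "x \<in> e'" for e'
      using that e(1) face_eqI_aff_dim[of e Q e'] x(1)
      by (metis closed_segment_subset edge_of_def face_of_imp_convex)
    have "r x = M \<or> r x = m"
    proof (rule ccontr)
      assume "\<not> ?thesis"
      then have lt: "m < r x" "r x < M" using le[OF xV] by auto
      obtain w where w: "e = max_face Q w"
        using face_eq_max_face[OF Q(1)] e by (metis edge_of_def empty_iff)
      \<comment> \<open>Rescaled to height 1 below \<open>v\<close>, the rays end on one line, on
        which \<open>r\<close> is a coordinate. A ray of intermediate slope is then a convex
        combination of the two extreme rays; \<open>z\<close> is the difference, scaled by
        \<open>M - m\<close>.\<close>
      define d where "d y = (1 / - (f \<bullet> (y - v))) *\<^sub>R (y - v)" for y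
      have fd: "f \<bullet> d y = -1" and gd: "g \<bullet> d y = r y" and dS: "d y \<in> S" if "y \<in> V" for y
        using pos[OF that] subspace_scale[OF S(1) xS[OF subsetD[OF VQ that]]]
        by (auto simp only: d_def r_def inner_scaleR_right) (auto simp: field_simps)
      define z where "z = (M - m) *\<^sub>R d x - ((r x - m) *\<^sub>R d xM + (M - r x) *\<^sub>R d xm)"
      have "z \<in> S"
        using dS xV xM xm S(1) by (auto simp: z_def intro!: subspace_diff subspace_add subspace_scale)
      moreover have fz: "f \<bullet> z = 0"
        using fd xV xM xm by (simp add: z_def inner_diff_right inner_add_right)
      moreover have gz: "g \<bullet> z = 0"
        using gd xV xM xm by (simp add: z_def inner_diff_right inner_add_right algebra_simps)
      ultimately have "z = 0"
      proof -
        have "xM - v \<in> S" "xM - v \<noteq> c *\<^sub>R g" for c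
          using xS[of xM] xM(1) VQ pos[OF xM(1)] g(3) by auto
        then obtain c1 c2 where z: "z = c1 *\<^sub>R g + c2 *\<^sub>R (xM - v)"
          using plane_coordinates[OF S g(1) _ g(2) _ \<open>z \<in> S\<close>] by metis
        then have "c2 = 0" using fz pos[OF xM(1)] g(3) by (simp add: inner_add_right)
        then show ?thesis using z gz g(2) by simp
      qed
      then have "(M - m) *\<^sub>R d x = (r x - m) *\<^sub>R d xM + (M - r x) *\<^sub>R d xm" by (simp add: z_def)
      then have "(M - m) * (w \<bullet> d x) = (r x - m) * (w \<bullet> d xM) + (M - r x) * (w \<bullet> d xm)"
        by (metis inner_add_right inner_scaleR_right)
      moreover have "w \<bullet> d x = 0"
        using inner_max_face_eq[of x Q w v] e(2) x(1) w by (simp add: d_def inner_diff_right)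
      moreover have wd: "w \<bullet> d y \<le> 0" if "y \<in> V" for y
      proof -
        have "w \<bullet> y \<le> w \<bullet> v" using e(2) w that VQ by (auto simp: max_face_def)
        then show ?thesis using pos[OF that] by (simp add: d_def inner_diff_right divide_nonpos_pos divide_nonneg_neg)
      qed
      \<comment> \<open>The functional supporting \<open>Q\<close> at \<open>e\<close> vanishes on
        the intermediate ray and is nonpositive on both extreme ones, so it vanishes on
        \<open>d xM\<close> as well. This puts \<open>xM\<close> on \<open>e\<close>.\<close>
      moreover have "(r x - m) * (w \<bullet> d xM) \<le> 0" "(M - r x) * (w \<bullet> d xm) \<le> 0"
        using wd[OF xM(1)] wd[OF xm(1)] lt by (auto intro!: mult_nonneg_nonpos)
      ultimately have "(r x - m) * (w \<bullet> d xM) = 0" by (metis add_nonpos_eq_0_iff mult_zero_right)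
      then have "w \<bullet> d xM = 0" using lt by simp
      then have "w \<bullet> xM = w \<bullet> v" using pos[OF xM(1)] by (auto simp: d_def inner_diff_right)
      then have "xM \<in> e" using w e(2) max_face_eq_Int[of v Q w] xM(1) VQ by auto
      then have "xM extreme_point_of e"
        using xM(1) extreme_point_of_face[of e Q xM] e by (auto simp: edge_of_def V_def)
      then have "xM = x" using x xM(1) by (auto simp: extreme_point_of_segment V_def)
      then show False using lt xM by simp
    qed
    moreover have "x \<in> ?eM" if "r x = M" using edge(3)[of 1 M x] le xV that by auto
    moreover have "x \<in> ?em" if "r x = m" using edge(3)[of "-1" "-m" x] le xV that by auto
    ultimately show "e \<in> {?eM, ?em}" using eq eM em by blast
  qed (use eM em in auto)
  ultimately show ?thesis by simp
qed

lemma finite_edges: "polytope Q \<Longrightarrow> finite {e. e edge_of Q}"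
  using finite_polytope_faces[of Q] by (auto simp: edge_of_def elim: finite_subset[rotated])

text \<open>Double counting of incidences: an edge has two ends, and a vertex lies on two
  edges.\<close>

lemma card_extreme_points_eq_card_edges:
  fixes Q :: "'a::euclidean_space set"
  assumes Q: "polytope Q" "aff_dim Q = 2"
  shows "card {v. v extreme_point_of Q} = card {e. e edge_of Q}"
proof -
  let ?V = "{v. v extreme_point_of Q}" and ?E = "{e. e edge_of Q}"
  have "card {v \<in> ?V. v \<in> e} = 2" if e: "e \<in> ?E" for e
  proof -
    obtain a b where ab: "e = closed_segment a b" "a \<noteq> b"
      using edge_of_polytope_segment Q(1) e by blast
    have "{v \<in> ?V. v \<in> e} = {a, b}"
      using e extreme_point_of_face[of e Q] ab by (auto simp: edge_of_def extreme_point_of_segment)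
    then show ?thesis using ab by simp
  qed
  then have "(\<Sum>v\<in>?V. card {e \<in> ?E. v \<in> e}) = 2 * card ?E"
    using finite_edges[OF Q(1)] finite_extreme_points[OF Q(1)] by (intro sum_multicount) auto
  moreover have "(\<Sum>v\<in>?V. card {e \<in> ?E. v \<in> e}) = 2 * card ?V"
    using two_edges_at_vertex[OF Q] by simp
  ultimately show ?thesis by simp
qed

subsection \<open>Orienting the edges of a polygon\<close>

text \<open>The wedge product of the two functionals. On a plane separated by \<alpha> and \<beta>
  it is a nonzero area form, so it orients the plane without a choice of basis.\<close>

definition area_form :: "'a::euclidean_space \<Rightarrow> 'a \<Rightarrow> 'a \<Rightarrow> 'a \<Rightarrow> real" where
  "area_form \<alpha> \<beta> p q = (\<alpha> \<bullet> p) * (\<beta> \<bullet> q) - (\<alpha> \<bullet> q) * (\<beta> \<bullet> p)"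

lemma area_form_simps [simp]:
  "area_form \<alpha> \<beta> (p + p') q = area_form \<alpha> \<beta> p q + area_form \<alpha> \<beta> p' q"
  "area_form \<alpha> \<beta> p (q + q') = area_form \<alpha> \<beta> p q + area_form \<alpha> \<beta> p q'"
  "area_form \<alpha> \<beta> (c *\<^sub>R p) q = c * area_form \<alpha> \<beta> p q"
  "area_form \<alpha> \<beta> p (c *\<^sub>R q) = c * area_form \<alpha> \<beta> p q"
  "area_form \<alpha> \<beta> (- p) q = - area_form \<alpha> \<beta> p q"
  "area_form \<alpha> \<beta> p (- q) = - area_form \<alpha> \<beta> p q"
  "area_form \<alpha> \<beta> p p = 0"
  by (simp_all add: area_form_def inner_add_right algebra_simps)

text \<open>For the direction space of a 2-face this is the negation of degeneracy for
  \<open>span {\<alpha>, \<beta>}\<close> (see \<open>degenerating_span_iff\<close>), in a form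
  explicit in the two spanning vectors.\<close>

definition separates :: "'a::euclidean_space \<Rightarrow> 'a \<Rightarrow> 'a set \<Rightarrow> bool" where
  "separates \<alpha> \<beta> S \<longleftrightarrow> (\<forall>v\<in>S. \<alpha> \<bullet> v = 0 \<and> \<beta> \<bullet> v = 0 \<longrightarrow> v = 0)"

lemma area_form_eq_0_imp_parallel:
  assumes "separates \<alpha> \<beta> S" "subspace S" "p \<in> S" "q \<in> S" "area_form \<alpha> \<beta> p q = 0" "p \<noteq> 0"
  obtains c where "q = c *\<^sub>R p"
proof -
  have 0: "v = 0" if "v \<in> S" "\<alpha> \<bullet> v = 0" "\<beta> \<bullet> v = 0" for v
    using that assms(1) by (simp add: separates_def)
  \<comment> \<open>Vanishing of the form makes this combination of \<open>p\<close> and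
    \<open>q\<close> a vector killed by \<alpha> and \<beta> alike.\<close>
  have *: "(\<gamma> \<bullet> q) *\<^sub>R p - (\<gamma> \<bullet> p) *\<^sub>R q = 0" if "\<gamma> = \<alpha> \<or> \<gamma> = \<beta>" for \<gamma>
    using assms that
    by (intro 0 subspace_diff subspace_scale) (auto simp: area_form_def inner_diff_right mult.commute)
  obtain \<gamma> where \<gamma>: "\<gamma> = \<alpha> \<or> \<gamma> = \<beta>" "\<gamma> \<bullet> p \<noteq> 0" using 0[OF assms(3)] assms(6) by blast
  have "(\<gamma> \<bullet> p) *\<^sub>R q = (\<gamma> \<bullet> q) *\<^sub>R p" using *[OF \<gamma>(1)] by simp
  then have "q = (\<gamma> \<bullet> q / (\<gamma> \<bullet> p)) *\<^sub>R p"
    using \<gamma>(2) by (metis divideR_right divide_inverse_commute scaleR_scaleR)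
  then show ?thesis ..
qed

text \<open>\<open>F\<close> lies on one side of the line through the edge. A functional supporting
  \<open>F\<close> exactly at the edge shows that any inward vector is a positive multiple of a
  fixed one, up to a multiple of the edge direction, which does not affect the area.\<close>

lemma area_form_edge:
  fixes F :: "'a::euclidean_space set"
  assumes F: "polytope F" "aff_dim F = 2" and sep: "separates \<alpha> \<beta> (dir_space F)"
    and e: "closed_segment a b edge_of F"
    and x: "x \<in> closed_segment a b" "x' \<in> closed_segment a b"
    and y: "y \<in> F - closed_segment a b" "y' \<in> F - closed_segment a b"
  shows "area_form \<alpha> \<beta> (b - a) (y - x) \<noteq> 0"
    and "sgn (area_form \<alpha> \<beta> (b - a) (y' - x')) = sgn (area_form \<alpha> \<beta> (b - a) (y - x))"
proof -
  let ?S = "dir_space F" and ?u = "b - a"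
  have eF: "closed_segment a b \<subseteq> F" using e by (rule edge_of_imp_subset)
  have S: "subspace ?S" "dim ?S = 2"
    using dim_dir_space[of F] F aff_dim_empty_eq[where 'a = 'a] by (force simp: subspace_dir_space)+
  obtain w where w: "closed_segment a b = max_face F w"
    using face_eq_max_face[OF F(1), of "closed_segment a b"] e by (auto simp: edge_of_def)
  have mem: "?u \<in> ?S" "y - x \<in> ?S" "y' - x' \<in> ?S"
    using x y eF segment_edge_ends[OF e] by (auto intro: diff_in_dir_space)
  have u0: "?u \<noteq> 0" using segment_edge_ends(1)[OF e] by auto
  have wu: "w \<bullet> ?u = 0"
    using inner_max_face_eq[of b F w a] w by (auto simp: inner_diff_right)
  have wy: "w \<bullet> (y - x) < 0" "w \<bullet> (y' - x') < 0"
    using inner_max_face_less[of x F w y] inner_max_face_less[of x' F w y'] x y w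
    by (auto simp: inner_diff_right)
  have ni: "y - x \<noteq> c *\<^sub>R ?u" for c using wy(1) wu by auto
  show nz: "area_form \<alpha> \<beta> ?u (y - x) \<noteq> 0"
  proof
    assume "area_form \<alpha> \<beta> ?u (y - x) = 0"
    then obtain c where "y - x = c *\<^sub>R ?u"
      using area_form_eq_0_imp_parallel[OF sep S(1) mem(1,2) _ u0] by blast
    then show False using ni by blast
  qed
  obtain c1 c2 where c: "y' - x' = c1 *\<^sub>R ?u + c2 *\<^sub>R (y - x)"
    using plane_coordinates[OF S mem(1,2) u0 ni mem(3)] by blast
  have "w \<bullet> (y' - x') = c2 * (w \<bullet> (y - x))"
    unfolding c using wu by (simp add: inner_add_right)
  then have "c2 > 0" using wy by (metis mult_le_0_iff mult_less_0_iff not_less order_less_imp_le)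
  then show "sgn (area_form \<alpha> \<beta> ?u (y' - x')) = sgn (area_form \<alpha> \<beta> ?u (y - x))"
    unfolding c by (simp add: sgn_mult)
qed

text \<open>\<open>cyclic_orientation\<close> constrains edges and vertices one at a time; that
  \<open>F\<close> lies on the same side of all directed edges is a global statement. The side
  agrees on consecutive edges, and the boundary of a polygon is connected.\<close>

lemma cyclic_orientation_sign:
  fixes F :: "'a::euclidean_space set"
  assumes F: "polytope F" "aff_dim F = 2" and sep: "separates \<alpha> \<beta> (dir_space F)"
    and D: "cyclic_orientation F D"
  obtains \<eta> :: real where
    "\<And>a b x y. (a, b) \<in> D \<Longrightarrow> x \<in> closed_segment a b \<Longrightarrow> y \<in> F - closed_segment a b \<Longrightarrow>
        sgn (area_form \<alpha> \<beta> (b - a) (y - x)) = \<eta>"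
proof -
  have De: "closed_segment a b edge_of F" if "(a, b) \<in> D" for a b
    using D that by (auto simp: cyclic_orientation_def)
  have Dx: "((a, b) \<in> D) \<noteq> ((b, a) \<in> D)" if "closed_segment a b edge_of F" for a b
    using D that by (auto simp: cyclic_orientation_def)
  have Dout: "b = b'" if "(v, b) \<in> D" "(v, b') \<in> D" for v b b'
    using D that segment_edge_ends(2)[OF De[OF that(1)]] unfolding cyclic_orientation_def by blast
  have Din: "a = a'" if "(a, v) \<in> D" "(a', v) \<in> D" for v a a'
    using D that segment_edge_ends(3)[OF De[OF that(1)]] unfolding cyclic_orientation_def by blast
  have pt: "\<exists>y. y \<in> F - closed_segment a b" if "closed_segment a b edge_of F" for a b
  proof -
    have "closed_segment a b \<noteq> F" using that F by (auto simp: edge_of_def)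
    then show ?thesis using edge_of_imp_subset[OF that] by blast
  qed
  define \<sigma> where "\<sigma> p = sgn (area_form \<alpha> \<beta> (snd p - fst p)
      ((SOME y. y \<in> F - closed_segment (fst p) (snd p)) - fst p))" for p
  have \<sigma>: "sgn (area_form \<alpha> \<beta> (b - a) (y - x)) = \<sigma> (a, b)"
    if "(a, b) \<in> D" "x \<in> closed_segment a b" "y \<in> F - closed_segment a b" for a b x y
    unfolding \<sigma>_def fst_conv snd_conv
    by (rule area_form_edge(2)[OF F sep De[OF that(1)] _ that(2) someI_ex[OF pt[OF De[OF that(1)]]] that(3)]) simp
  text \<open>Consecutive edges \<open>a v\<close> and \<open>v c\<close> have the same sign, since the area of \<open>(v - a, c - v)\<close>
    can be read off from either of them.\<close>
  have step: "\<sigma> (a, v) = \<sigma> (v, c)" if "(a, v) \<in> D" "(v, c) \<in> D" for a v c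
  proof -
    have "closed_segment a v \<noteq> closed_segment v c"
    proof
      assume "closed_segment a v = closed_segment v c"
      then have "a = c" using segment_edge_ends(1)[OF De[OF that(1)]] by (auto simp: doubleton_eq_iff)
      then show False using that Dx[OF De[OF that(1)]] by simp
    qed
    then have ne: "\<not> closed_segment v c \<subseteq> closed_segment a v" "\<not> closed_segment a v \<subseteq> closed_segment v c"
      using De[OF that(1)] De[OF that(2)] face_eqI_aff_dim unfolding edge_of_def by (metis, metis)
    then have "c \<in> F - closed_segment a v" "a \<in> F - closed_segment v c"
      using segment_edge_ends[OF De[OF that(1)]] segment_edge_ends[OF De[OF that(2)]]
      by (auto simp: subset_closed_segment)
    then have "\<sigma> (a, v) = sgn (area_form \<alpha> \<beta> (v - a) (c - v))"
      "\<sigma> (v, c) = sgn (area_form \<alpha> \<beta> (c - v) (a - v))"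
      using \<sigma>[OF that(1), of v c] \<sigma>[OF that(2), of v a] by simp_all
    moreover have "area_form \<alpha> \<beta> (c - v) (a - v) = area_form \<alpha> \<beta> (v - a) (c - v)"
      by (simp add: area_form_def inner_diff_right algebra_simps)
    ultimately show ?thesis by simp
  qed
  have fin: "finite D"
  proof (rule finite_subset)
    show "D \<subseteq> {v. v extreme_point_of F} \<times> {v. v extreme_point_of F}"
      using segment_edge_ends(2,3)[OF De] by auto
    show "finite ({v. v extreme_point_of F} \<times> {v. v extreme_point_of F})"
      using finite_extreme_points[OF F(1)] by simp
  qed
  have closedU: "closed (\<Union>{closed_segment a b | a b. (a, b) \<in> D \<and> Q (a, b)})" for Q
  proof (rule closed_Union)
    have "{closed_segment a b | a b. (a, b) \<in> D \<and> Q (a, b)} \<subseteq> (\<lambda>(a, b). closed_segment a b) ` D" by auto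
    then show "finite {closed_segment a b | a b. (a, b) \<in> D \<and> Q (a, b)}"
      using fin by (meson finite_imageI finite_subset)
  qed auto
  have same: "\<sigma> p = \<sigma> q" if pq: "p \<in> D" "q \<in> D" for p q
  proof (rule ccontr)
    assume ne: "\<sigma> p \<noteq> \<sigma> q"
    \<comment> \<open>Edges with the sign of \<open>p\<close> and edges with another sign cover the
      boundary by two closed sets. A common point would be a vertex joining consecutive edges of
      different sign, or one with two outgoing or two incoming edges.\<close>
    define A where "A = \<Union>{closed_segment a b | a b. (a, b) \<in> D \<and> \<sigma> (a, b) = \<sigma> p}"
    define B where "B = \<Union>{closed_segment a b | a b. (a, b) \<in> D \<and> \<sigma> (a, b) \<noteq> \<sigma> p}"
    have conn: "connected (rel_frontier F)"
      using F by (intro connected_sphere_gen) (auto simp: polytope_imp_convex polytope_imp_bounded)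
    have "rel_frontier F = \<Union>{e. e edge_of F}"
    proof -
      have "e facet_of F \<longleftrightarrow> e edge_of F" for e using F(2) by (auto simp: facet_of_def edge_of_def)
      then show ?thesis by (simp add: rel_frontier_of_polyhedron[OF polytope_imp_polyhedron[OF F(1)]])
    qed
    also have "\<dots> = A \<union> B"
    proof
      show "\<Union>{e. e edge_of F} \<subseteq> A \<union> B"
      proof
        fix z assume "z \<in> \<Union>{e. e edge_of F}"
        then obtain e where e: "e edge_of F" "z \<in> e" by blast
        obtain a b where ab: "e = closed_segment a b" using edge_of_polytope_segment[OF F(1) e(1)] by blast
        then have "(a, b) \<in> D \<or> (b, a) \<in> D" using Dx e by blast
        then show "z \<in> A \<union> B"
          unfolding A_def B_def using e(2) ab closed_segment_commute[of a b] by blast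
      qed
      show "A \<union> B \<subseteq> \<Union>{e. e edge_of F}" unfolding A_def B_def using De by blast
    qed
    finally have cover: "rel_frontier F = A \<union> B" .
    have "closed A" "closed B" unfolding A_def B_def by (rule closedU)+
    moreover have "A \<inter> B = {}"
    proof (rule ccontr)
      assume "A \<inter> B \<noteq> {}"
      then obtain z a b c d where z: "z \<in> closed_segment a b" "z \<in> closed_segment c d"
        and D1: "(a, b) \<in> D" "(c, d) \<in> D" and \<sigma>1: "\<sigma> (a, b) = \<sigma> p" "\<sigma> (c, d) \<noteq> \<sigma> p"
        unfolding A_def B_def by blast
      have "closed_segment a b \<noteq> closed_segment c d"
      proof
        assume "closed_segment a b = closed_segment c d"
        then have "a = c \<and> b = d \<or> a = d \<and> b = c" by (simp add: doubleton_eq_iff)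
        then show False using \<sigma>1 D1 Dx[OF De[OF D1(1)]] by auto
      qed
      then have zF: "z extreme_point_of F" using edges_Int_extreme_point[OF De[OF D1(1)] De[OF D1(2)] _ z] by blast
      then have "z extreme_point_of closed_segment a b" "z extreme_point_of closed_segment c d"
        using extreme_point_of_face De[OF D1(1)] De[OF D1(2)] z unfolding edge_of_def by blast+
      then have "(z = a \<or> z = b)" "(z = c \<or> z = d)" by (simp_all add: extreme_point_of_segment)
      moreover have "\<not> (z = a \<and> z = c)" using Dout D1 \<sigma>1 by metis
      moreover have "\<not> (z = b \<and> z = d)" using Din D1 \<sigma>1 by metis
      moreover have "\<not> (z = b \<and> z = c)" using step D1 \<sigma>1 by metis
      moreover have "\<not> (z = a \<and> z = d)" using step D1 \<sigma>1 by metis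
      ultimately show False by blast
    qed
    moreover have "A \<noteq> {}" "B \<noteq> {}"
      using pq ne by (cases p; cases q; force simp: A_def B_def)+
    ultimately show False
      using conn cover unfolding connected_closed by (metis Int_Un_eq(1) Int_absorb2 inf_sup_absorb Un_commute Int_empty_left order_refl)
  qed
  show ?thesis
  proof (cases "D = {}")
    case True
    then show ?thesis using that by auto
  next
    case False
    then obtain q where "q \<in> D" by blast
    then show ?thesis using that[of "\<sigma> q"] \<sigma> same by metis
  qed
qed

subsection \<open>Edges of the projected polytope\<close>

lemma two_faces_dim:
  assumes "F \<in> two_faces P"
  shows "F face_of P" "aff_dim F = 2" "F \<noteq> {}" "dim (dir_space F) = 2"
proof -
  show F: "F face_of P" "aff_dim F = 2" using assms by (auto simp: two_faces_def)
  then show "F \<noteq> {}" by auto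
  then show "dim (dir_space F) = 2" using dim_dir_space[of F] F(2) by simp
qed

lemma two_face_polytope: "polytope P \<Longrightarrow> F \<in> two_faces P \<Longrightarrow> polytope F"
  using face_of_polytope_polytope by (auto simp: two_faces_def)

lemma aff_dim_orth_proj_less_iff:
  fixes S :: "'a::euclidean_space set"
  assumes "subspace W" "S \<noteq> {}"
  shows "aff_dim (orth_proj W ` S) < aff_dim S \<longleftrightarrow> (\<exists>v\<in>dir_space S. v \<noteq> 0 \<and> (\<forall>w\<in>W. w \<bullet> v = 0))"
proof -
  have "aff_dim (orth_proj W ` S) < aff_dim S \<longleftrightarrow> dim (orth_proj W ` dir_space S) < dim (dir_space S)"
    using dim_dir_space[of "orth_proj W ` S"] dim_dir_space[OF assms(2)] assms(2)
    unfolding dir_space_linear_image[OF linear_orth_proj[OF assms(1)]] by auto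
  then show ?thesis
    by (simp add: dim_linear_image_less_iff linear_orth_proj subspace_dir_space orth_proj_eq_0_iff assms(1))
qed

lemma aff_dim_orth_proj_le:
  fixes S :: "'a::euclidean_space set"
  assumes "subspace W"
  shows "aff_dim (orth_proj W ` S) \<le> aff_dim S"
  by (rule aff_dim_linear_image_le[OF linear_orth_proj[OF assms]])

lemma degenerating_iff:
  assumes "subspace W" "F \<in> two_faces P"
  shows "degenerating W F \<longleftrightarrow> (\<exists>v\<in>dir_space F. v \<noteq> 0 \<and> (\<forall>w\<in>W. w \<bullet> v = 0))"
  using aff_dim_orth_proj_less_iff[OF assms(1) two_faces_dim(3)[OF assms(2)]] two_faces_dim(2)[OF assms(2)]
  by (auto simp: degenerating_def collinear_aff_dim)

lemma parallel_class_subset: "parallel_rel P `` {F} \<subseteq> two_faces P"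
  by (auto simp: parallel_rel_def)

lemma admissible_iff:
  "admissible P W \<longleftrightarrow> linear_plane W \<and> (\<forall>F\<in>two_faces P. \<not> degenerating W F)"
proof -
  have "(\<forall>C\<in>face_classes P. \<not> class_degenerating W C) \<longleftrightarrow> (\<forall>F\<in>two_faces P. \<not> degenerating W F)"
  proof
    assume *: "\<forall>C\<in>face_classes P. \<not> class_degenerating W C"
    show "\<forall>F\<in>two_faces P. \<not> degenerating W F"
    proof
      fix F assume F: "F \<in> two_faces P"
      then have "parallel_rel P `` {F} \<in> face_classes P" "F \<in> parallel_rel P `` {F}"
        by (auto simp: face_classes_def quotient_def parallel_rel_def)
      then show "\<not> degenerating W F" using * by (auto simp: class_degenerating_def)
    qed
  next
    assume *: "\<forall>F\<in>two_faces P. \<not> degenerating W F"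
    show "\<forall>C\<in>face_classes P. \<not> class_degenerating W C"
      using * parallel_class_subset[of P] by (fastforce simp: face_classes_def quotient_def class_degenerating_def)
  qed
  then show ?thesis by (auto simp: admissible_def)
qed

lemma only_degenerating_classI:
  assumes W: "subspace W" and F: "F \<in> two_faces P" "degenerating W F"
    and only: "\<And>G. G \<in> two_faces P \<Longrightarrow> degenerating W G \<Longrightarrow> dir_space G = dir_space F"
  shows "only_degenerating_class P W F"
proof -
  have "C = parallel_rel P `` {F}" if C: "C \<in> face_classes P" "class_degenerating W C" for C
  proof -
    obtain G where G: "G \<in> two_faces P" "C = parallel_rel P `` {G}"
      using C(1) by (auto simp: face_classes_def quotient_def)
    obtain H where H: "H \<in> C" "degenerating W H" using C(2) by (auto simp: class_degenerating_def)
    then have "dir_space H = dir_space F" using only G parallel_class_subset by blast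
    moreover have "dir_space H = dir_space G" using H G by (auto simp: parallel_rel_def)
    ultimately show ?thesis using G F by (auto simp: parallel_rel_def)
  qed
  moreover have "parallel_rel P `` {F} \<in> face_classes P" using F by (auto simp: face_classes_def quotient_def)
  moreover have "class_degenerating W (parallel_rel P `` {F})"
    unfolding class_degenerating_def using F by (intro bexI[of _ F]) (auto simp: parallel_rel_def)
  ultimately show ?thesis unfolding only_degenerating_class_def by blast
qed

lemma max_face_cong:
  assumes "\<And>y. y \<in> P \<Longrightarrow> z \<bullet> y = w \<bullet> y"
  shows "max_face P z = max_face P w"
  unfolding max_face_def using assms by auto

lemma max_face_orth_proj:
  assumes "subspace W" "w \<in> W"
  shows "max_face (orth_proj W ` P) w = orth_proj W ` max_face P w"
  using assms by (auto simp: max_face_def inner_orth_proj)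

lemma edge_in_two_face:
  fixes P :: "'a::euclidean_space set"
  assumes "polytope P" "aff_dim P \<ge> 2" "e edge_of P"
  obtains F where "F \<in> two_faces P" "e \<subseteq> F" "dir_space e \<subseteq> dir_space F"
proof -
  have "e \<noteq> {}" using assms(3) by (auto simp: edge_of_def)
  then obtain F where "F face_of P" "e \<subseteq> F" "aff_dim F = 2"
    using exists_face_aff_dim_between[OF assms(1), of e 2] assms by (auto simp: edge_of_def)
  then show ?thesis using that[of F] dir_space_mono[of e F] by (simp add: two_faces_def)
qed

text \<open>Equality with the maximal face, rather than inclusion, excludes edges lying inside a
  larger maximal face.\<close>

definition silhouette :: "'a::euclidean_space set \<Rightarrow> 'a set \<Rightarrow> 'a set set" where
  "silhouette P W = {e. e edge_of P \<and> (\<exists>w\<in>W. max_face P w = e)}"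

text \<open>Functionals from \<open>W\<close> factor through the projection, so edges of the
  projection are images of their maximal faces. Admissibility keeps these faces one-dimensional and
  their images from collapsing to points.\<close>

lemma bij_betw_silhouette:
  fixes P :: "'a::euclidean_space set"
  assumes P: "polytope P" "aff_dim P \<ge> 2" and adm: "admissible P W"
  shows "bij_betw ((`) (orth_proj W)) (silhouette P W) {e. e edge_of orth_proj W ` P}"
proof -
  let ?\<pi> = "orth_proj W"
  have W: "subspace W" and nd: "\<And>F. F \<in> two_faces P \<Longrightarrow> \<not> degenerating W F"
    using adm by (auto simp: admissible_iff linear_plane_def)
  have Q: "polytope (?\<pi> ` P)" "?\<pi> ` P \<noteq> {}"
    using P polytope_linear_image[OF linear_orth_proj[OF W]] by auto
  have cP: "convex P" "convex (?\<pi> ` P)" using P Q polytope_imp_convex by auto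
  show ?thesis
    unfolding bij_betw_def
  proof
    \<comment> \<open>The edge \<open>e'\<close> is recovered from its image as the part of
      \<open>P\<close> whose projection is maximal for \<open>w\<close>.\<close>
    have "e \<subseteq> e'" if ee: "e \<in> silhouette P W" "e' \<in> silhouette P W" "?\<pi> ` e = ?\<pi> ` e'" for e e'
    proof
      obtain w where w: "w \<in> W" "e' = max_face P w" using ee(2) by (auto simp: silhouette_def)
      fix x assume "x \<in> e"
      then have "x \<in> P" using ee(1) by (auto simp: silhouette_def dest: edge_of_imp_subset)
      have "?\<pi> x \<in> max_face (?\<pi> ` P) w"
        using \<open>x \<in> e\<close> ee(3) max_face_orth_proj[OF W w(1), of P] w(2) by auto
      then show "x \<in> e'" using \<open>x \<in> P\<close> w W by (auto simp: max_face_def inner_orth_proj)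
    qed
    then show "inj_on ((`) ?\<pi>) (silhouette P W)" by (intro inj_onI) blast
    show "(`) ?\<pi> ` silhouette P W = {e. e edge_of ?\<pi> ` P}"
    proof (intro equalityI subsetI)
      fix e' assume "e' \<in> (`) ?\<pi> ` silhouette P W"
      then obtain e w where e: "e edge_of P" "w \<in> W" "max_face P w = e" "e' = ?\<pi> ` e"
        by (auto simp: silhouette_def)
      have "e' face_of ?\<pi> ` P"
        using max_face_of[OF cP(2), of w] max_face_orth_proj[OF W e(2), of P] e(3,4) by simp
      moreover have "aff_dim e' = 1"
      proof -
        obtain F where F: "F \<in> two_faces P" "dir_space e \<subseteq> dir_space F"
          by (rule edge_in_two_face[OF P e(1)])
        have "e \<noteq> {}" "aff_dim e = 1" using e(1) by (auto simp: edge_of_def)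
        moreover have "\<not> aff_dim (?\<pi> ` e) < aff_dim e"
          using nd[OF F(1)] F(2) aff_dim_orth_proj_less_iff[OF W \<open>e \<noteq> {}\<close>] degenerating_iff[OF W F(1)] by blast
        ultimately show ?thesis using aff_dim_orth_proj_le[OF W, of e] e(4) by simp
      qed
      ultimately show "e' \<in> {e. e edge_of ?\<pi> ` P}" by (simp add: edge_of_def)
    next
      fix e' assume "e' \<in> {e. e edge_of ?\<pi> ` P}"
      then have e': "e' face_of ?\<pi> ` P" "aff_dim e' = 1" by (auto simp: edge_of_def)
      then have "e' \<noteq> {}" by auto
      then obtain z where z: "e' = max_face (?\<pi> ` P) z"
        using face_eq_max_face[OF Q(1) e'(1)] by blast
      \<comment> \<open>Only the component of \<open>z\<close> in \<open>W\<close> matters on the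
        projection.\<close>
      define w where "w = ?\<pi> z"
      have w: "w \<in> W" using orth_proj_decomp(1)[OF W] by (simp add: w_def)
      have "z \<bullet> y = w \<bullet> y" if "y \<in> ?\<pi> ` P" for y
        using inner_orth_proj[OF W subsetD[OF orth_proj_image_subset[OF W] that], of z]
        by (simp add: w_def inner_commute)
      then have "e' = max_face (?\<pi> ` P) w"
        unfolding z by (rule max_face_cong)
      then have e: "e' = ?\<pi> ` max_face P w" by (simp add: max_face_orth_proj[OF W w])
      have f: "max_face P w face_of P" by (rule max_face_of[OF cP(1)])
      have "aff_dim (max_face P w) \<ge> 1" using aff_dim_orth_proj_le[OF W, of "max_face P w"] e e'(2) by simp
      \<comment> \<open>A maximal face this large contains a 2-face, whose projection would lie in
        the edge \<open>e'\<close>, hence in a line.\<close>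
      moreover have "\<not> aff_dim (max_face P w) \<ge> 2"
      proof
        assume "aff_dim (max_face P w) \<ge> 2"
        then obtain F where F: "F face_of max_face P w" "aff_dim F = 2"
          using exists_face_aff_dim[OF face_of_polytope_polytope[OF P(1) f], of 2] by auto
        then have "F \<in> two_faces P" using face_of_trans[OF F(1) f] by (simp add: two_faces_def)
        moreover have "aff_dim (?\<pi> ` F) \<le> 1"
          using aff_dim_subset[of "?\<pi> ` F" e'] face_of_imp_subset[OF F(1)] e e'(2) by auto
        ultimately show False using nd by (auto simp: degenerating_def collinear_aff_dim)
      qed
      ultimately have "max_face P w edge_of P" using f by (simp add: edge_of_def)
      then show "e' \<in> (`) ?\<pi> ` silhouette P W" using e w by (auto simp: silhouette_def)
    qed
  qed
qed

lemma k_gon_card_silhouette: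
  fixes P :: "'a::euclidean_space set"
  assumes P: "polytope P" "aff_dim P = DIM('a)" "DIM('a) \<ge> 2" and adm: "admissible P W"
  shows "k_gon (card (silhouette P W)) (orth_proj W ` P)"
proof -
  let ?Q = "orth_proj W ` P"
  have W: "subspace W" "dim W = 2" using adm by (auto simp: admissible_iff linear_plane_def)
  have Q: "polytope ?Q" using P polytope_linear_image[OF linear_orth_proj[OF W(1)]] by auto
  have "?Q \<noteq> {}" using P by auto
  have "orth_proj W ` UNIV = W"
    using orth_proj_image_subset[OF W(1), of UNIV] orth_proj_ident[OF W(1)] by (metis UNIV_I rev_image_eqI subsetI subset_antisym)
  then have "dir_space ?Q = W"
    by (simp add: dir_space_linear_image[OF linear_orth_proj[OF W(1)]] dir_space_full_dim[OF P(2)])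
  then have Q2: "aff_dim ?Q = 2" using dim_dir_space[OF \<open>?Q \<noteq> {}\<close>] W(2) by simp
  have "card (silhouette P W) = card {e. e edge_of ?Q}"
    using bij_betw_same_card[OF bij_betw_silhouette[OF P(1) _ adm]] P by simp
  then show ?thesis
    using card_extreme_points_eq_card_edges[OF Q Q2] Q Q2 by (simp add: k_gon_def)
qed

subsection \<open>Signed edge counts of compensating faces\<close>

lemma segment_direction_cases:
  fixes a b :: "'a::euclidean_space"
  assumes "closed_segment a b = closed_segment a' b'"
  shows "b' - a' = b - a \<or> b' - a' = - (b - a)"
  using assms by (auto simp: doubleton_eq_iff)

text \<open>The sign of \<beta> along \<open>e\<close> when \<open>e\<close> is directed so that
  \<open>F\<close> lies on its positive side. Reversing \<open>e\<close> flips both factors, so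
  neither the choice of ends nor that of \<open>x\<close> and \<open>y\<close> matters.\<close>

definition edge_sign :: "'a::euclidean_space \<Rightarrow> 'a \<Rightarrow> 'a set \<Rightarrow> 'a set \<Rightarrow> real" where
  "edge_sign \<alpha> \<beta> F e = (SOME s. \<exists>a b x y. e = closed_segment a b \<and> x \<in> e \<and> y \<in> F - e \<and>
     s = sgn (area_form \<alpha> \<beta> (b - a) (y - x)) * sgn (\<beta> \<bullet> (b - a)))"

lemma edge_sign_eq:
  fixes F :: "'a::euclidean_space set"
  assumes F: "polytope F" "aff_dim F = 2" and sep: "separates \<alpha> \<beta> (dir_space F)"
    and e: "e edge_of F" "e = closed_segment a b" and x: "x \<in> e" and y: "y \<in> F - e"
  shows "edge_sign \<alpha> \<beta> F e = sgn (area_form \<alpha> \<beta> (b - a) (y - x)) * sgn (\<beta> \<bullet> (b - a))"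
  unfolding edge_sign_def
proof (rule some_equality)
  show "\<exists>a' b' x' y'. e = closed_segment a' b' \<and> x' \<in> e \<and> y' \<in> F - e \<and>
     sgn (area_form \<alpha> \<beta> (b - a) (y - x)) * sgn (\<beta> \<bullet> (b - a)) =
     sgn (area_form \<alpha> \<beta> (b' - a') (y' - x')) * sgn (\<beta> \<bullet> (b' - a'))"
    using e x y by blast
next
  fix s assume "\<exists>a b x y. e = closed_segment a b \<and> x \<in> e \<and> y \<in> F - e \<and>
     s = sgn (area_form \<alpha> \<beta> (b - a) (y - x)) * sgn (\<beta> \<bullet> (b - a))"
  then obtain a' b' x' y' where s: "e = closed_segment a' b'" "x' \<in> e" "y' \<in> F - e"
    "s = sgn (area_form \<alpha> \<beta> (b' - a') (y' - x')) * sgn (\<beta> \<bullet> (b' - a'))" by blast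
  note sign = area_form_edge(2)[OF F sep, of a b, folded e(2), OF e(1) x s(2) y s(3)]
  have "b' - a' = b - a \<or> b' - a' = - (b - a)"
    using segment_direction_cases[of a b a' b'] s(1) e(2) by simp
  then show "s = sgn (area_form \<alpha> \<beta> (b - a) (y - x)) * sgn (\<beta> \<bullet> (b - a))"
  proof
    assume "b' - a' = b - a"
    then show ?thesis by (simp only: s(4) sign)
  next
    assume "b' - a' = - (b - a)"
    then show ?thesis
      by (simp only: s(4) area_form_simps(5) inner_minus_right sgn_minus minus_mult_minus sign)
  qed
qed

text \<open>The right-hand side is the same for both faces of a pair, while
  \<open>\<zeta> \<bullet> (x - y)\<close> changes sign when they are exchanged. Hence
  counterclockwise orientations of opposite faces have opposite area signs.\<close>

lemma ccw_direction_sign: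
  fixes P :: "'a::euclidean_space set"
  assumes F: "F \<subseteq> P" "dir_space F = dir_space G" and G: "G \<subseteq> P" and xy: "x \<in> F" "y \<in> G"
    and \<zeta>: "\<And>v. v \<in> dir_space F \<Longrightarrow> \<zeta> \<bullet> v = 0"
    and e: "e \<subseteq> F" and u: "u \<in> dir_space F"
    and ccw: "ccw_direction P b e F G u"
  obtains p q where "p \<in> e" "q \<in> F - e"
    "sgn (area_form \<alpha> \<beta> u (q - p)) * sgn (\<zeta> \<bullet> (x - y)) =
      sgn (det (\<chi> j k. (vector [\<alpha>, \<beta>, \<zeta>] :: 'a ^ 3) $ k \<bullet> b $ j :: real ^ 3 ^ 3))"
proof -
  let ?\<psi> = "vector [\<alpha>, \<beta>, \<zeta>] :: 'a ^ 3"
  let ?A = "affine hull (F \<union> G)"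
  obtain w n where w: "points_into e F w" and n: "outward_normal (P \<inter> ?A) F n"
    and pos: "positively_oriented b (vector [u, w, n])"
    using ccw by (auto simp: ccw_direction_def)
  obtain p q where pq: "p \<in> e" "q \<in> F - e" "w = q - p" using w by (auto simp: points_into_def)
  have wF: "w \<in> dir_space F" using pq e by (auto intro: diff_in_dir_space)
  let ?v = "vector [u, w, n] :: 'a ^ 3"
  obtain M :: "real ^ 3 ^ 3" where M: "det M > 0" "\<And>i. ?v $ i = (\<Sum>j\<in>UNIV. (M $ i $ j) *\<^sub>R (b $ j))"
    using pos by (auto simp: positively_oriented_def)
  define Y :: "real ^ 3 ^ 3" where "Y = (\<chi> j k. ?\<psi> $ k \<bullet> b $ j)"
  define X :: "real ^ 3 ^ 3" where "X = (\<chi> i k. ?\<psi> $ k \<bullet> ?v $ i)"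
  \<comment> \<open>The three functionals are evaluated on \<open>(u, w, n)\<close> and on the basis
    \<open>b\<close>; the two determinants differ by the positive factor \<open>det M\<close>. As
    \<zeta> kills \<open>u\<close> and \<open>w\<close>, the first one splits into area form times
    \<open>\<zeta> \<bullet> n\<close>.\<close>
  have "X = M ** Y"
    by (simp add: X_def Y_def matrix_matrix_mult_def M(2) inner_sum_right vec_eq_iff)
  then have "det X = det M * det Y" by (simp add: det_mul)
  moreover have "det X = area_form \<alpha> \<beta> u w * (\<zeta> \<bullet> n)"
    using \<zeta>[OF u] \<zeta>[OF wF] by (simp add: det_3 X_def area_form_def algebra_simps)
  ultimately have 1: "sgn (area_form \<alpha> \<beta> u w) * sgn (\<zeta> \<bullet> n) = sgn (det Y)"
    using M(1) by (metis mult_1 sgn_mult sgn_pos)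
  \<comment> \<open>The faces are parallel, so the section has at most one direction beyond theirs,
    that of \<open>y - x\<close>. Modulo \<open>dir_space F\<close> the outward normal is therefore
    a multiple of \<open>y - x\<close>, and outwardness makes the factor negative.\<close>
  have "n \<in> span (insert (y - x) (dir_space F))"
  proof -
    let ?V = "span (insert (y - x) (dir_space F))"
    have "F \<union> G \<subseteq> {z. z - x \<in> ?V}"
    proof
      fix z assume "z \<in> F \<union> G"
      then show "z \<in> {z. z - x \<in> ?V}"
      proof
        assume "z \<in> F"
        then show ?thesis using xy by (auto intro!: span_base diff_in_dir_space)
      next
        assume "z \<in> G"
        then have "z - y \<in> dir_space F" using xy F(2) by (auto intro: diff_in_dir_space)
        then have "(z - y) + (y - x) \<in> ?V" by (intro span_add) (auto intro: span_base)
        then show ?thesis by simp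
      qed
    qed
    moreover have "affine {z. z - x \<in> ?V}"
    proof -
      have "{z. z - x \<in> ?V} = (+) x ` ?V" by (force simp: image_iff algebra_simps)
      then show ?thesis by (simp add: affine_translation[symmetric] subspace_imp_affine)
    qed
    ultimately have "?A \<subseteq> {z. z - x \<in> ?V}" by (rule hull_minimal)
    then have "dir_space (P \<inter> ?A) \<subseteq> ?V" by (intro dir_space_least[of _ _ x]) auto
    then show ?thesis using n by (auto simp: outward_normal_def)
  qed
  then obtain k where "n - k *\<^sub>R (y - x) \<in> span (dir_space F)"
    by (auto simp: span_breakdown_eq)
  then have k: "n - k *\<^sub>R (y - x) \<in> dir_space F" by (metis span_eq_iff subspace_dir_space)
  have "n \<noteq> 0" and orth: "\<And>v. v \<in> dir_space F \<Longrightarrow> n \<bullet> v = 0"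
    and le: "\<And>x y. x \<in> F \<Longrightarrow> y \<in> P \<inter> ?A \<Longrightarrow> n \<bullet> y \<le> n \<bullet> x"
    using n by (auto simp: outward_normal_def orthogonal_comp_def orthogonal_def inner_commute)
  have "n \<bullet> n = k * (n \<bullet> (y - x))" using orth[OF k] by (simp add: inner_diff_right)
  moreover have "n \<bullet> (y - x) \<le> 0"
    using le[OF xy(1), of y] xy(2) G hull_inc[of y "F \<union> G" affine] by (auto simp: inner_diff_right)
  moreover have "n \<bullet> n > 0" using \<open>n \<noteq> 0\<close> by simp
  ultimately have "k < 0" by (metis mult_nonneg_nonpos not_le)
  moreover have "\<zeta> \<bullet> n = (- k) * (\<zeta> \<bullet> (x - y))" using \<zeta>[OF k] by (simp add: inner_diff_right algebra_simps)
  ultimately have "sgn (\<zeta> \<bullet> n) = sgn (\<zeta> \<bullet> (x - y))" by (simp add: sgn_mult)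
  then show ?thesis using that[OF pq(1,2)] 1 pq(3) by (simp add: Y_def)
qed

lemma sum_over_pairs_eq_0:
  fixes j :: "'b \<Rightarrow> real"
  assumes "finite A" "partition_on A \<P>" "\<And>B. B \<in> \<P> \<Longrightarrow> \<exists>s t. B = {s, t} \<and> s \<noteq> t \<and> j s + j t = 0"
  shows "sum j A = 0"
proof -
  have B: "finite B \<and> sum j B = 0" if "B \<in> \<P>" for B using assms(3)[OF that] by auto
  have "sum j (\<Union>\<P>) = (\<Sum>B\<in>\<P>. sum j B)"
    using assms(2) B unfolding partition_on_def disjoint_def
    by (subst sum.Union_disjoint) auto
  then show ?thesis using B assms(2) by (simp add: partition_on_def)
qed

lemma finite_edge_two_faces:
  assumes "polytope P"
  shows "finite (edge_two_faces P)"
proof (rule finite_subset)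
  let ?\<F> = "{F. F face_of P}"
  show "edge_two_faces P \<subseteq> ?\<F> \<times> ?\<F> \<times> ?\<F>"
    by (auto simp: edge_two_faces_def simultaneously_visible_def two_faces_def parallel_rel_def edge_of_def
        intro: face_of_trans split: if_splits)
  show "finite (?\<F> \<times> ?\<F> \<times> ?\<F>)" using finite_polytope_faces[OF assms] by simp
qed

lemma compensating_sum_eq_0:
  fixes P :: "'a::euclidean_space set" and j :: "'a set \<times> 'a set \<times> 'a set \<Rightarrow> real"
  assumes "polytope P" "partitioned_into_compensating_pairs P ori cyc"
    and "\<And>s t. s \<in> edge_two_faces P \<Longrightarrow> t \<in> edge_two_faces P \<Longrightarrow> compensate P ori cyc s t \<Longrightarrow> j s + j t = 0"
  shows "sum j (edge_two_faces P) = 0"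
proof -
  obtain \<P> where \<P>: "partition_on (edge_two_faces P) \<P>"
    "\<And>B. B \<in> \<P> \<Longrightarrow> \<exists>s t. B = {s, t} \<and> compensate P ori cyc s t"
    using assms(2) by (auto simp: partitioned_into_compensating_pairs_def)
  show ?thesis
  proof (rule sum_over_pairs_eq_0[OF finite_edge_two_faces[OF assms(1)] \<P>(1)])
    fix B assume "B \<in> \<P>"
    then obtain s t where st: "B = {s, t}" "compensate P ori cyc s t" using \<P>(2) by blast
    then have "s \<in> edge_two_faces P" "t \<in> edge_two_faces P"
      using \<P>(1) \<open>B \<in> \<P>\<close> by (auto simp: partition_on_def)
    moreover have "s \<noteq> t" using st(2) by (cases s; cases t) auto
    ultimately show "\<exists>s t. B = {s, t} \<and> s \<noteq> t \<and> j s + j t = 0" using st assms(3) by blast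
  qed
qed

lemma sum_edge_two_faces:
  fixes h :: "'a::euclidean_space set \<Rightarrow> real"
  assumes "polytope P" "simultaneously_visible P F F'"
  shows "(\<Sum>(e, G, G')\<in>edge_two_faces P. if G = F \<and> G' = F' then h e else 0) = (\<Sum>e | e edge_of F. h e)"
proof -
  have "(\<Sum>(e, G, G')\<in>edge_two_faces P. if G = F \<and> G' = F' then h e else 0) =
    (\<Sum>(e, G, G')\<in>(\<lambda>e. (e, F, F')) ` {e. e edge_of F}. h e)"
  proof (rule sum.mono_neutral_cong_right[OF finite_edge_two_faces[OF assms(1)]])
    show "(\<lambda>e. (e, F, F')) ` {e. e edge_of F} \<subseteq> edge_two_faces P"
      using assms(2) by (auto simp: edge_two_faces_def)
    show "\<forall>s\<in>edge_two_faces P - (\<lambda>e. (e, F, F')) ` {e. e edge_of F}.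
        (case s of (e, G, G') \<Rightarrow> if G = F \<and> G' = F' then h e else 0) = 0"
    proof
      fix s assume s: "s \<in> edge_two_faces P - (\<lambda>e. (e, F, F')) ` {e. e edge_of F}"
      obtain e G G' where [simp]: "s = (e, G, G')" by (cases s) auto
      have "e edge_of G" using s by (simp add: edge_two_faces_def)
      then have "\<not> (G = F \<and> G' = F')" using s by auto
      then show "(case s of (e, G, G') \<Rightarrow> if G = F \<and> G' = F' then h e else 0) = 0" by auto
    qed
  qed auto
  also have "\<dots> = (\<Sum>e | e edge_of F. h e)"
    by (subst sum.reindex) (auto simp: inj_on_def)
  finally show ?thesis .
qed

lemma simultaneously_visible_sym:
  assumes "simultaneously_visible P F F'" "F' \<noteq> {}"
  shows "simultaneously_visible P F' F"
proof -
  have "F \<noteq> {}" using assms(1) by (auto simp: simultaneously_visible_def two_faces_def)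
  moreover have "(F, F') \<in> parallel_rel P" using assms by (simp add: simultaneously_visible_def)
  then have "(F', F) \<in> parallel_rel P" "F' \<in> two_faces P" "parallel_rel P `` {F'} = parallel_rel P `` {F}"
    by (auto simp: parallel_rel_def)
  ultimately show ?thesis
    using assms by (auto simp: simultaneously_visible_def only_degenerating_class_def)
qed

text \<open>The cyclic orientation gives all edges of \<open>F\<close> one area sign, so up to a
  common factor \<open>edge_sign\<close> is the sign of \<beta> along the oriented edge, which is
  opposite for compensating edges.\<close>

lemma signed_edge_sum_single:
  fixes P :: "'a::euclidean_space set"
  assumes P: "polytope P" and ori: "orientation_choice P ori cyc"
    and part: "partitioned_into_compensating_pairs P ori cyc"
    and vis: "simultaneously_visible P F {}" and sep: "separates \<alpha> \<beta> (dir_space F)"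
  shows "(\<Sum>e | e edge_of F. edge_sign \<alpha> \<beta> F e) = 0"
proof -
  have F2: "F \<in> two_faces P" using vis by (simp add: simultaneously_visible_def)
  note F = two_face_polytope[OF P F2] two_faces_dim(2)[OF F2]
  have cycF: "cyclic_orientation F (cyc F)" using ori vis by (auto simp: orientation_choice_def)
  obtain \<eta> where \<eta>: "\<And>a b x y. (a, b) \<in> cyc F \<Longrightarrow> x \<in> closed_segment a b \<Longrightarrow> y \<in> F - closed_segment a b \<Longrightarrow>
        sgn (area_form \<alpha> \<beta> (b - a) (y - x)) = \<eta>"
    using cyclic_orientation_sign[OF F sep cycF] by blast
  have val: "edge_sign \<alpha> \<beta> F e = \<eta> * sgn (\<beta> \<bullet> (b - a))"
    if e: "e edge_of F" "oriented_as P ori cyc (e, F, {}) (a, b)" for e a b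
  proof -
    have ab: "e = closed_segment a b" "(a, b) \<in> cyc F" using e(2) by auto
    have "e \<noteq> F" using e(1) F(2) by (auto simp: edge_of_def)
    then obtain y where "y \<in> F - e" using edge_of_imp_subset[OF e(1)] by blast
    then show ?thesis using edge_sign_eq[OF F sep e(1) ab(1), of a y] \<eta>[OF ab(2), of a y] ab(1) by simp
  qed
  have "(\<Sum>(e, G, G')\<in>edge_two_faces P. if G = F \<and> G' = {} then edge_sign \<alpha> \<beta> F e else 0) = 0"
  proof (rule compensating_sum_eq_0[OF P part])
    fix s t assume st: "s \<in> edge_two_faces P" "t \<in> edge_two_faces P" "compensate P ori cyc s t"
    obtain e G G' g H H' where s: "s = (e, G, G')" and t: "t = (g, H, H')" by (cases s; cases t) auto
    have ne: "G \<noteq> {}" "H \<noteq> {}" "e edge_of G" "g edge_of H"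
      using st(1,2) by (auto simp: s t edge_two_faces_def simultaneously_visible_def two_faces_def)
    obtain a b a' b' c where o: "oriented_as P ori cyc s (a, b)" "oriented_as P ori cyc t (a', b')"
      "c > 0" "b' - a' = - (c *\<^sub>R (b - a))"
      using st(3) unfolding s t compensate.simps oppositely_oriented_def by blast
    have alt: "G = H' \<and> G' = H \<or> G = H \<and> G' = H'" using st(3) by (auto simp: s t)
    show "(case s of (e, G, G') \<Rightarrow> if G = F \<and> G' = {} then edge_sign \<alpha> \<beta> F e else 0) +
      (case t of (e, G, G') \<Rightarrow> if G = F \<and> G' = {} then edge_sign \<alpha> \<beta> F e else 0) = 0"
    proof (cases "G = F \<and> G' = {}")
      case True
      \<comment> \<open>The exchanged alternative would make a 2-face empty, so the partner also
        belongs to \<open>(F, {})\<close>.\<close>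
      then have GH: "H = F" "H' = {}" using alt ne by auto
      have "edge_sign \<alpha> \<beta> F e = \<eta> * sgn (\<beta> \<bullet> (b - a))" "edge_sign \<alpha> \<beta> F g = \<eta> * sgn (\<beta> \<bullet> (b' - a'))"
        using val ne o(1,2) True GH unfolding s t by blast+
      then show ?thesis using True GH o(3) by (simp add: s t o(4) sgn_mult)
    next
      case False
      then have "\<not> (H = F \<and> H' = {})" using alt ne by auto
      with False show ?thesis by (simp only: s t prod.case if_False)
    qed
  qed
  then show ?thesis using sum_edge_two_faces[OF P vis, of "edge_sign \<alpha> \<beta> F"] by simp
qed

text \<open>The counterclockwise orientation gives area sign \<eta> on \<open>F\<close> and the
  opposite sign on \<open>F'\<close>. Counting \<open>F'\<close> negatively turns both into \<eta>
  times the sign of \<beta> along the oriented edge, so compensating pairs cancel within one face as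
  well as across both.\<close>

lemma signed_edge_sum_pair:
  fixes P :: "'a::euclidean_space set"
  assumes P: "polytope P" and ori: "orientation_choice P ori cyc"
    and part: "partitioned_into_compensating_pairs P ori cyc"
    and vis: "simultaneously_visible P F F'" "F' \<noteq> {}"
    and sep: "separates \<alpha> \<beta> (dir_space F)"
    and \<zeta>: "max_face P \<zeta> = F" "max_face P (- \<zeta>) = F'"
  shows "(\<Sum>e | e edge_of F. edge_sign \<alpha> \<beta> F e) = (\<Sum>e | e edge_of F'. edge_sign \<alpha> \<beta> F' e)"
proof -
  have F2: "F \<in> two_faces P" "F' \<in> two_faces P" and par: "dir_space F = dir_space F'" and FF': "F \<noteq> F'"
    using vis by (auto simp: simultaneously_visible_def parallel_rel_def)
  note vis' = simultaneously_visible_sym[OF vis]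
  note F = two_face_polytope[OF P F2(1)] two_faces_dim(2)[OF F2(1)]
  note F' = two_face_polytope[OF P F2(2)] two_faces_dim(2)[OF F2(2)]
  have sep': "separates \<alpha> \<beta> (dir_space F')" using sep par by simp
  obtain x y where xy: "x \<in> F" "y \<in> F'" using two_faces_dim(3) F2 by blast
  have sub: "F \<subseteq> P" "F' \<subseteq> P" using F2 by (auto simp: two_faces_def dest: face_of_imp_subset)
  have \<zeta>0: "\<zeta> \<bullet> v = 0" if "v \<in> dir_space F" for v using inner_dir_max_face[of v P \<zeta>] that \<zeta> by simp
  \<comment> \<open>Otherwise \<zeta> would be constant on \<open>P\<close>, and both maximal faces
    would be all of \<open>P\<close>.\<close>
  have "\<zeta> \<bullet> y < \<zeta> \<bullet> x"
  proof (rule ccontr)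
    assume "\<not> ?thesis"
    moreover have "\<zeta> \<bullet> z \<le> \<zeta> \<bullet> x" "\<zeta> \<bullet> y \<le> \<zeta> \<bullet> z" if "z \<in> P" for z
      using xy \<zeta> that by (auto simp: max_face_def)
    ultimately have "\<zeta> \<bullet> z = \<zeta> \<bullet> x" if "z \<in> P" for z using that by (meson le_less_trans less_le not_less)
    then have "F = P" "F' = P" unfolding \<zeta>[symmetric] using xy sub by (auto simp: max_face_def)
    then show False using FF' by simp
  qed
  then have pos: "sgn (\<zeta> \<bullet> (x - y)) = 1" "sgn (\<zeta> \<bullet> (y - x)) = -1" by (auto simp: inner_diff_right)
  define \<eta> where "\<eta> = sgn (det (\<chi> j k. (vector [\<alpha>, \<beta>, \<zeta>] :: 'a ^ 3) $ k \<bullet> ori (affine hull (F \<union> F')) $ j :: real ^ 3 ^ 3))"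
  have val: "edge_sign \<alpha> \<beta> F e = \<eta> * sgn (\<beta> \<bullet> (b - a))"
    if e: "e edge_of F" "oriented_as P ori cyc (e, F, F') (a, b)" for e a b
  proof -
    have ab: "e = closed_segment a b" and ccw: "ccw_direction P (ori (affine hull (F \<union> F'))) e F F' (b - a)"
      using e(2) vis(2) by auto
    have "b - a \<in> dir_space F" using edge_of_imp_subset[OF e(1)] ab by (auto intro: diff_in_dir_space)
    then obtain p q where pq: "p \<in> e" "q \<in> F - e" "sgn (area_form \<alpha> \<beta> (b - a) (q - p)) = \<eta>"
      using ccw_direction_sign[OF sub(1) par sub(2) xy \<zeta>0 edge_of_imp_subset[OF e(1)] _ ccw, of \<alpha> \<beta>] pos
      unfolding \<eta>_def by auto
    then show ?thesis using edge_sign_eq[OF F sep e(1) ab pq(1,2)] by simp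
  qed
  have val': "edge_sign \<alpha> \<beta> F' e = - (\<eta> * sgn (\<beta> \<bullet> (b - a)))"
    if e: "e edge_of F'" "oriented_as P ori cyc (e, F', F) (a, b)" for e a b
  proof -
    have ab: "e = closed_segment a b" and ccw: "ccw_direction P (ori (affine hull (F' \<union> F))) e F' F (b - a)"
      using e(2) xy(1) by (auto split: if_splits)
    have "b - a \<in> dir_space F'" using edge_of_imp_subset[OF e(1)] ab by (auto intro: diff_in_dir_space)
    then obtain p q where pq: "p \<in> e" "q \<in> F' - e" "- sgn (area_form \<alpha> \<beta> (b - a) (q - p)) = \<eta>"
      using ccw_direction_sign[OF sub(2) par[symmetric] sub(1) xy(2,1) _ edge_of_imp_subset[OF e(1)] _ ccw, of \<zeta> \<alpha> \<beta>]
        pos par \<zeta>0 unfolding \<eta>_def by (auto simp: Un_commute)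
    then show ?thesis using edge_sign_eq[OF F' sep' e(1) ab pq(1,2)] by (simp flip: pq(3))
  qed
  let ?j1 = "\<lambda>(e, G, G'). if G = F \<and> G' = F' then edge_sign \<alpha> \<beta> F e else 0"
  let ?j2 = "\<lambda>(e, G, G'). if G = F' \<and> G' = F then - edge_sign \<alpha> \<beta> F' e else 0"
  have "(\<Sum>s\<in>edge_two_faces P. ?j1 s + ?j2 s) = 0"
  proof (rule compensating_sum_eq_0[OF P part])
    fix s t assume st: "s \<in> edge_two_faces P" "t \<in> edge_two_faces P" "compensate P ori cyc s t"
    obtain e G G' g H H' where s: "s = (e, G, G')" and t: "t = (g, H, H')" by (cases s; cases t) auto
    have ne: "e edge_of G" "g edge_of H"
      using st(1,2) by (auto simp: s t edge_two_faces_def)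
    obtain a b a' b' c where o: "oriented_as P ori cyc s (a, b)" "oriented_as P ori cyc t (a', b')"
      "c > 0" "b' - a' = - (c *\<^sub>R (b - a))"
      using st(3) unfolding s t compensate.simps oppositely_oriented_def by blast
    have alt: "G = H' \<and> G' = H \<or> G = H \<and> G' = H'" using st(3) by (auto simp: s t)
    show "(?j1 s + ?j2 s) + (?j1 t + ?j2 t) = 0"
    proof (cases "(G = F \<and> G' = F') \<or> (G = F' \<and> G' = F)")
      case True
      then have GH: "(H = F \<and> H' = F') \<or> (H = F' \<and> H' = F)" using alt by auto
      have "?j1 s + ?j2 s = \<eta> * sgn (\<beta> \<bullet> (b - a))"
        using val[of e a b] val'[of e a b] ne(1) o(1) True FF' unfolding s by auto
      moreover have "?j1 t + ?j2 t = \<eta> * sgn (\<beta> \<bullet> (b' - a'))"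
        using val[of g a' b'] val'[of g a' b'] ne(2) o(2) GH FF' unfolding t by auto
      ultimately show ?thesis using o(3) by (simp add: o(4) sgn_mult)
    next
      case False
      then have "\<not> (G = F \<and> G' = F')" "\<not> (G = F' \<and> G' = F)"
        "\<not> (H = F \<and> H' = F')" "\<not> (H = F' \<and> H' = F)" using alt by auto
      then show ?thesis by (simp only: s t prod.case if_False)
    qed
  qed
  then show ?thesis
    using sum_edge_two_faces[OF P vis(1), of "edge_sign \<alpha> \<beta> F"]
      sum_edge_two_faces[OF P vis', of "\<lambda>e. - edge_sign \<alpha> \<beta> F' e"]
    by (simp add: sum.distrib sum_negf)
qed

subsection \<open>Sweeping the plane of projection\<close>

lemma separates_iff: "\<not> separates a b S \<longleftrightarrow> (\<exists>v\<in>S. v \<noteq> 0 \<and> a \<bullet> v = 0 \<and> b \<bullet> v = 0)"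
  by (auto simp: separates_def)

lemma span_pair: "span {a, b} = {x *\<^sub>R a + y *\<^sub>R b | x y. True}"
proof -
  have "w \<in> span {a, b} \<longleftrightarrow> (\<exists>x y. w = x *\<^sub>R a + y *\<^sub>R b)" for w
    unfolding span_breakdown_eq[of w a] span_singleton
    by (auto simp: image_iff diff_eq_eq) (metis add.commute)+
  then show ?thesis by blast
qed

lemma degenerating_span_iff:
  assumes "F \<in> two_faces P"
  shows "degenerating (span {a, b}) F \<longleftrightarrow> \<not> separates a b (dir_space F)"
proof -
  have "(\<forall>w\<in>span {a, b}. w \<bullet> v = 0) \<longleftrightarrow> a \<bullet> v = 0 \<and> b \<bullet> v = 0" for v
  proof
    assume "\<forall>w\<in>span {a, b}. w \<bullet> v = 0"
    then show "a \<bullet> v = 0 \<and> b \<bullet> v = 0" by (simp add: span_base)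
  next
    assume "a \<bullet> v = 0 \<and> b \<bullet> v = 0"
    then show "\<forall>w\<in>span {a, b}. w \<bullet> v = 0" unfolding span_pair by (auto simp: inner_add_left)
  qed
  then show ?thesis unfolding degenerating_iff[OF subspace_span assms] separates_iff by simp
qed

lemma separates_kernel_parallel:
  assumes "separates a b S" "subspace S" "v \<in> S" "v' \<in> S" "b \<bullet> v = 0" "b \<bullet> v' = 0" "v \<noteq> 0"
  obtains k where "v' = k *\<^sub>R v"
  using area_form_eq_0_imp_parallel[OF assms(1-4) _ assms(7)] assms(5,6) by (auto simp: area_form_def)

text \<open>The direction plane of \<open>F\<close> contains a nonzero vector killed by
  \<open>b\<close>. The functional, constant on \<open>F\<close>, kills it too, and because
  \<open>x \<noteq> 0\<close> so does \<open>a\<close>.\<close>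

lemma degenerate_if_subset_max_face:
  fixes P :: "'a::euclidean_space set"
  assumes "F \<in> two_faces P" "F \<subseteq> max_face P (x *\<^sub>R a + y *\<^sub>R b)" "x \<noteq> 0"
  shows "\<not> separates a b (dir_space F)"
proof -
  obtain v where v: "v \<in> dir_space F" "v \<noteq> 0" "b \<bullet> v = 0"
    using plane_kernel[OF subspace_dir_space, of F b] two_faces_dim(4)[OF assms(1)] by auto
  have "(x *\<^sub>R a + y *\<^sub>R b) \<bullet> v = 0"
    using inner_dir_max_face dir_space_mono[OF assms(2)] v(1) by blast
  then have "a \<bullet> v = 0" using v(3) assms(3) by (simp add: inner_add_left)
  then show ?thesis using v separates_iff by blast
qed

text \<open>A larger maximal face contains a 3-face, and two nonparallel facets of that 3-face would
  both degenerate, against \<open>par\<close>.\<close>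

lemma max_face_aff_dim_le_2:
  fixes P :: "'a::euclidean_space set"
  assumes P: "polytope P" and "x \<noteq> 0"
    and par: "\<And>F G. F \<in> two_faces P \<Longrightarrow> G \<in> two_faces P \<Longrightarrow> \<not> separates a b (dir_space F) \<Longrightarrow>
      \<not> separates a b (dir_space G) \<Longrightarrow> dir_space F = dir_space G"
  shows "aff_dim (max_face P (x *\<^sub>R a + y *\<^sub>R b)) \<le> 2"
proof (rule ccontr)
  let ?G = "max_face P (x *\<^sub>R a + y *\<^sub>R b)"
  have G: "?G face_of P" by (rule max_face_of[OF polytope_imp_convex[OF P]])
  assume "\<not> ?thesis"
  then obtain H where H: "H face_of ?G" "aff_dim H = 3"
    using exists_face_aff_dim[OF face_of_polytope_polytope[OF P G], of 3] by auto
  then have HP: "H face_of P" using G face_of_trans by blast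
  obtain F F' where F: "F facet_of H" "F' facet_of H" "dir_space F \<noteq> dir_space F'"
    using exists_nonparallel_facets[OF face_of_polytope_polytope[OF P HP]] H(2) by auto
  have *: "F \<in> two_faces P" "\<not> separates a b (dir_space F)" if "F facet_of H" for F
  proof -
    have "F face_of H" "aff_dim F = 2" using that H(2) by (auto simp: facet_of_def)
    then show "F \<in> two_faces P" using face_of_trans[OF _ HP] by (simp add: two_faces_def)
    moreover have "F \<subseteq> ?G"
      using face_of_imp_subset[OF \<open>F face_of H\<close>] face_of_imp_subset[OF H(1)] by (rule subset_trans)
    ultimately show "\<not> separates a b (dir_space F)"
      using degenerate_if_subset_max_face[OF _ _ \<open>x \<noteq> 0\<close>] by blast
  qed
  show False using par[OF *(1)[OF F(1)] *(1)[OF F(2)] *(2)[OF F(1)] *(2)[OF F(2)]] F(3) by blast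
qed

text \<open>Determined only up to sign; \<open>edge_normal\<close> and \<open>edges_generic\<close>
  are unchanged when it is negated.\<close>

definition edge_vec :: "'a::euclidean_space set \<Rightarrow> 'a" where
  "edge_vec e = (SOME u. \<exists>p q. e = closed_segment p q \<and> u = q - p)"

lemma edge_vec:
  fixes P :: "'a::euclidean_space set"
  assumes "polytope P" "e edge_of P"
  obtains p q where "e = closed_segment p q" "edge_vec e = q - p"
proof -
  have "\<exists>p q. e = closed_segment p q \<and> edge_vec e = q - p"
    unfolding edge_vec_def using edge_of_polytope_segment[OF assms]
    by (intro someI_ex[where P = "\<lambda>u. \<exists>p q. e = closed_segment p q \<and> u = q - p"]) metis
  then show ?thesis using that by blast
qed

lemma edge_vec_span:
  fixes P :: "'a::euclidean_space set"
  assumes "polytope P" "e edge_of P" "v \<in> dir_space e" "w \<bullet> edge_vec e = 0"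
  shows "w \<bullet> v = 0"
proof -
  obtain p q where pq: "e = closed_segment p q" "edge_vec e = q - p" using edge_vec[OF assms(1,2)] .
  have p: "w \<bullet> x = w \<bullet> p" if x: "x \<in> e" for x
  proof -
    obtain s where "x = (1 - s) *\<^sub>R p + s *\<^sub>R q" using x by (auto simp: pq(1) closed_segment_def)
    then have "x = p + s *\<^sub>R (q - p)" by (simp add: algebra_simps)
    then show ?thesis using assms(4) by (simp add: pq(2) inner_add_right)
  qed
  show ?thesis by (rule inner_dir_space_eq_0[OF assms(3)]) (simp add: p)
qed

text \<open>The combination of \<open>a\<close> and \<open>b\<close>, with coefficient 1 at \<open>a\<close>, that is constant on the edge.\<close>

definition edge_normal :: "'a::euclidean_space \<Rightarrow> 'a \<Rightarrow> 'a set \<Rightarrow> 'a" where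
  "edge_normal a b e = a - ((a \<bullet> edge_vec e) / (b \<bullet> edge_vec e)) *\<^sub>R b"

definition edges_generic :: "'a::euclidean_space set \<Rightarrow> 'a \<Rightarrow> bool" where
  "edges_generic P b \<longleftrightarrow> (\<forall>e. e edge_of P \<longrightarrow> b \<bullet> edge_vec e \<noteq> 0)"

lemma edge_normal_unique:
  assumes "edges_generic P b" "e edge_of P" "(a + y *\<^sub>R b) \<bullet> edge_vec e = 0"
  shows "a + y *\<^sub>R b = edge_normal a b e"
proof -
  have "b \<bullet> edge_vec e \<noteq> 0" using assms by (simp add: edges_generic_def)
  then have "y = - (a \<bullet> edge_vec e / (b \<bullet> edge_vec e))"
    using assms(3) by (simp add: inner_add_left field_simps)
  then show ?thesis by (simp add: edge_normal_def)
qed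

lemma edge_normal_edge_vec:
  assumes "edges_generic P b" "e edge_of P"
  shows "edge_normal a b e \<bullet> edge_vec e = 0"
  using assms by (simp add: edges_generic_def edge_normal_def inner_diff_left)

lemma scaled_edge_normal: "\<sigma> *\<^sub>R edge_normal a b e = \<sigma> *\<^sub>R a + (- \<sigma> * (a \<bullet> edge_vec e / (b \<bullet> edge_vec e))) *\<^sub>R b"
  by (simp add: edge_normal_def algebra_simps)

lemma edge_vec_in_dir_space:
  assumes "polytope P" "e edge_of P" "e \<subseteq> F"
  shows "edge_vec e \<in> dir_space F"
  using edge_vec[OF assms(1,2)] assms(3) by (metis diff_in_dir_space ends_in_segment subset_iff)

lemma max_face_supset_edge_cases:
  fixes P :: "'a::euclidean_space set"
  assumes P: "polytope P" and e: "e edge_of P" "e \<subseteq> G" and G: "G face_of P" "G \<noteq> e" "aff_dim G \<le> 2"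
  shows "G \<in> two_faces P"
proof -
  have ef: "e face_of P" "aff_dim e = 1" using e by (auto simp: edge_of_def)
  have "aff_dim G \<noteq> 1" using face_eqI_aff_dim[OF ef(1) G(1) e(2)] ef(2) G(2) by auto
  moreover have "aff_dim G \<ge> 1" using aff_dim_subset[OF e(2)] ef(2) by simp
  ultimately show ?thesis using G by (simp add: two_faces_def)
qed

text \<open>A functional of the plane that is constant on \<open>e\<close> is a multiple of
  \<open>edge_normal a b e\<close>, and only the sign of the factor matters: these are the two
  values of \<sigma>. Inclusion in place of equality gives the same count when nothing degenerates,
  and is a closed condition that can be followed through degenerate parameters.\<close>

lemma card_silhouette:
  fixes P :: "'a::euclidean_space set"
  assumes P: "polytope P" "aff_dim P = DIM('a)" "DIM('a) \<ge> 3" and gen: "edges_generic P b"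
    and sep: "\<And>F. F \<in> two_faces P \<Longrightarrow> separates a b (dir_space F)"
    and ind: "dim (span {a, b}) = 2"
  shows "real (card (silhouette P (span {a, b}))) =
    (\<Sum>e | e edge_of P. \<Sum>\<sigma>\<in>{1, -1}. of_bool (e \<subseteq> max_face P (\<sigma> *\<^sub>R edge_normal a b e)))"
proof -
  let ?n = "edge_normal a b"
  let ?E = "\<lambda>\<sigma>. {e. e edge_of P \<and> e \<subseteq> max_face P (\<sigma> *\<^sub>R ?n e)}"
  have cP: "convex P" using P(1) polytope_imp_convex by blast
  have eq: "max_face P (\<sigma> *\<^sub>R ?n e) = e" if e: "e edge_of P" "e \<subseteq> max_face P (\<sigma> *\<^sub>R ?n e)" "\<sigma> \<noteq> 0" for \<sigma> e
  proof (rule ccontr)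
    assume ne: "max_face P (\<sigma> *\<^sub>R ?n e) \<noteq> e"
    have "aff_dim (max_face P (\<sigma> *\<^sub>R ?n e)) \<le> 2"
      unfolding scaled_edge_normal using sep by (intro max_face_aff_dim_le_2[OF P(1) e(3)]) auto
    then have "max_face P (\<sigma> *\<^sub>R ?n e) \<in> two_faces P"
      using max_face_supset_edge_cases[OF P(1) e(1,2) max_face_of[OF cP] ne] by blast
    then show False
      using degenerate_if_subset_max_face[of "max_face P (\<sigma> *\<^sub>R ?n e)" P \<sigma> a _ b] sep e(3)
      unfolding scaled_edge_normal by blast
  qed
  have b0: "a \<noteq> y *\<^sub>R b" for y
  proof
    assume "a = y *\<^sub>R b"
    then have "span {a, b} = span {b}" by (simp add: span_redundant span_base span_scale)
    then show False using ind dim_le_card[of "span {b}" "{b}"] by simp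
  qed
  have n0: "?n e \<noteq> 0" for e unfolding edge_normal_def using b0 by simp
  have sil: "silhouette P (span {a, b}) = ?E 1 \<union> ?E (-1)"
  proof (intro equalityI subsetI)
    fix e assume "e \<in> silhouette P (span {a, b})"
    then obtain w where e: "e edge_of P" "w \<in> span {a, b}" "max_face P w = e"
      by (auto simp: silhouette_def)
    obtain x y where w: "w = x *\<^sub>R a + y *\<^sub>R b" using e(2) unfolding span_pair by blast
    have "edge_vec e \<in> dir_space (max_face P w)" using edge_vec_in_dir_space[OF P(1) e(1)] e(3) by blast
    then have wu: "w \<bullet> edge_vec e = 0" by (rule inner_dir_max_face)
    have "w \<noteq> 0"
    proof
      assume "w = 0"
      then have "e = P" using e(3) by (auto simp: max_face_def)
      then show False using e(1) P by (simp add: edge_of_def)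
    qed
    have "x \<noteq> 0"
    proof
      assume "x = 0"
      then have "y = 0" using wu w gen e(1) by (simp add: edges_generic_def)
      then show False using w \<open>x = 0\<close> \<open>w \<noteq> 0\<close> by simp
    qed
    have "a + (y / x) *\<^sub>R b = ?n e"
      using wu \<open>x \<noteq> 0\<close> by (intro edge_normal_unique[OF gen e(1)]) (simp add: w inner_add_left field_simps)
    then have wn: "w = x *\<^sub>R ?n e" using \<open>x \<noteq> 0\<close> by (simp add: w flip: \<open>a + (y / x) *\<^sub>R b = ?n e\<close>) (simp add: scaleR_add_right)
    show "e \<in> ?E 1 \<union> ?E (-1)"
    proof (cases "x > 0")
      case True
      then have "max_face P (1 *\<^sub>R ?n e) = e" using max_face_scale[OF True, of P "?n e"] e(3) wn by simp
      then show ?thesis using e(1) by auto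
    next
      case False
      then have "- x > 0" using \<open>x \<noteq> 0\<close> by simp
      then have "max_face P ((-1) *\<^sub>R ?n e) = e" using max_face_scale[of "- x" P "- ?n e"] e(3) wn by simp
      then show ?thesis using e(1) by auto
    qed
  next
    fix e assume "e \<in> ?E 1 \<union> ?E (-1)"
    then obtain \<sigma> :: real where \<sigma>: "\<sigma> \<noteq> 0" "e edge_of P" "e \<subseteq> max_face P (\<sigma> *\<^sub>R ?n e)"
      by (metis (mono_tags, lifting) Un_iff mem_Collect_eq neg_equal_0_iff_equal zero_neq_one)
    have "\<sigma> *\<^sub>R ?n e \<in> span {a, b}" unfolding scaled_edge_normal span_pair by blast
    then show "e \<in> silhouette P (span {a, b})" using eq[OF \<sigma>(2,3,1)] \<sigma>(2) by (auto simp: silhouette_def)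
  qed
  \<comment> \<open>An edge counted for both signs would have a normal that is constant on the
    full-dimensional \<open>P\<close>, hence zero.\<close>
  have disj: "?E 1 \<inter> ?E (-1) = {}"
  proof (rule ccontr)
    assume "?E 1 \<inter> ?E (-1) \<noteq> {}"
    then obtain e where e: "e edge_of P" "e \<subseteq> max_face P (?n e)" "e \<subseteq> max_face P (- ?n e)" by auto
    have "e \<noteq> {}" using e(1) by (auto simp: edge_of_def)
    then obtain p where "p \<in> e" by blast
    then have p: "\<forall>y\<in>P. ?n e \<bullet> y \<le> ?n e \<bullet> p" "\<forall>y\<in>P. ?n e \<bullet> p \<le> ?n e \<bullet> y"
      using e(2,3) by (auto simp: max_face_def)
    then have "max_face P (?n e) = P" unfolding max_face_def by (auto intro: order_trans)
    then show False using max_face_eq_whole[OF P(2)] n0 by blast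
  qed
  have fin: "finite (?E \<sigma>)" for \<sigma> using finite_edges[OF P(1)] by (rule rev_finite_subset) auto
  have cardE: "real (card (?E \<sigma>)) = (\<Sum>e | e edge_of P. of_bool (e \<subseteq> max_face P (\<sigma> *\<^sub>R ?n e)))" for \<sigma>
    using finite_edges[OF P(1)] by (simp add: Int_def of_bool_def sum.If_cases)
  have two: "(\<Sum>\<sigma>\<in>{1, -1}. g \<sigma>) = g 1 + g (- 1)" for g :: "real \<Rightarrow> real" by simp
  have "card (silhouette P (span {a, b})) = card (?E 1) + card (?E (-1))"
    unfolding sil by (rule card_Un_disjoint[OF fin fin disj])
  then show ?thesis by (simp only: of_nat_add cardE two sum.distrib)
qed

section \<open>Visibility of an edge as a function of the sweep parameter\<close>

lemma edge_normal_affine: "edge_normal (a + t *\<^sub>R a') b e = edge_normal a b e + t *\<^sub>R edge_normal a' b e"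
  by (simp add: edge_normal_def inner_add_left add_divide_distrib algebra_simps)

text \<open>Reduces visibility to finitely many linear inequalities in the functional, one per
  vertex, so that it becomes a system of affine inequalities in the sweep parameter.\<close>

lemma edge_subset_max_face_iff:
  fixes P :: "'a::euclidean_space set"
  assumes P: "polytope P" and e: "e edge_of P" and w: "w \<bullet> edge_vec e = 0" and p: "p \<in> e"
  shows "e \<subseteq> max_face P w \<longleftrightarrow> (\<forall>y. y extreme_point_of P \<longrightarrow> w \<bullet> (y - p) \<le> 0)"
proof
  assume "e \<subseteq> max_face P w"
  then show "\<forall>y. y extreme_point_of P \<longrightarrow> w \<bullet> (y - p) \<le> 0"
    using p by (auto simp: max_face_def extreme_point_of_def inner_diff_right)
next
  assume *: "\<forall>y. y extreme_point_of P \<longrightarrow> w \<bullet> (y - p) \<le> 0"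
  have eP: "e \<subseteq> P" using e by (rule edge_of_imp_subset)
  have pm: "p \<in> max_face P w"
    using * eP p by (intro max_face_memI_extreme[OF P]) (auto simp: inner_diff_right)
  show "e \<subseteq> max_face P w"
  proof
    fix x assume "x \<in> e"
    then have "w \<bullet> (x - p) = 0" using edge_vec_span[OF P e _ w] p by (auto intro: diff_in_dir_space)
    then show "x \<in> max_face P w"
      unfolding max_face_eq_Int[OF pm] using \<open>x \<in> e\<close> eP by (auto simp: inner_diff_right)
  qed
qed

text \<open>In \<open>S\<close>, \<open>b\<close> kills at most a line. On that line
  \<open>a\<close> is nonzero while \<open>a + t *\<^sub>R a'\<close> vanishes, so \<open>a'\<close>
  cannot vanish.\<close>

lemma separates_direction:
  assumes "separates a b S" "\<not> separates (a + t *\<^sub>R a') b S" "subspace S"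
  shows "separates a' b S"
proof -
  obtain v where v: "v \<in> S" "v \<noteq> 0" "(a + t *\<^sub>R a') \<bullet> v = 0" "b \<bullet> v = 0"
    using assms(2) unfolding separates_iff by blast
  have "a \<bullet> v \<noteq> 0" using assms(1) v by (auto simp: separates_def)
  then have nz: "a' \<bullet> v \<noteq> 0" using v(3) by (auto simp: inner_add_left)
  show ?thesis
    unfolding separates_def
  proof safe
    fix v' assume v': "v' \<in> S" "a' \<bullet> v' = 0" "b \<bullet> v' = 0"
    obtain k where "v' = k *\<^sub>R v"
      using separates_kernel_parallel[OF assms(1,3) v(1) v'(1) v(4) v'(3) v(2)] .
    then show "v' = 0" using v'(2) nz by simp
  qed
qed

lemma eventually_affine_pos:
  fixes c k s :: real
  assumes "c > 0"
  shows "\<forall>\<^sub>F t in at s. c + (t - s) * k > 0"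
proof -
  have "((\<lambda>t. c + (t - s) * k) \<longlongrightarrow> c + (s - s) * k) (at s)" by (intro tendsto_intros)
  then show ?thesis using assms by (intro order_tendstoD(1)[where y = c]) auto
qed

text \<open>Writing out \<open>edge_normal\<close> gives minus the area form of edge direction and
  \<open>y - p\<close>, divided by \<open>b\<close> at the edge direction. This translates the
  orientation of the face into the motion of its points relative to \<open>e\<close>.\<close>

lemma edge_sign_inner:
  fixes G :: "'a::euclidean_space set"
  assumes G: "polytope G" "aff_dim G = 2" and sep: "separates a' b (dir_space G)"
    and e: "e edge_of G" and b: "b \<bullet> edge_vec e \<noteq> 0" and p: "p \<in> e" and y: "y \<in> G - e"
  shows "sgn (edge_normal a' b e \<bullet> (y - p)) = - edge_sign a' b G e" "\<bar>edge_sign a' b G e\<bar> = 1"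
proof -
  obtain q r where qr: "e = closed_segment q r" "edge_vec e = r - q" using edge_vec[OF G(1) e] .
  let ?\<omega> = "area_form a' b (r - q) (y - p)"
  have s: "edge_sign a' b G e = sgn ?\<omega> * sgn (b \<bullet> (r - q))" using edge_sign_eq[OF G sep e qr(1) p y] .
  have "?\<omega> \<noteq> 0" using area_form_edge(1)[OF G sep, of q r p p y y] e p y qr(1) by simp
  then show "\<bar>edge_sign a' b G e\<bar> = 1" using b qr(2) by (simp add: s abs_mult abs_sgn_eq)
  have "edge_normal a' b e \<bullet> (y - p) = (- ?\<omega>) / (b \<bullet> (r - q))"
    using b unfolding edge_normal_def qr(2) inner_diff_left inner_scaleR_left
    by (simp add: area_form_def diff_divide_distrib)
  then show "sgn (edge_normal a' b e \<bullet> (y - p)) = - edge_sign a' b G e"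
    by (simp add: s sgn_divide divide_sgn sgn_mult)
qed

text \<open>A vertex strictly above \<open>e\<close> stays above near \<open>s\<close>. Otherwise
  vertices outside \<open>G\<close> stay below, points of \<open>e\<close> stay level, and points of
  \<open>G - e\<close> all rise or all sink. The \<open>sgn\<close> expression is the indicator of
  one side of \<open>s\<close>, centred at 1/2 so that the remaining term is odd in
  \<open>t - s\<close>.\<close>

lemma edge_visible_near:
  fixes P :: "'a::euclidean_space set"
  assumes P: "polytope P" and gen: "edges_generic P b"
    and sep: "\<And>F. F \<in> two_faces P \<Longrightarrow> separates a b (dir_space F)"
    and par: "\<And>F G. F \<in> two_faces P \<Longrightarrow> G \<in> two_faces P \<Longrightarrow> \<not> separates (a + s *\<^sub>R a') b (dir_space F) \<Longrightarrow>
      \<not> separates (a + s *\<^sub>R a') b (dir_space G) \<Longrightarrow> dir_space F = dir_space G"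
    and e: "e edge_of P" and \<sigma>: "\<bar>\<sigma>\<bar> = 1"
    and G: "G = max_face P (\<sigma> *\<^sub>R edge_normal (a + s *\<^sub>R a') b e)"
  shows "\<forall>\<^sub>F t in at s. of_bool (e \<subseteq> max_face P (\<sigma> *\<^sub>R edge_normal (a + t *\<^sub>R a') b e)) =
    (if G \<in> two_faces P \<and> e \<subseteq> G then 1 / 2 + \<sigma> * edge_sign a' b G e / 2 * sgn (t - s) else of_bool (e \<subseteq> G))"
proof -
  define n where "n t = \<sigma> *\<^sub>R edge_normal (a + t *\<^sub>R a') b e" for t
  define n' where "n' = \<sigma> *\<^sub>R edge_normal a' b e"
  have cP: "convex P" using P polytope_imp_convex by blast
  have G': "G = max_face P (n s)" by (simp add: G n_def)
  have aff: "n t \<bullet> d = n s \<bullet> d + (t - s) * (n' \<bullet> d)" for t d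
    by (simp add: n_def n'_def edge_normal_affine inner_add_left algebra_simps)
  have nu: "n t \<bullet> edge_vec e = 0" for t by (simp add: n_def edge_normal_edge_vec[OF gen e])
  have "e \<noteq> {}" using e by (auto simp: edge_of_def)
  then obtain p where p: "p \<in> e" by blast
  have pP: "p \<in> P" using p edge_of_imp_subset[OF e] by blast
  note vis = edge_subset_max_face_iff[OF P e nu p]
  have on_e: "n t \<bullet> (y - p) = 0" if "y \<in> e" for t y
    using edge_vec_span[OF P e diff_in_dir_space[OF that p] nu] .
  have "\<forall>\<^sub>F t in at s. of_bool (e \<subseteq> max_face P (n t)) =
    (if G \<in> two_faces P \<and> e \<subseteq> G then 1 / 2 + \<sigma> * edge_sign a' b G e / 2 * sgn (t - s) else of_bool (e \<subseteq> G))"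
  proof (cases "e \<subseteq> G")
    case False
    then obtain y where y: "y extreme_point_of P" "n s \<bullet> (y - p) > 0"
      unfolding G' vis by (auto simp: not_le)
    show ?thesis
      using eventually_affine_pos[OF y(2), of s "n' \<bullet> (y - p)"]
    proof eventually_elim
      case (elim t)
      then have "n t \<bullet> (y - p) > 0" by (simp only: aff[of t])
      then have "\<not> e \<subseteq> max_face P (n t)" unfolding vis using y(1) by (meson not_le)
      then show ?case using False by simp
    qed
  next
    case True
    let ?V = "{y. y extreme_point_of P \<and> y \<notin> G}"
    have pG: "p \<in> G" using True p by blast
    have "\<forall>\<^sub>F t in at s. \<forall>y\<in>?V. - (n s \<bullet> (y - p)) + (t - s) * - (n' \<bullet> (y - p)) > 0"
    proof (intro eventually_ball_finite ballI eventually_affine_pos)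
      show "finite ?V" using finite_extreme_points[OF P] by (rule rev_finite_subset) auto
      fix y assume "y \<in> ?V"
      then show "- (n s \<bullet> (y - p)) > 0"
        using inner_max_face_less[of p P "n s" y] pG G' by (auto simp: inner_diff_right extreme_point_of_def)
    qed
    moreover have "\<forall>\<^sub>F t in at s. t \<noteq> s" by (simp add: eventually_at_filter)
    ultimately show ?thesis
    proof eventually_elim
      case (elim t)
      have far: "n t \<bullet> (y - p) \<le> 0" if "y extreme_point_of P" "y \<notin> G" for y
        using elim(1) that by (fastforce simp: aff[of t])
      show ?case
      proof (cases "G = e")
        case Ge: True
        then have "e \<subseteq> max_face P (n t)" unfolding vis using far on_e by (metis order_refl)
        moreover have "G \<notin> two_faces P" using Ge e by (simp add: two_faces_def edge_of_def)
        ultimately show ?thesis using True by simp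
      next
        case False
        have "aff_dim G \<le> 2"
          unfolding G scaled_edge_normal using \<sigma> par by (intro max_face_aff_dim_le_2[OF P]) auto
        moreover have Gf: "G face_of P" unfolding G by (rule max_face_of[OF cP])
        ultimately have G2: "G \<in> two_faces P"
          using max_face_supset_edge_cases[OF P e True _ False] by blast
        note Gp = two_face_polytope[OF P G2] two_faces_dim(2)[OF G2]
        have "\<not> separates (a + s *\<^sub>R a') b (dir_space G)"
          using degenerate_if_subset_max_face[OF G2 eq_refl[OF G[unfolded scaled_edge_normal]]] \<sigma> by auto
        then have sepG: "separates a' b (dir_space G)"
          using separates_direction[OF sep[OF G2] _ subspace_dir_space] by blast
        have eG: "e edge_of G" using face_of_face[OF Gf, of e] e True by (simp add: edge_of_def)
        have bu: "b \<bullet> edge_vec e \<noteq> 0" using gen e by (simp add: edges_generic_def)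
        \<comment> \<open>\<open>n s\<close> is constant on \<open>G\<close>, so only the motion
          term is left and its sign depends on the side of \<open>s\<close>.\<close>
        have onG: "n t \<bullet> (y - p) = (t - s) * (n' \<bullet> (y - p))" if "y \<in> G" for y
          using inner_max_face_eq[of y P "n s" p] that pG G' by (simp add: aff[of t] inner_diff_right right_diff_distrib)
        let ?\<kappa> = "\<sigma> * edge_sign a' b G e"
        have sgn: "sgn (n t \<bullet> (y - p)) = - (sgn (t - s) * ?\<kappa>)" "\<bar>?\<kappa>\<bar> = 1" if y: "y \<in> G - e" for y
          using edge_sign_inner[OF Gp sepG eG bu p y] onG[of y] y \<sigma>
          by (auto simp: sgn_mult n'_def abs_mult abs_if split: if_splits)
        have "G \<noteq> e" using False .
        then obtain y0 where y0: "y0 \<in> G - e" using True by blast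
        have "\<bar>sgn (t - s)\<bar> = 1" using elim(2) by (simp add: abs_sgn_eq)
        then consider "sgn (t - s) * ?\<kappa> = 1" | "sgn (t - s) * ?\<kappa> = -1"
          using sgn(2)[OF y0] by (metis abs_mult abs_1 abs_eq_iff mult_1)
        then show ?thesis
        proof cases
          case 1
          have "n t \<bullet> (y - p) \<le> 0" if y: "y extreme_point_of P" for y
          proof -
            consider "y \<notin> G" | "y \<in> e" | "y \<in> G - e" using True by blast
            then show ?thesis
            proof cases
              case 3
              then have "sgn (n t \<bullet> (y - p)) = -1" using sgn(1) 1 by simp
              then show ?thesis by (simp add: sgn_if split: if_splits)
            qed (use far y on_e in auto)
          qed
          then have "e \<subseteq> max_face P (n t)" unfolding vis by blast
          then show ?thesis using 1 G2 True by (simp add: mult.commute)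
        next
          case 2
          then have "sgn (n t \<bullet> (y0 - p)) = 1" using sgn(1)[OF y0] by simp
          then have "n t \<bullet> p < n t \<bullet> y0" by (simp add: sgn_if inner_diff_right split: if_splits)
          moreover have "y0 \<in> P" using y0 face_of_imp_subset[OF Gf] by blast
          ultimately have "p \<notin> max_face P (n t)" by (auto simp: max_face_def not_le)
          then have "\<not> e \<subseteq> max_face P (n t)" using p by blast
          then show ?thesis using 2 G2 True by (simp add: mult.commute)
        qed
      qed
    qed
  qed
  then show ?thesis by (simp add: n_def)
qed

section \<open>Simultaneous visibility and the balance of opposite faces\<close>

lemma projects_to_boundary_max_face:
  fixes P :: "'a::euclidean_space set"
  assumes P: "convex P" and W: "subspace W" "w \<in> W" and ne: "max_face P w \<noteq> P"
  shows "projects_to_boundary P W (max_face P w)"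
proof -
  let ?Q = "orth_proj W ` P"
  have "convex ?Q" by (rule convex_linear_image[OF linear_orth_proj[OF W(1)] P])
  then have "max_face ?Q w face_of ?Q" by (rule max_face_of)
  moreover have "max_face ?Q w \<noteq> ?Q"
  proof
    assume "max_face ?Q w = ?Q"
    then have "w \<bullet> orth_proj W y \<le> w \<bullet> orth_proj W x" if "x \<in> P" "y \<in> P" for x y
      using that by (force simp: max_face_def)
    then have "max_face P w = P" by (auto simp: max_face_def inner_orth_proj[OF W])
    then show False using ne by simp
  qed
  ultimately show ?thesis
    unfolding projects_to_boundary_def max_face_orth_proj[OF W, symmetric]
    by (rule face_of_subset_rel_frontier)
qed

text \<open>A relative interior point of the image of \<open>G\<close> lies in a proper face of the
  projection, and that face then contains the whole image.\<close>

lemma projects_to_boundaryE: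
  fixes P :: "'a::euclidean_space set"
  assumes P: "polytope P" and W: "subspace W" and G: "G \<subseteq> P" "convex G" "G \<noteq> {}"
    and bd: "projects_to_boundary P W G"
  obtains w where "w \<in> W" "w \<noteq> 0" "G \<subseteq> max_face P w"
proof -
  let ?\<pi> = "orth_proj W"
  let ?Q = "?\<pi> ` P"
  have Q: "polytope ?Q" by (rule polytope_linear_image[OF linear_orth_proj[OF W] P])
  have "convex (?\<pi> ` G)" by (rule convex_linear_image[OF linear_orth_proj[OF W] G(2)])
  then obtain x where x: "x \<in> rel_interior (?\<pi> ` G)" using rel_interior_eq_empty[of "?\<pi> ` G"] G(3) by blast
  then have "x \<in> rel_frontier ?Q"
    using bd rel_interior_subset unfolding projects_to_boundary_def by blast
  then obtain T where T: "T face_of ?Q" "T \<noteq> ?Q" "x \<in> T"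
    unfolding rel_frontier_of_polyhedron_alt[OF polytope_imp_polyhedron[OF Q]] by blast
  have GT: "?\<pi> ` G \<subseteq> T" using subset_of_face_of[OF T(1)] G(1) x T(3) by blast
  obtain z where z: "T = max_face ?Q z" using face_eq_max_face[OF Q T(1)] T(3) by blast
  define w where "w = ?\<pi> z"
  have w: "w \<in> W" using orth_proj_decomp(1)[OF W] by (simp add: w_def)
  have "z \<bullet> y = w \<bullet> y" if "y \<in> ?Q" for y
    using inner_orth_proj[OF W subsetD[OF orth_proj_image_subset[OF W] that], of z]
    by (simp add: w_def inner_commute)
  then have Tw: "T = max_face ?Q w" unfolding z by (rule max_face_cong)
  then have "w \<noteq> 0" using T(2) by (auto simp: max_face_def)
  moreover have "G \<subseteq> max_face P w"
  proof
    fix x assume "x \<in> G"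
    then have "?\<pi> x \<in> max_face ?Q w" using GT Tw by blast
    then show "x \<in> max_face P w" using \<open>x \<in> G\<close> G(1) by (auto simp: max_face_def inner_orth_proj[OF W w])
  qed
  ultimately show ?thesis using that w by blast
qed

text \<open>The value 0 off the 2-faces lets one equation between opposite maximal faces cover the
  cases of two, one or no 2-face.\<close>

definition signed_edge_sum :: "'a::euclidean_space set \<Rightarrow> 'a \<Rightarrow> 'a \<Rightarrow> 'a set \<Rightarrow> real" where
  "signed_edge_sum P \<alpha> \<beta> F = (if F \<in> two_faces P then \<Sum>e | e edge_of F. edge_sign \<alpha> \<beta> F e else 0)"

text \<open>The face is visible without a partner: a parallel face on the boundary lies in the
  maximal face of some functional of the plane, which must be a multiple of \<open>w\<close>. A
  positive factor gives the same face, a negative one would make \<open>max_face P (- w)\<close> a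
  2-face.\<close>

lemma signed_edge_sum_lonely:
  fixes P :: "'a::euclidean_space set"
  assumes P: "polytope P" "aff_dim P = DIM('a)" "DIM('a) \<ge> 3"
    and ori: "orientation_choice P ori cyc" and part: "partitioned_into_compensating_pairs P ori cyc"
    and ind: "dim (span {a, b}) = 2"
    and par: "\<And>F G. F \<in> two_faces P \<Longrightarrow> G \<in> two_faces P \<Longrightarrow> \<not> separates a b (dir_space F) \<Longrightarrow>
      \<not> separates a b (dir_space G) \<Longrightarrow> dir_space F = dir_space G"
    and w: "w = x *\<^sub>R a + y *\<^sub>R b" "x \<noteq> 0"
    and z: "z \<in> dir_space (max_face P w)" "b \<bullet> z \<noteq> 0"
    and F: "max_face P w \<in> two_faces P" and F': "max_face P (- w) \<notin> two_faces P"
    and sep: "separates \<alpha> \<beta> (dir_space (max_face P w))"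
  shows "(\<Sum>e | e edge_of max_face P w. edge_sign \<alpha> \<beta> (max_face P w) e) = 0"
proof -
  let ?F = "max_face P w" and ?W = "span {a, b}"
  have cP: "convex P" using P(1) polytope_imp_convex by blast
  have wW: "w \<in> ?W" unfolding w span_pair by blast
  have FP: "?F \<noteq> P" using F P by (auto simp: two_faces_def)
  have degF: "\<not> separates a b (dir_space ?F)"
    using degenerate_if_subset_max_face[OF F _ w(2)] w(1) by blast
  have only: "only_degenerating_class P ?W ?F"
  proof (rule only_degenerating_classI[OF subspace_span F])
    show "degenerating ?W ?F" using degF degenerating_span_iff[OF F] by blast
    show "dir_space G = dir_space ?F" if "G \<in> two_faces P" "degenerating ?W G" for G
      using par[OF that(1) F] degF degenerating_span_iff[OF that(1), of a b] that(2) by blast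
  qed
  have alone: "\<not> projects_to_boundary P ?W G" if G: "(?F, G) \<in> parallel_rel P" "G \<noteq> ?F" for G
  proof
    assume bd: "projects_to_boundary P ?W G"
    have G2: "G \<in> two_faces P" and dirG: "dir_space ?F = dir_space G" using G(1) by (auto simp: parallel_rel_def)
    have Gf: "G face_of P" "G \<noteq> {}" using two_faces_dim[OF G2] by auto
    obtain v where v: "v \<in> ?W" "v \<noteq> 0" "G \<subseteq> max_face P v"
      using projects_to_boundaryE[OF P(1) subspace_span face_of_imp_subset[OF Gf(1)]
          face_of_imp_convex[OF Gf(1)] Gf(2) bd] .
    obtain k l where kl: "v = k *\<^sub>R a + l *\<^sub>R b" using v(1) unfolding span_pair by blast
    have "v \<bullet> z = 0" using inner_dir_max_face dir_space_mono[OF v(3)] z(1) dirG by blast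
    moreover have "w \<bullet> z = 0" by (rule inner_dir_max_face[OF z(1)])
    \<comment> \<open>Eliminating \<open>a\<close> leaves a multiple of \<open>b\<close>. At
      \<open>z\<close>, which \<open>v\<close> and \<open>w\<close> kill and \<open>b\<close> does
      not, its coefficient is seen to vanish.\<close>
    moreover have "x *\<^sub>R v = k *\<^sub>R w + (x * l - k * y) *\<^sub>R b" by (simp add: kl w(1) algebra_simps)
    then have "x * (v \<bullet> z) = k * (w \<bullet> z) + (x * l - k * y) * (b \<bullet> z)"
      by (metis inner_add_left inner_scaleR_left)
    ultimately have "x * l - k * y = 0" using z(2) by simp
    then have "x *\<^sub>R v = k *\<^sub>R w" using \<open>x *\<^sub>R v = k *\<^sub>R w + (x * l - k * y) *\<^sub>R b\<close> by simp
    then have vw: "v = (k / x) *\<^sub>R w" using w(2) by (metis divide_inverse_commute divideR_right scaleR_scaleR)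
    then have "k / x \<noteq> 0" using v(2) by auto
    then consider "k / x > 0" | "- (k / x) > 0" by linarith
    then show False
    proof cases
      case 1
      then have "G \<subseteq> ?F" using v(3) max_face_scale[OF 1, of P w] vw by simp
      then show False
        using face_eqI_aff_dim[OF Gf(1) max_face_of[OF cP]] two_faces_dim(2)[OF G2] two_faces_dim(2)[OF F] G(2) by simp
    next
      case 2
      then have sub: "G \<subseteq> max_face P (- w)" using v(3) max_face_scale[OF 2, of P "- w"] vw by simp
      have "aff_dim (max_face P (- w)) \<le> 2"
      proof -
        have "- w = (- x) *\<^sub>R a + (- y) *\<^sub>R b" by (simp add: w(1))
        then show ?thesis using max_face_aff_dim_le_2[of P "- x" a b "- y", OF P(1) _ par] w(2) by simp
      qed
      moreover have "aff_dim (max_face P (- w)) \<ge> 2"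
        using aff_dim_subset[OF sub] two_faces_dim(2)[OF G2] by simp
      ultimately have "max_face P (- w) \<in> two_faces P"
        using max_face_of[OF cP] by (simp add: two_faces_def)
      then show False using F' by simp
    qed
  qed
  have "linear_plane ?W" using ind by (simp add: linear_plane_def)
  moreover have "projects_to_boundary P ?W ?F"
    by (rule projects_to_boundary_max_face[OF cP subspace_span wW FP])
  ultimately have "simultaneously_visible P ?F {}"
    unfolding simultaneously_visible_def using F only alone by (simp only: if_True refl) blast
  then show ?thesis using signed_edge_sum_single[OF P(1) ori part _ sep] by blast
qed

lemma signed_edge_sum_balance:
  fixes P :: "'a::euclidean_space set"
  assumes P: "polytope P" "aff_dim P = DIM('a)" "DIM('a) \<ge> 3"
    and ori: "orientation_choice P ori cyc" and part: "partitioned_into_compensating_pairs P ori cyc"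
    and ind: "dim (span {a, b}) = 2"
    and par: "\<And>F G. F \<in> two_faces P \<Longrightarrow> G \<in> two_faces P \<Longrightarrow> \<not> separates a b (dir_space F) \<Longrightarrow>
      \<not> separates a b (dir_space G) \<Longrightarrow> dir_space F = dir_space G"
    and w: "w = a + y *\<^sub>R b"
    and S: "\<And>F. F \<in> two_faces P \<Longrightarrow> \<not> separates a b (dir_space F) \<Longrightarrow> dir_space F = S"
    and z: "z \<in> S" "b \<bullet> z \<noteq> 0"
    and sep: "separates \<alpha> \<beta> S"
  shows "signed_edge_sum P \<alpha> \<beta> (max_face P w) = signed_edge_sum P \<alpha> \<beta> (max_face P (- w))"
proof -
  let ?F = "max_face P w" and ?F' = "max_face P (- w)" and ?W = "span {a, b}"
  have cP: "convex P" using P(1) polytope_imp_convex by blast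
  have w1: "w = 1 *\<^sub>R a + y *\<^sub>R b" and w2: "- w = (-1) *\<^sub>R a + (- y) *\<^sub>R b" by (simp_all add: w)
  have dirF: "dir_space ?F = S" "\<not> separates a b (dir_space ?F)" if "?F \<in> two_faces P"
    using S[OF that] degenerate_if_subset_max_face[OF that, of 1 a y b] w1 by auto
  have dirF': "dir_space ?F' = S" "\<not> separates a b (dir_space ?F')" if "?F' \<in> two_faces P"
    using S[OF that] degenerate_if_subset_max_face[OF that, of "-1" a "- y" b] w2 by auto
  have proper: "F \<noteq> P" if "F \<in> two_faces P" for F using that P by (auto simp: two_faces_def)
  consider "?F \<in> two_faces P" "?F' \<in> two_faces P" | "?F \<in> two_faces P" "?F' \<notin> two_faces P"
    | "?F \<notin> two_faces P" "?F' \<in> two_faces P" | "?F \<notin> two_faces P" "?F' \<notin> two_faces P" by blast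
  then show ?thesis
  proof cases
    case 1
    have wW: "w \<in> ?W" unfolding w1 span_pair by blast
    then have wW': "- w \<in> ?W" by (rule span_neg)
    have "?F \<noteq> ?F'"
    proof
      assume eq: "?F = ?F'"
      obtain p where "p \<in> ?F" using two_faces_dim(3)[OF 1(1)] by blast
      then have "\<forall>y\<in>P. w \<bullet> y \<le> w \<bullet> p" "\<forall>y\<in>P. w \<bullet> p \<le> w \<bullet> y" using eq by (auto simp: max_face_def)
      then have "?F = P" unfolding max_face_def by (auto intro: order_trans)
      then show False using proper[OF 1(1)] by simp
    qed
    moreover have "(?F, ?F') \<in> parallel_rel P" using 1 dirF dirF' by (simp add: parallel_rel_def)
    moreover have "only_degenerating_class P ?W ?F"
    proof (rule only_degenerating_classI[OF subspace_span 1(1)])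
      show "degenerating ?W ?F" using dirF(2)[OF 1(1)] degenerating_span_iff[OF 1(1)] by blast
      show "dir_space G = dir_space ?F" if "G \<in> two_faces P" "degenerating ?W G" for G
        using S[OF that(1)] dirF(1)[OF 1(1)] degenerating_span_iff[OF that(1), of a b] that(2) by simp
    qed
    moreover have "linear_plane ?W" using ind by (simp add: linear_plane_def)
    moreover have "projects_to_boundary P ?W ?F" "projects_to_boundary P ?W ?F'"
      using projects_to_boundary_max_face[OF cP subspace_span wW] proper[OF 1(1)]
        projects_to_boundary_max_face[OF cP subspace_span wW'] proper[OF 1(2)] by blast+
    moreover have ne: "?F' \<noteq> {}" by (rule two_faces_dim(3)[OF 1(2)])
    ultimately have "simultaneously_visible P ?F ?F'"
      unfolding simultaneously_visible_def using 1(1) by (simp only: if_False) blast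
    moreover have "separates \<alpha> \<beta> (dir_space ?F)" using sep dirF(1)[OF 1(1)] by simp
    ultimately show ?thesis
      using signed_edge_sum_pair[OF P(1) ori part _ ne _ refl refl] 1 by (simp add: signed_edge_sum_def)
  next
    case 2
    then have "separates \<alpha> \<beta> (dir_space ?F)" "z \<in> dir_space ?F" using sep z dirF(1) by simp_all
    then have "(\<Sum>e | e edge_of ?F. edge_sign \<alpha> \<beta> ?F e) = 0"
      using signed_edge_sum_lonely[OF P ori part ind par w1 _ _ z(2) 2(1,2)] by simp
    then show ?thesis using 2 by (simp add: signed_edge_sum_def)
  next
    case 3
    then have "separates \<alpha> \<beta> (dir_space ?F')" "z \<in> dir_space ?F'" using sep z dirF'(1) by simp_all
    then have "(\<Sum>e | e edge_of ?F'. edge_sign \<alpha> \<beta> ?F' e) = 0"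
      using signed_edge_sum_lonely[OF P ori part ind par w2 _ _ z(2) 3(2)] 3(1) by simp
    then show ?thesis using 3 by (simp add: signed_edge_sum_def)
  next
    case 4
    then show ?thesis by (simp add: signed_edge_sum_def)
  qed
qed

text \<open>By \<open>par\<close> all degenerate faces share one direction space, on which exactly
  one functional \<open>w\<close> of the form \<open>a + y *\<^sub>R b\<close> vanishes. Every
  crossing edge has normal \<open>w\<close>, so the crossings are the edges of
  \<open>max_face P w\<close> and, with factor -1, of \<open>max_face P (- w)\<close>, as far as
  these are 2-faces.\<close>

lemma signed_crossings_cancel:
  fixes P :: "'a::euclidean_space set"
  assumes P: "polytope P" "aff_dim P = DIM('a)" "DIM('a) \<ge> 3"
    and ori: "orientation_choice P ori cyc" and part: "partitioned_into_compensating_pairs P ori cyc"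
    and gen: "edges_generic P b"
    and ind: "dim (span {a, b}) = 2"
    and par: "\<And>F G. F \<in> two_faces P \<Longrightarrow> G \<in> two_faces P \<Longrightarrow> \<not> separates a b (dir_space F) \<Longrightarrow>
      \<not> separates a b (dir_space G) \<Longrightarrow> dir_space F = dir_space G"
    and sep: "\<And>F. F \<in> two_faces P \<Longrightarrow> \<not> separates a b (dir_space F) \<Longrightarrow> separates \<alpha> b (dir_space F)"
    and G: "\<And>\<sigma> e. G \<sigma> e = max_face P (\<sigma> *\<^sub>R edge_normal a b e)"
  shows "(\<Sum>e | e edge_of P. \<Sum>\<sigma>\<in>{1, -1}.
    if G \<sigma> e \<in> two_faces P \<and> e \<subseteq> G \<sigma> e then \<sigma> * edge_sign \<alpha> b (G \<sigma> e) e else 0) = 0"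
proof (cases "\<exists>F\<in>two_faces P. \<not> separates a b (dir_space F)")
  case False
  have "G \<sigma> e \<notin> two_faces P" if "\<sigma> \<in> {1, -1}" for \<sigma> e
    using False that degenerate_if_subset_max_face[OF _ eq_refl[OF G[unfolded scaled_edge_normal]], of \<sigma> e] by auto
  then show ?thesis by (intro sum.neutral ballI) auto
next
  case True
  then obtain F0 where F0: "F0 \<in> two_faces P" "\<not> separates a b (dir_space F0)" by blast
  define S where "S = dir_space F0"
  have S: "subspace S" "dim S = 2" using two_faces_dim(4)[OF F0(1)] by (simp_all add: S_def subspace_dir_space)
  have sepS: "separates \<alpha> b S" using sep[OF F0] by (simp add: S_def)
  have dirS: "dir_space F = S" if "F \<in> two_faces P" "\<not> separates a b (dir_space F)" for F
    using par[OF that(1) F0(1) that(2) F0(2)] by (simp add: S_def)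
  obtain v where v: "v \<in> S" "v \<noteq> 0" "a \<bullet> v = 0" "b \<bullet> v = 0" using F0(2) unfolding S_def separates_iff by blast
  obtain z where "z \<in> S" "z \<noteq> 0" "\<alpha> \<bullet> z = 0" using plane_kernel[OF S(1)] S(2) by (metis order_refl)
  then have z: "z \<in> S" "b \<bullet> z \<noteq> 0" using sepS by (auto simp: separates_def)
  \<comment> \<open>All combinations of \<open>a\<close> and \<open>b\<close> kill \<open>v\<close>;
    this coefficient makes \<open>w\<close> kill \<open>z\<close> too, and \<open>v\<close> and
    \<open>z\<close> span \<open>S\<close>.\<close>
  define w where "w = a + (- (a \<bullet> z) / (b \<bullet> z)) *\<^sub>R b"
  have wz: "w \<bullet> z = 0" unfolding w_def inner_add_left inner_scaleR_left using z(2) by simp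
  have w0: "w \<bullet> x = 0" if x: "x \<in> S" for x
  proof -
    have "z \<noteq> c *\<^sub>R v" for c using z(2) v(4) by auto
    then obtain c1 c2 where "x = c1 *\<^sub>R v + c2 *\<^sub>R z"
      using plane_coordinates[OF S v(1) z(1) v(2) _ x] by blast
    moreover have "w \<bullet> v = 0" unfolding w_def inner_add_left inner_scaleR_left using v(3,4) by simp
    ultimately show ?thesis using wz by (simp add: inner_add_right)
  qed
  have cP: "convex P" using P(1) polytope_imp_convex by blast
  let ?H = "\<lambda>\<sigma>. max_face P (\<sigma> *\<^sub>R w)"
  let ?J = "\<lambda>\<sigma> e. if G \<sigma> e \<in> two_faces P \<and> e \<subseteq> G \<sigma> e then \<sigma> * edge_sign \<alpha> b (G \<sigma> e) e else 0"
  have summand: "?J \<sigma> e = (if ?H \<sigma> \<in> two_faces P \<and> e edge_of ?H \<sigma> then \<sigma> * edge_sign \<alpha> b (?H \<sigma>) e else 0)"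
    if e: "e edge_of P" and \<sigma>: "\<sigma> \<in> {1, -1}" for \<sigma> e
  proof -
    have norm: "edge_normal a b e = w" if "w \<bullet> edge_vec e = 0"
      using edge_normal_unique[OF gen e, of a "- (a \<bullet> z) / (b \<bullet> z)"] that by (simp add: w_def)
    have crossing: "G \<sigma> e = ?H \<sigma> \<and> ?H \<sigma> \<in> two_faces P \<and> e edge_of ?H \<sigma>" if "G \<sigma> e \<in> two_faces P" "e \<subseteq> G \<sigma> e"
    proof -
      have "\<not> separates a b (dir_space (G \<sigma> e))"
        using degenerate_if_subset_max_face[OF that(1) eq_refl[OF G[unfolded scaled_edge_normal]]] \<sigma> by auto
      then have "dir_space (G \<sigma> e) = S" using dirS that(1) by blast
      then have "edge_vec e \<in> S" using edge_vec_in_dir_space[OF P(1) e that(2)] by simp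
      then have "G \<sigma> e = ?H \<sigma>" using norm w0 G by simp
      then show ?thesis
        using that e face_of_face[OF max_face_of[OF cP], of e "\<sigma> *\<^sub>R w"] by (auto simp: edge_of_def)
    qed
    have crossed: "G \<sigma> e = ?H \<sigma> \<and> e \<subseteq> G \<sigma> e" if "e edge_of ?H \<sigma>"
    proof -
      have sub: "e \<subseteq> ?H \<sigma>" using that by (rule edge_of_imp_subset)
      have "(\<sigma> *\<^sub>R w) \<bullet> edge_vec e = 0"
        using inner_dir_max_face edge_vec_in_dir_space[OF P(1) e sub] by blast
      then have "w \<bullet> edge_vec e = 0" using \<sigma> by auto
      then show ?thesis using norm G sub by simp
    qed
    show ?thesis
    proof (cases "G \<sigma> e \<in> two_faces P \<and> e \<subseteq> G \<sigma> e")
      case True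
      then show ?thesis using crossing by simp
    next
      case False
      then have "\<not> (?H \<sigma> \<in> two_faces P \<and> e edge_of ?H \<sigma>)" using crossed by metis
      then show ?thesis by (simp only: False if_False)
    qed
  qed
  have part_sum: "(\<Sum>e | e edge_of P. ?J \<sigma> e) = \<sigma> * signed_edge_sum P \<alpha> b (?H \<sigma>)" if \<sigma>: "\<sigma> \<in> {1, -1}" for \<sigma>
  proof -
    have "(\<Sum>e | e edge_of P. ?J \<sigma> e) =
      (\<Sum>e | e edge_of P. if ?H \<sigma> \<in> two_faces P \<and> e edge_of ?H \<sigma> then \<sigma> * edge_sign \<alpha> b (?H \<sigma>) e else 0)"
      by (intro sum.cong refl summand[OF _ \<sigma>]) simp
    also have "\<dots> = \<sigma> * signed_edge_sum P \<alpha> b (?H \<sigma>)"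
    proof (cases "?H \<sigma> \<in> two_faces P")
      case True
      have "{e. e edge_of ?H \<sigma>} \<subseteq> {e. e edge_of P}"
        using face_of_trans[OF _ max_face_of[OF cP]] by (auto simp: edge_of_def)
      then have "(\<Sum>e | e edge_of P. if e edge_of ?H \<sigma> then \<sigma> * edge_sign \<alpha> b (?H \<sigma>) e else 0) =
          (\<Sum>e | e edge_of ?H \<sigma>. \<sigma> * edge_sign \<alpha> b (?H \<sigma>) e)"
        using finite_edges[OF P(1)] by (intro sum.mono_neutral_cong_right) auto
      then show ?thesis using True by (simp add: signed_edge_sum_def sum_distrib_left)
    qed (simp add: signed_edge_sum_def)
    finally show ?thesis .
  qed
  have "(\<Sum>e | e edge_of P. \<Sum>\<sigma>\<in>{1, -1}. ?J \<sigma> e) = (\<Sum>\<sigma>\<in>{1, -1}. \<Sum>e | e edge_of P. ?J \<sigma> e)"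
    by (rule sum.swap)
  also have "\<dots> = (\<Sum>\<sigma>\<in>{1, -1}. \<sigma> * signed_edge_sum P \<alpha> b (?H \<sigma>))"
    by (intro sum.cong refl part_sum)
  also have "\<dots> = signed_edge_sum P \<alpha> b (max_face P w) - signed_edge_sum P \<alpha> b (max_face P (- w))" by simp
  also have "\<dots> = 0"
    using signed_edge_sum_balance[OF P ori part ind par w_def dirS z sepS] by simp
  finally show ?thesis .
qed

section \<open>Constancy of the edge count along a sweep\<close>

lemma finite_degenerate_parameters:
  fixes P :: "'a::euclidean_space set"
  assumes P: "polytope P" and sep: "\<And>F. F \<in> two_faces P \<Longrightarrow> separates a b (dir_space F)"
  shows "finite {t. \<exists>F\<in>two_faces P. \<not> separates (a + t *\<^sub>R a') b (dir_space F)}"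
proof -
  have "finite {t. \<not> separates (a + t *\<^sub>R a') b (dir_space F)}" if F: "F \<in> two_faces P" for F
  proof -
    \<comment> \<open>The kernel of \<open>b\<close> in \<open>dir_space F\<close> is a line, so
      degeneracy is a single affine equation in the parameter, with nonzero slope
      \<open>a' \<bullet> v\<close>.\<close>
    have uniq: "t = s" if deg: "\<not> separates (a + t *\<^sub>R a') b (dir_space F)" "\<not> separates (a + s *\<^sub>R a') b (dir_space F)" for t s
    proof -
      obtain v where v: "v \<in> dir_space F" "v \<noteq> 0" "(a + t *\<^sub>R a') \<bullet> v = 0" "b \<bullet> v = 0"
        using deg(1) unfolding separates_iff by blast
      obtain v' where v': "v' \<in> dir_space F" "v' \<noteq> 0" "(a + s *\<^sub>R a') \<bullet> v' = 0" "b \<bullet> v' = 0"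
        using deg(2) unfolding separates_iff by blast
      obtain k where k: "v' = k *\<^sub>R v"
        using separates_kernel_parallel[OF sep[OF F] subspace_dir_space v(1) v'(1) v(4) v'(4) v(2)] .
      then have "(a + s *\<^sub>R a') \<bullet> v = 0" using v'(2,3) by simp
      then have "s * (a' \<bullet> v) = t * (a' \<bullet> v)" using v(3)
        by (simp only: inner_add_left inner_scaleR_left)
      moreover have "separates a' b (dir_space F)"
        using separates_direction[OF sep[OF F] deg(1) subspace_dir_space] .
      then have "a' \<bullet> v \<noteq> 0" using v by (auto simp: separates_def)
      ultimately show ?thesis by simp
    qed
    show ?thesis
    proof (cases "\<exists>t. \<not> separates (a + t *\<^sub>R a') b (dir_space F)")
      case True
      then obtain t0 where "\<not> separates (a + t0 *\<^sub>R a') b (dir_space F)" by blast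
      then have "{t. \<not> separates (a + t *\<^sub>R a') b (dir_space F)} \<subseteq> {t0}" using uniq by blast
      then show ?thesis by (rule finite_subset) simp
    qed simp
  qed
  moreover have "finite (two_faces P)"
    using finite_polytope_faces[OF P] by (rule rev_finite_subset) (auto simp: two_faces_def)
  moreover have "{t. \<exists>F\<in>two_faces P. \<not> separates (a + t *\<^sub>R a') b (dir_space F)} =
    (\<Union>F\<in>two_faces P. {t. \<not> separates (a + t *\<^sub>R a') b (dir_space F)})" by blast
  ultimately show ?thesis by simp
qed

text \<open>Punctured neighbourhoods are compared with the value at their centre, so this is local
  constancy on the connected real line.\<close>

lemma eventually_at_constant_imp_eq:
  fixes h :: "real \<Rightarrow> 'b"
  assumes "\<And>s. \<forall>\<^sub>F t in at s. h t = h s"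
  shows "h x = h y"
proof -
  have "h constant_on UNIV"
  proof (rule locally_constant_imp_constant)
    show "\<exists>T. openin (top_of_set UNIV) T \<and> s \<in> T \<and> (\<forall>x\<in>T. h x = h s)" for s
    proof -
      obtain T where "open T" "s \<in> T" "\<forall>x\<in>T. x \<noteq> s \<longrightarrow> h x = h s"
        using assms[of s] unfolding eventually_at_topological by blast
      then show ?thesis by (intro exI[of _ T]) auto
    qed
  qed simp
  then show ?thesis unfolding constant_on_def by auto
qed

text \<open>The half-count \<open>h\<close> below averages the edge count over the two sides of a degenerate
  parameter, so that it is locally constant precisely because the signed crossings cancel.\<close>

lemma card_silhouette_sweep:
  fixes P :: "'a::euclidean_space set"
  assumes P: "polytope P" "aff_dim P = DIM('a)" "DIM('a) \<ge> 3"
    and ori: "orientation_choice P ori cyc" and part: "partitioned_into_compensating_pairs P ori cyc"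
    and gen: "edges_generic P b"
    and ind: "\<And>t. dim (span {a + t *\<^sub>R a', b}) = 2"
    and par: "\<And>t F G. F \<in> two_faces P \<Longrightarrow> G \<in> two_faces P \<Longrightarrow> \<not> separates (a + t *\<^sub>R a') b (dir_space F) \<Longrightarrow>
      \<not> separates (a + t *\<^sub>R a') b (dir_space G) \<Longrightarrow> dir_space F = dir_space G"
    and sep: "\<And>F. F \<in> two_faces P \<Longrightarrow> separates a b (dir_space F)"
    and sep1: "\<And>F. F \<in> two_faces P \<Longrightarrow> separates (a + a') b (dir_space F)"
  shows "card (silhouette P (span {a, b})) = card (silhouette P (span {a + a', b}))"
proof -
  define G where "G t \<sigma> e = max_face P (\<sigma> *\<^sub>R edge_normal (a + t *\<^sub>R a') b e)" for t \<sigma> e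
  define f :: "real \<Rightarrow> real" where
    "f t = (\<Sum>e | e edge_of P. \<Sum>\<sigma>\<in>{1, -1}. of_bool (e \<subseteq> G t \<sigma> e))" for t
  define h :: "real \<Rightarrow> real" where
    "h t = (\<Sum>e | e edge_of P. \<Sum>\<sigma>\<in>{1, -1}.
      if G t \<sigma> e \<in> two_faces P \<and> e \<subseteq> G t \<sigma> e then 1 / 2 else of_bool (e \<subseteq> G t \<sigma> e))" for t
  let ?good = "\<lambda>t. \<forall>F\<in>two_faces P. separates (a + t *\<^sub>R a') b (dir_space F)"
  have fcard: "real (card (silhouette P (span {a + t *\<^sub>R a', b}))) = f t" if "?good t" for t
    unfolding f_def G_def using that by (intro card_silhouette[OF P gen _ ind]) blast
  \<comment> \<open>Away from degeneracy none of the maximal faces in the sum is a 2-face, so the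
    half-count is the true count.\<close>
  have fh: "f t = h t" if "?good t" for t
    unfolding f_def h_def
  proof (intro sum.cong refl)
    fix e \<sigma> assume "\<sigma> \<in> {1, -1 :: real}"
    then have "G t \<sigma> e \<notin> two_faces P"
      using degenerate_if_subset_max_face[OF _ eq_refl[OF G_def[unfolded scaled_edge_normal]], of t \<sigma> e] that by auto
    then show "of_bool (e \<subseteq> G t \<sigma> e) =
      (if G t \<sigma> e \<in> two_faces P \<and> e \<subseteq> G t \<sigma> e then 1 / 2 else of_bool (e \<subseteq> G t \<sigma> e))" by simp
  qed
  have "\<forall>\<^sub>F t in at s. h t = h s" for s
  proof -
    let ?J = "\<lambda>\<sigma> e. if G s \<sigma> e \<in> two_faces P \<and> e \<subseteq> G s \<sigma> e then \<sigma> * edge_sign a' b (G s \<sigma> e) e else 0"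
    let ?k = "\<lambda>\<sigma> e. if G s \<sigma> e \<in> two_faces P \<and> e \<subseteq> G s \<sigma> e then 1 / 2 else of_bool (e \<subseteq> G s \<sigma> e) :: real"
    have J: "(\<Sum>e | e edge_of P. \<Sum>\<sigma>\<in>{1, -1}. ?J \<sigma> e) = 0"
      using separates_direction[OF sep _ subspace_dir_space]
      by (intro signed_crossings_cancel[OF P ori part gen ind[of s] par[where t = s] _ G_def[of s]]) auto
    \<comment> \<open>Each indicator is its half-count at \<open>s\<close> plus a multiple of
      \<open>sgn (t - s)\<close>; summed over all edges, these multiples cancel by
      \<open>J\<close>.\<close>
    have "\<forall>\<^sub>F t in at s. \<forall>e\<in>{e. e edge_of P}. \<forall>\<sigma>\<in>{1, -1}.
      of_bool (e \<subseteq> G t \<sigma> e) = ?k \<sigma> e + ?J \<sigma> e * (sgn (t - s) / 2)"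
    proof (intro eventually_ball_finite ballI finite_edges[OF P(1)])
      fix e and \<sigma> :: real assume e: "e \<in> {e. e edge_of P}" "\<sigma> \<in> {1, -1}"
      have "\<bar>\<sigma>\<bar> = 1" "e edge_of P" using e by auto
      from edge_visible_near[OF P(1) gen sep par this(2,1) G_def]
      show "\<forall>\<^sub>F t in at s. of_bool (e \<subseteq> G t \<sigma> e) = ?k \<sigma> e + ?J \<sigma> e * (sgn (t - s) / 2)"
        unfolding G_def[symmetric] by (rule eventually_mono) (auto split: if_splits)
    qed simp
    moreover have "\<forall>\<^sub>F t in at s. ?good t"
    proof -
      let ?C = "{t. \<exists>F\<in>two_faces P. \<not> separates (a + t *\<^sub>R a') b (dir_space F)}"
      have "closed (?C - {s})" using finite_degenerate_parameters[OF P(1) sep, of a'] by (simp add: finite_imp_closed)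
      then have "open (- (?C - {s}))" by (rule open_Compl)
      then show ?thesis unfolding eventually_at_topological by (intro exI[of _ "- (?C - {s})"]) auto
    qed
    ultimately show ?thesis
    proof eventually_elim
      case (elim t)
      have "h t = f t" using fh[OF elim(2)] by simp
      also have "f t = (\<Sum>e | e edge_of P. \<Sum>\<sigma>\<in>{1, -1}. ?k \<sigma> e + ?J \<sigma> e * (sgn (t - s) / 2))"
        unfolding f_def using elim(1) by (intro sum.cong refl) blast
      also have "\<dots> = h s + (\<Sum>e | e edge_of P. \<Sum>\<sigma>\<in>{1, -1}. ?J \<sigma> e) * (sgn (t - s) / 2)"
        unfolding h_def sum.distrib sum_distrib_right ..
      finally show ?case by (simp only: J)
    qed
  qed
  then have "h 0 = h 1" by (rule eventually_at_constant_imp_eq)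
  then have "f 0 = f 1" using fh[of 0] fh[of 1] sep sep1 by simp
  then show ?thesis using fcard[of 0] fcard[of 1] sep sep1 by simp
qed

subsection \<open>Generic planes\<close>

text \<open>A subspace is not covered by finitely many proper subspaces. A vector good for
  \<open>D\<close> and one good for \<open>d\<close> are combined with a factor avoiding finitely
  many ratios.\<close>

lemma exists_generic_vector:
  fixes W :: "'a::euclidean_space set"
  assumes "finite D" "subspace W" "\<And>d. d \<in> D \<Longrightarrow> \<exists>x\<in>W. x \<bullet> d \<noteq> 0"
  shows "\<exists>x\<in>W. \<forall>d\<in>D. x \<bullet> d \<noteq> 0"
  using assms(1,3)
proof (induction D)
  case empty
  then show ?case using subspace_0[OF assms(2)] by auto
next
  case (insert d D)
  then obtain x where x: "x \<in> W" "\<forall>d\<in>D. x \<bullet> d \<noteq> 0" by auto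
  obtain y where y: "y \<in> W" "y \<bullet> d \<noteq> 0" using insert.prems by blast
  let ?bad = "(\<lambda>d. - (y \<bullet> d) / (x \<bullet> d)) ` insert d D"
  have "infinite (UNIV :: real set)" by (rule infinite_UNIV_char_0)
  then obtain r where r: "r \<notin> ?bad" "r \<noteq> 0"
    using insert.hyps(1) ex_new_if_finite[of "insert 0 ?bad"] by auto
  have "(r *\<^sub>R x + y) \<bullet> d' \<noteq> 0" if d': "d' \<in> insert d D" for d'
  proof
    assume 0: "(r *\<^sub>R x + y) \<bullet> d' = 0"
    show False
    proof (cases "x \<bullet> d' = 0")
      case True
      then have "d' = d" using x(2) d' by blast
      then show False using 0 True y(2) by (simp add: inner_add_left)
    next
      case False
      have "r * (x \<bullet> d') = - (y \<bullet> d')" using 0 by (simp add: inner_add_left)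
      then have "r = - (y \<bullet> d') / (x \<bullet> d')" by (metis False nonzero_mult_div_cancel_right)
      then show False using r(1) d' by blast
    qed
  qed
  moreover have "r *\<^sub>R x + y \<in> W" using x(1) y(1) assms(2) by (simp add: subspace_add subspace_scale)
  ultimately show ?case by blast
qed

text \<open>By the second condition the lines that \<open>b\<close> kills in the direction spaces of
  nonparallel 2-faces are different, so a suitable motion of \<open>a\<close> makes these faces
  degenerate at different parameters.\<close>

definition generic :: "'a::euclidean_space set \<Rightarrow> 'a \<Rightarrow> bool" where
  "generic P b \<longleftrightarrow> edges_generic P b \<and> (\<forall>F\<in>two_faces P. \<forall>G\<in>two_faces P.
     dir_space F \<noteq> dir_space G \<longrightarrow> (\<forall>d\<in>dir_space F \<inter> dir_space G. b \<bullet> d = 0 \<longrightarrow> d = 0))"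

lemma edge_vec_nonzero:
  fixes P :: "'a::euclidean_space set"
  assumes "polytope P" "e edge_of P"
  shows "edge_vec e \<noteq> 0"
proof -
  obtain p q where "e = closed_segment p q" "edge_vec e = q - p" using edge_vec[OF assms] .
  then show ?thesis using segment_edge_ends(1)[of p q P] assms(2) by auto
qed

lemma finite_two_faces: "polytope P \<Longrightarrow> finite (two_faces P)"
  by (rule finite_subset[OF _ finite_polytope_faces]) (auto simp: two_faces_def)

lemma nonparallel_planes_Int:
  fixes S T :: "'a::euclidean_space set"
  assumes "subspace S" "subspace T" "dim S = 2" "dim T = 2" "S \<noteq> T"
    and d: "d \<in> S \<inter> T" "d \<noteq> 0" and x: "x \<in> S \<inter> T"
  obtains c where "x = c *\<^sub>R d"
proof (rule ccontr)
  assume "\<not> thesis"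
  then have ni: "x \<noteq> c *\<^sub>R d" for c using that by blast
  have "y \<in> T" if y: "y \<in> S" for y
  proof -
    obtain c1 c2 where "y = c1 *\<^sub>R d + c2 *\<^sub>R x"
      using plane_coordinates[OF assms(1,3) _ _ d(2) ni y] d x by blast
    then show ?thesis using d x assms(2) by (simp add: subspace_add subspace_scale)
  qed
  moreover have "y \<in> S" if y: "y \<in> T" for y
  proof -
    obtain c1 c2 where "y = c1 *\<^sub>R d + c2 *\<^sub>R x"
      using plane_coordinates[OF assms(2,4) _ _ d(2) ni y] d x by blast
    then show ?thesis using d x assms(1) by (simp add: subspace_add subspace_scale)
  qed
  ultimately show False using assms(5) by blast
qed

text \<open>Two distinct planes meet at most in a line, so one test vector per pair suffices for all
  common directions. Each test vector lies in the direction space of a 2-face, which is what lets an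
  admissible plane contain a generic vector.\<close>

lemma generic_criterion:
  fixes P :: "'a::euclidean_space set"
  assumes P: "polytope P" "aff_dim P \<ge> 2"
  obtains D where "finite D" "\<And>d. d \<in> D \<Longrightarrow> d \<noteq> 0 \<and> (\<exists>F\<in>two_faces P. d \<in> dir_space F)"
    "\<And>b. (\<And>d. d \<in> D \<Longrightarrow> b \<bullet> d \<noteq> 0) \<Longrightarrow> generic P b"
proof -
  define meet where "meet F G d \<longleftrightarrow> d \<in> dir_space F \<inter> dir_space G \<and> d \<noteq> 0" for F G :: "'a set" and d
  define pick where "pick F G = (SOME d. meet F G d)" for F G
  have pick: "meet F G (pick F G)" if "meet F G d" for F G d
    unfolding pick_def using that by (rule someI)
  let ?D1 = "edge_vec ` {e. e edge_of P}"
  let ?N = "{(F, G). F \<in> two_faces P \<and> G \<in> two_faces P \<and> (\<exists>d. meet F G d)}"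
  let ?D2 = "(\<lambda>(F, G). pick F G) ` ?N"
  show thesis
  proof (rule that[of "?D1 \<union> ?D2"])
    have "finite ?N" using finite_two_faces[OF P(1)] by (intro finite_subset[of ?N "two_faces P \<times> two_faces P"]) auto
    then show "finite (?D1 \<union> ?D2)" using finite_edges[OF P(1)] by simp
  next
    fix d assume "d \<in> ?D1 \<union> ?D2"
    then show "d \<noteq> 0 \<and> (\<exists>F\<in>two_faces P. d \<in> dir_space F)"
    proof
      assume "d \<in> ?D1"
      then obtain e where e: "e edge_of P" "d = edge_vec e" by auto
      obtain F where F: "F \<in> two_faces P" "e \<subseteq> F" by (rule edge_in_two_face[OF P e(1)])
      have "d \<in> dir_space F" "d \<noteq> 0"
        unfolding e(2) by (rule edge_vec_in_dir_space[OF P(1) e(1) F(2)], rule edge_vec_nonzero[OF P(1) e(1)])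
      then show ?thesis using F(1) by auto
    next
      assume "d \<in> ?D2"
      then obtain F G d' where FG: "F \<in> two_faces P" "meet F G d'" "d = pick F G" by auto
      have "meet F G d" using pick[OF FG(2)] FG(3) by simp
      then show ?thesis using FG(1) by (auto simp: meet_def)
    qed
  next
    fix b assume b: "\<And>d. d \<in> ?D1 \<union> ?D2 \<Longrightarrow> b \<bullet> d \<noteq> 0"
    have "d = 0" if FG: "F \<in> two_faces P" "G \<in> two_faces P" "dir_space F \<noteq> dir_space G"
      and d: "d \<in> dir_space F \<inter> dir_space G" "b \<bullet> d = 0" for F G d
    proof (rule ccontr)
      assume "d \<noteq> 0"
      then have ex: "meet F G d" using d(1) by (simp add: meet_def)
      have d0: "pick F G \<in> dir_space F \<inter> dir_space G" "pick F G \<noteq> 0"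
        using pick[OF ex] by (simp_all add: meet_def)
      have "(F, G) \<in> ?N" using FG(1,2) ex by auto
      then have "pick F G \<in> ?D2" by (rule rev_image_eqI) simp
      then have "b \<bullet> pick F G \<noteq> 0" by (intro b UnI2)
      moreover obtain c where "d = c *\<^sub>R pick F G"
        using nonparallel_planes_Int[OF subspace_dir_space subspace_dir_space two_faces_dim(4)[OF FG(1)]
            two_faces_dim(4)[OF FG(2)] FG(3) d0 d(1)] .
      ultimately show False using d(2) \<open>d \<noteq> 0\<close> by simp
    qed
    moreover have "edges_generic P b" unfolding edges_generic_def by (intro allI impI b UnI1 imageI CollectI)
    ultimately show "generic P b" unfolding generic_def by blast
  qed
qed

lemma dim_span_pair_eq_2:
  fixes a b :: "'a::euclidean_space"
  shows "dim (span {a, b}) = 2 \<longleftrightarrow> b \<noteq> 0 \<and> (\<forall>y. a \<noteq> y *\<^sub>R b)"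
proof
  assume *: "dim (span {a, b}) = 2"
  have "b \<noteq> 0"
  proof
    assume "b = 0"
    then have "span {a, b} = span {a}" by (simp add: insert_commute)
    then show False using * dim_le_card[of "span {a}" "{a}"] by simp
  qed
  moreover have "a \<noteq> y *\<^sub>R b" for y
  proof
    assume "a = y *\<^sub>R b"
    then have "span {a, b} = span {b}" by (simp add: span_redundant span_base span_scale)
    then show False using * dim_le_card[of "span {b}" "{b}"] by simp
  qed
  ultimately show "b \<noteq> 0 \<and> (\<forall>y. a \<noteq> y *\<^sub>R b)" by blast
next
  assume *: "b \<noteq> 0 \<and> (\<forall>y. a \<noteq> y *\<^sub>R b)"
  then have "a \<notin> span {b}" by (auto simp: span_singleton)
  then have "independent {a, b}" using * by (simp add: independent_insert)
  moreover have "a \<noteq> b" using * by (metis scaleR_one)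
  ultimately show "dim (span {a, b}) = 2" by (simp add: dim_eq_card_independent)
qed

text \<open>\<open>D\<close> collects three conditions on the end \<open>c\<close> of the segment
  from \<open>a\<close>: the moving vector stays independent of \<open>b\<close>, nothing
  degenerates at \<open>c\<close>, and no two classes degenerate together on the way.\<close>

lemma silhouette_of_generic_neighbour:
  fixes P :: "'a::euclidean_space set"
  assumes P: "polytope P" "aff_dim P = DIM('a)" "DIM('a) \<ge> 3"
    and ori: "orientation_choice P ori cyc" and part: "partitioned_into_compensating_pairs P ori cyc"
    and gen: "generic P b" and ind: "dim (span {a, b}) = 2"
    and sep: "\<And>F. F \<in> two_faces P \<Longrightarrow> separates a b (dir_space F)"
  obtains D where "finite D" "0 \<notin> D"
    "\<And>c. (\<And>d. d \<in> D \<Longrightarrow> c \<bullet> d \<noteq> 0) \<Longrightarrow> (\<forall>F\<in>two_faces P. separates c b (dir_space F)) \<and>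
      dim (span {c, b}) = 2 \<and> card (silhouette P (span {a, b})) = card (silhouette P (span {c, b}))"
proof -
  have "\<exists>v. v \<in> dir_space F \<and> v \<noteq> 0 \<and> b \<bullet> v = 0" if "F \<in> two_faces P" for F
    using plane_kernel[OF subspace_dir_space, of F b] two_faces_dim(4)[OF that] by auto
  then obtain v where v: "\<And>F. F \<in> two_faces P \<Longrightarrow> v F \<in> dir_space F \<and> v F \<noteq> 0 \<and> b \<bullet> v F = 0" by metis
  have av: "a \<bullet> v F \<noteq> 0" if "F \<in> two_faces P" for F
    using sep[OF that] v[OF that] by (auto simp: separates_def)
  have kernel: "c \<bullet> v F = 0" if F: "F \<in> two_faces P" and c: "\<not> separates c b (dir_space F)" for c F
  proof -
    obtain x where x: "x \<in> dir_space F" "x \<noteq> 0" "c \<bullet> x = 0" "b \<bullet> x = 0" using c unfolding separates_iff by blast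
    then obtain k where "v F = k *\<^sub>R x"
      using separates_kernel_parallel[OF sep[OF F] subspace_dir_space, of x "v F"] v[OF F] by blast
    then show ?thesis using x(3) by simp
  qed
  \<comment> \<open>Orthogonal to \<open>a\<close> and \<open>b\<close>, which is possible in
    dimension at least 3. If \<open>c \<bullet> d0 \<noteq> 0\<close>, the moving vector can be a
    multiple of \<open>b\<close> only at \<open>t = 0\<close>, where it is \<open>a\<close>.\<close>
  obtain d0 where d0: "d0 \<noteq> 0" "a \<bullet> d0 = 0" "b \<bullet> d0 = 0"
  proof -
    have "dim {a, b} < DIM('a)" using dim_le_card[of "{a, b}" "{a, b}"] P(3) span_superset card_insert_le_m1[of 2 "{b}" a] by fastforce
    then obtain d where "d \<noteq> 0" "\<And>y. y \<in> span {a, b} \<Longrightarrow> orthogonal d y"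
      using orthogonal_to_subspace_exists[of "{a, b}"] by blast
    then show thesis using that[of d] by (simp add: orthogonal_def span_base inner_commute)
  qed
  \<comment> \<open>If \<open>F\<close> and \<open>G\<close> degenerate at the same
    \<open>t\<close>, eliminating \<open>1 - t\<close> from their two affine equations gives
    \<open>t * (c \<bullet> ?x F G) = 0\<close>; and \<open>t = 0\<close> is excluded because
    \<open>a\<close> separates.\<close>
  let ?x = "\<lambda>F G. (a \<bullet> v F) *\<^sub>R v G - (a \<bullet> v G) *\<^sub>R v F"
  let ?N = "{(F, G) \<in> two_faces P \<times> two_faces P. dir_space F \<noteq> dir_space G}"
  have x0: "?x F G \<noteq> 0" if FG: "F \<in> two_faces P" "G \<in> two_faces P" "dir_space F \<noteq> dir_space G" for F G
  proof
    assume "?x F G = 0"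
    then have eq: "(a \<bullet> v F) *\<^sub>R v G = (a \<bullet> v G) *\<^sub>R v F" by simp
    have "(a \<bullet> v F) *\<^sub>R v G \<in> dir_space F \<inter> dir_space G"
      using v[OF FG(1)] v[OF FG(2)] subspace_scale[OF subspace_dir_space] eq by (metis IntI)
    moreover have "b \<bullet> ((a \<bullet> v F) *\<^sub>R v G) = 0" using v[OF FG(2)] by simp
    ultimately have "(a \<bullet> v F) *\<^sub>R v G = 0" using gen FG unfolding generic_def by blast
    then show False using av[OF FG(1)] v[OF FG(2)] by simp
  qed
  let ?D = "insert d0 (v ` two_faces P \<union> (\<lambda>(F, G). ?x F G) ` ?N)"
  show thesis
  proof (rule that[of ?D])
    have "finite ?N" using finite_two_faces[OF P(1)] by (intro finite_subset[of ?N "two_faces P \<times> two_faces P"]) auto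
    then show "finite ?D" using finite_two_faces[OF P(1)] by blast
    have "v F \<noteq> 0" if "F \<in> two_faces P" for F using v[OF that] by blast
    then show "0 \<notin> ?D" using d0(1) x0 by fastforce
  next
    fix c assume c: "\<And>d. d \<in> ?D \<Longrightarrow> c \<bullet> d \<noteq> 0"
    have cd: "c \<bullet> d0 \<noteq> 0" using c by blast
    have cv: "c \<bullet> v F \<noteq> 0" if "F \<in> two_faces P" for F using c that by blast
    have cx: "c \<bullet> ?x F G \<noteq> 0" if "F \<in> two_faces P" "G \<in> two_faces P" "dir_space F \<noteq> dir_space G" for F G
    proof -
      have "(F, G) \<in> ?N" using that by blast
      then have "?x F G \<in> (\<lambda>(F, G). ?x F G) ` ?N" by (rule rev_image_eqI) simp
      then show ?thesis using c by blast
    qed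
    have sepc: "separates c b (dir_space F)" if "F \<in> two_faces P" for F
      using kernel[OF that] cv[OF that] by blast
    have b0: "b \<noteq> 0" and ab: "\<And>y. a \<noteq> y *\<^sub>R b" using ind dim_span_pair_eq_2 by blast+
    have indt: "dim (span {a + t *\<^sub>R (c - a), b}) = 2" for t
    proof -
      have "a + t *\<^sub>R (c - a) \<noteq> y *\<^sub>R b" for y
      proof
        assume eq: "a + t *\<^sub>R (c - a) = y *\<^sub>R b"
        then have "(a + t *\<^sub>R (c - a)) \<bullet> d0 = 0" using d0(3) by simp
        then have "t = 0" using d0(2) cd by (simp add: inner_add_left inner_diff_left)
        then show False using eq ab by simp
      qed
      then show ?thesis using b0 dim_span_pair_eq_2 by blast
    qed
    have par: "dir_space F = dir_space G" if F: "F \<in> two_faces P" and G: "G \<in> two_faces P"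
      and degF: "\<not> separates (a + t *\<^sub>R (c - a)) b (dir_space F)"
      and degG: "\<not> separates (a + t *\<^sub>R (c - a)) b (dir_space G)" for t F G
    proof (rule ccontr)
      assume ne: "dir_space F \<noteq> dir_space G"
      have 1: "a \<bullet> v F + t * (c \<bullet> v F - a \<bullet> v F) = 0"
        using kernel[OF F degF] by (simp add: inner_add_left inner_diff_left)
      have 2: "a \<bullet> v G + t * (c \<bullet> v G - a \<bullet> v G) = 0"
        using kernel[OF G degG] by (simp add: inner_add_left inner_diff_left)
      have "t * (c \<bullet> ?x F G) = 0"
        using 1 2 unfolding inner_diff_right inner_scaleR_right by algebra
      then have "t = 0" using cx[OF F G ne] by simp
      then show False using 1 av[OF F] by simp
    qed
    have "card (silhouette P (span {a, b})) = card (silhouette P (span {a + (c - a), b}))"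
      using gen sepc unfolding generic_def
      by (intro card_silhouette_sweep[OF P ori part _ indt par sep]) auto
    then show "(\<forall>F\<in>two_faces P. separates c b (dir_space F)) \<and>
      dim (span {c, b}) = 2 \<and> card (silhouette P (span {a, b})) = card (silhouette P (span {c, b}))"
      using sepc indt[of 1] by simp
  qed
qed

lemma exists_avoiding_vector:
  fixes D :: "'a::euclidean_space set"
  assumes "finite D" "0 \<notin> D"
  obtains c where "\<And>d. d \<in> D \<Longrightarrow> c \<bullet> d \<noteq> 0"
proof -
  have "\<exists>x\<in>UNIV. x \<bullet> d \<noteq> 0" if "d \<in> D" for d using that assms(2) by (intro bexI[of _ d]) auto
  then show thesis using exists_generic_vector[OF assms(1) subspace_UNIV] that by blast
qed

text \<open>The segment from \<open>a\<close> to \<open>a'\<close> may make several classes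
  degenerate at once, so both ends are joined to a third vector that avoids both finite sets of bad
  hyperplanes.\<close>

lemma card_silhouette_common_generic:
  fixes P :: "'a::euclidean_space set"
  assumes P: "polytope P" "aff_dim P = DIM('a)" "DIM('a) \<ge> 3"
    and ori: "orientation_choice P ori cyc" and part: "partitioned_into_compensating_pairs P ori cyc"
    and gen: "generic P b" and ind: "dim (span {a, b}) = 2" "dim (span {a', b}) = 2"
    and sep: "\<And>F. F \<in> two_faces P \<Longrightarrow> separates a b (dir_space F)"
      "\<And>F. F \<in> two_faces P \<Longrightarrow> separates a' b (dir_space F)"
  shows "card (silhouette P (span {a, b})) = card (silhouette P (span {a', b}))"
proof -
  obtain D where D: "finite D" "0 \<notin> D"
    "\<And>c. (\<And>d. d \<in> D \<Longrightarrow> c \<bullet> d \<noteq> 0) \<Longrightarrow> card (silhouette P (span {a, b})) = card (silhouette P (span {c, b}))"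
    using silhouette_of_generic_neighbour[OF P ori part gen ind(1) sep(1)] by metis
  obtain D' where D': "finite D'" "0 \<notin> D'"
    "\<And>c. (\<And>d. d \<in> D' \<Longrightarrow> c \<bullet> d \<noteq> 0) \<Longrightarrow> card (silhouette P (span {a', b})) = card (silhouette P (span {c, b}))"
    using silhouette_of_generic_neighbour[OF P ori part gen ind(2) sep(2)] by metis
  obtain c where "\<And>d. d \<in> D \<union> D' \<Longrightarrow> c \<bullet> d \<noteq> 0"
    using exists_avoiding_vector[of "D \<union> D'"] D(1,2) D'(1,2) by blast
  then show ?thesis using D(3)[of c] D'(3)[of c] by simp
qed

text \<open>A test vector orthogonal to all of \<open>W\<close> would make a 2-face degenerate. So
  none of the finitely many test hyperplanes contains \<open>W\<close>, and they do not cover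
  it.\<close>

lemma admissible_generic_basis:
  fixes P :: "'a::euclidean_space set"
  assumes P: "polytope P" "aff_dim P \<ge> 2" and adm: "admissible P W"
  obtains a b where "W = span {a, b}" "generic P b" "dim (span {a, b}) = 2"
    "\<And>F. F \<in> two_faces P \<Longrightarrow> separates a b (dir_space F)"
proof -
  have W: "subspace W" "dim W = 2" and nd: "\<And>F. F \<in> two_faces P \<Longrightarrow> \<not> degenerating W F"
    using adm by (auto simp: admissible_iff linear_plane_def)
  obtain D where D: "finite D" "\<And>d. d \<in> D \<Longrightarrow> d \<noteq> 0 \<and> (\<exists>F\<in>two_faces P. d \<in> dir_space F)"
    "\<And>b. (\<And>d. d \<in> D \<Longrightarrow> b \<bullet> d \<noteq> 0) \<Longrightarrow> generic P b"
    using generic_criterion[OF P] by metis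
  have "\<exists>x\<in>W. x \<bullet> d \<noteq> 0" if "d \<in> D" for d
    using D(2)[OF that] nd degenerating_iff[OF W(1)] by blast
  then obtain b where b: "b \<in> W" "\<And>d. d \<in> D \<Longrightarrow> b \<bullet> d \<noteq> 0"
    using exists_generic_vector[OF D(1) W(1)] by blast
  have gen: "generic P b" using D(3) b(2) by blast
  obtain e where "e edge_of P"
    using exists_face_aff_dim[OF P(1), of 1] P(2) by (auto simp: edge_of_def)
  then have b0: "b \<noteq> 0" using gen by (auto simp: generic_def edges_generic_def)
  have "\<not> W \<subseteq> span {b}"
    using dim_le_card[of W "{b}"] W(2) by auto
  then obtain a where a: "a \<in> W" "\<And>y. a \<noteq> y *\<^sub>R b" by (auto simp: span_singleton)
  have sW: "span {a, b} \<subseteq> W" using a(1) b(1) W(1) by (intro span_minimal) auto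
  have two: "dim (span {a, b}) = 2" using dim_span_pair_eq_2 b0 a(2) by blast
  then have "W = span {a, b}"
    using subspace_dim_equal[OF subspace_span W(1) sW] W(2) by simp
  then show thesis
    using that[of a b] gen two nd degenerating_span_iff by blast
qed

text \<open>The chain runs through \<open>{a, b}\<close>, \<open>{c, b}\<close>,
  \<open>{c, b'}\<close>, \<open>{a', b'}\<close>. In the middle the roles change: \<open>c\<close>
  is held fixed while \<open>b\<close> is exchanged for \<open>b'\<close>, so \<open>c\<close> must
  itself be generic.\<close>

lemma card_silhouette_admissible:
  fixes P :: "'a::euclidean_space set"
  assumes P: "polytope P" "aff_dim P = DIM('a)" "DIM('a) \<ge> 3"
    and ori: "orientation_choice P ori cyc" and part: "partitioned_into_compensating_pairs P ori cyc"
    and adm: "admissible P W" "admissible P W'"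
  shows "card (silhouette P W) = card (silhouette P W')"
proof -
  have P2: "aff_dim P \<ge> 2" using P by simp
  obtain a b where ab: "W = span {a, b}" "generic P b" "dim (span {a, b}) = 2"
    "\<And>F. F \<in> two_faces P \<Longrightarrow> separates a b (dir_space F)"
    using admissible_generic_basis[OF P(1) P2 adm(1)] by metis
  obtain a' b' where ab': "W' = span {a', b'}" "generic P b'" "dim (span {a', b'}) = 2"
    "\<And>F. F \<in> two_faces P \<Longrightarrow> separates a' b' (dir_space F)"
    using admissible_generic_basis[OF P(1) P2 adm(2)] by metis
  obtain D where D: "finite D" "0 \<notin> D" "\<And>c. (\<And>d. d \<in> D \<Longrightarrow> c \<bullet> d \<noteq> 0) \<Longrightarrow>
      (\<forall>F\<in>two_faces P. separates c b (dir_space F)) \<and> dim (span {c, b}) = 2 \<and>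
      card (silhouette P (span {a, b})) = card (silhouette P (span {c, b}))"
    using silhouette_of_generic_neighbour[OF P ori part ab(2-4)] by metis
  obtain D' where D': "finite D'" "0 \<notin> D'" "\<And>c. (\<And>d. d \<in> D' \<Longrightarrow> c \<bullet> d \<noteq> 0) \<Longrightarrow>
      (\<forall>F\<in>two_faces P. separates c b' (dir_space F)) \<and> dim (span {c, b'}) = 2 \<and>
      card (silhouette P (span {a', b'})) = card (silhouette P (span {c, b'}))"
    using silhouette_of_generic_neighbour[OF P ori part ab'(2-4)] by metis
  obtain D0 where D0: "finite D0" "\<And>d. d \<in> D0 \<Longrightarrow> d \<noteq> 0 \<and> (\<exists>F\<in>two_faces P. d \<in> dir_space F)"
    "\<And>b. (\<And>d. d \<in> D0 \<Longrightarrow> b \<bullet> d \<noteq> 0) \<Longrightarrow> generic P b"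
    using generic_criterion[OF P(1) P2] by metis
  obtain c where c: "\<And>d. d \<in> D \<union> D' \<union> D0 \<Longrightarrow> c \<bullet> d \<noteq> 0"
    using exists_avoiding_vector[of "D \<union> D' \<union> D0"] D(1,2) D'(1,2) D0(1,2) by blast
  have "generic P c" using D0(3) c by blast
  have 1: "(\<forall>F\<in>two_faces P. separates c b (dir_space F)) \<and> dim (span {c, b}) = 2 \<and>
      card (silhouette P (span {a, b})) = card (silhouette P (span {c, b}))" using D(3) c by blast
  have 2: "(\<forall>F\<in>two_faces P. separates c b' (dir_space F)) \<and> dim (span {c, b'}) = 2 \<and>
      card (silhouette P (span {a', b'})) = card (silhouette P (span {c, b'}))" using D'(3) c by blast
  have "card (silhouette P (span {b, c})) = card (silhouette P (span {b', c}))"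
    using 1 2 by (intro card_silhouette_common_generic[OF P ori part \<open>generic P c\<close>])
      (auto simp: insert_commute separates_def)
  then show ?thesis using 1 2 ab(1) ab'(1) by (simp add: insert_commute)
qed

theorem theorem4:
  fixes P :: "(real ^ 'n) set"
    and ori :: "(real ^ 'n) set \<Rightarrow> (real ^ 'n) ^ 3"
    and cyc :: "(real ^ 'n) set \<Rightarrow> ((real ^ 'n) \<times> (real ^ 'n)) set"
  assumes "CARD('n) \<ge> 3"
    and "polytope P"
    and "aff_dim P = int CARD('n)"
    and "orientation_choice P ori cyc"
    and "partitioned_into_compensating_pairs P ori cyc"
  shows "equiprojective P"
proof -
  have d: "aff_dim P = int DIM(real ^ 'n)" "DIM(real ^ 'n) \<ge> 3" using assms by simp_all
  show ?thesis
  proof (cases "\<exists>W. admissible P W")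
    case True
    then obtain W where W: "admissible P W" by blast
    have "k_equiprojective (card (silhouette P W)) P"
      unfolding k_equiprojective_def
    proof (intro allI impI)
      fix W' assume W': "admissible P W'"
      have "card (silhouette P W) = card (silhouette P W')"
        by (rule card_silhouette_admissible[OF assms(2) d assms(4,5) W W'])
      then show "k_gon (card (silhouette P W)) (orth_proj W' ` P)"
        using k_gon_card_silhouette[OF assms(2) d(1) _ W'] d(2) by simp
    qed
    then show ?thesis by (auto simp: equiprojective_def)
  next
    \<comment> \<open>With no admissible plane every \<open>k\<close> satisfies the requirement
      vacuously.\<close>
    case False
    then show ?thesis by (simp add: equiprojective_def k_equiprojective_def)
  qed
qed

end
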